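(* Let $T=\sum_{k=M}^N Q_k(z)D^k$, with $Q_k\in\mathbb{R}[z]$ and $Q_MQ_N\not\equiv 0$, be a non-degenerate hyperbolicity preserver with nonnegative Fuchs index $r$, let $n\ge M$ be an integer, and let $A\in\binom{[n+r-1]}{r}$. Then $v_{A,n}\ll v_{A+\mathbf{1},n}$, where $A+\mathbf{1}:=\{a+1:a\in A\}$. Moreover, if there is no $\theta\in\mathbb{R}$ for which $Q_1(\theta)=\cdots=Q_n(\theta)=0$, then $v_{A,n}$ and $v_{A+\mathbf{1},n}$ are co-prime, i.e., their zeros strictly interlace.
   Context: $D=d/dz$, $[m]=\{1,\dots,m\}$, $\binom{[m]}{s}$ is the set of $s$-element subsets of $[m]$, and $Q_k\equiv 0$ for $k<M$ or $k>N$. A nonzero polynomial in $\mathbb{R}[z]$ is hyperbolic if all its zeros are real. A linear operator $T:\mathbb{R}[z]\to\mathbb{R}[z]$ preserves hyperbolicity (is a hyperbolicity preserver) if $T(f)$ is hyperbolic or identically zero whenever $f$ is hyperbolic. The Fuchs index of $T$ is $r=\max_k(\deg Q_k-k)$ (over $k$ with $Q_k\not\equiv0$); $T$ is non-degenerate if $\deg Q_N=N+r$. Proper position of polynomials: the zeros $\alpha_1\le\cdots\le\alpha_p$ of $f$ and $\beta_1\le\cdots\le\beta_q$ of $g$ (hyperbolic, zeros with multiplicity) interlace if $\alpha_1\le\beta_1\le\alpha_2\le\beta_2\le\cdots$ or $\beta_1\le\alpha_1\le\beta_2\le\alpha_2\le\cdots$ (so $|p-q|\le1$; zeros of any two polynomials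 of degree $0$ or $1$ interlace). Write $f\ll g$ if the zeros of $f$ and $g$ interlace and $f'g-fg'\le 0$ on all of $\mathbb{R}$. The polynomials $f_{B,n}$, $v_{A,n}$: a pair $(v,f)$ of hyperbolic polynomials of degrees $r$ and $n$ has zero pattern $(A,B)$, where $A\cup B=[n+r]$ is a disjoint union with $|A|=r$, $|B|=n$, if, with $\alpha_1\le\cdots\le\alpha_{n+r}$ the zeros of $vf$, the zeros of $v$ are $\{\alpha_i:i\in A\}$ and those of $f$ are $\{\alpha_i:i\in B\}$ (as multisets). Given $A\in\binom{[n+r]}{r}$ and $B=[n+r]\setminus A$, let $a$ be the smallest zero of $Q_e$, $e=\min(n,N)$, put $f_0=(z-a)^n$, and recursively let $T(f_i)=v_{i+1}f_{i+1}$ be the unique factorization with $f_{i+1}$ monic and $(v_{i+1},f_{i+1})$ of zero pattern $(A,B)$. It is known that the limits $f_{B,n}:=\lim_i f_i$ and $v_{A,n}:=\lim_i v_i$ exist, that $T(f_{B,n})=v_{A,n}f_{B,n}$ with $f_{B,n}$ monic of degree $n$, and that $(v_{A,n},f_{B,n})$ has zero pattern $(A,B)$. *)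

theory Defs
  imports
    Complex_Main
    "HOL-Library.Multiset"
    "HOL-Computational_Algebra.Computational_Algebra"
begin

definition hyperbolic :: "real poly \<Rightarrow> bool" where
  "hyperbolic p \<longleftrightarrow> p \<noteq> 0 \<and> (\<forall>z::complex. poly (map_poly of_real p) z = 0 \<longrightarrow> z \<in> \<real>)"

definition preserves_hyperbolicity :: "(real poly \<Rightarrow> real poly) \<Rightarrow> bool" where
  "preserves_hyperbolicity T \<longleftrightarrow> (\<forall>f. hyperbolic f \<longrightarrow> T f = 0 \<or> hyperbolic (T f))"

definition diff_op :: "nat \<Rightarrow> nat \<Rightarrow> (nat \<Rightarrow> real poly) \<Rightarrow> real poly \<Rightarrow> real poly" where
  "diff_op M N Q f = (\<Sum>k=M..N. Q k * (pderiv ^^ k) f)"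

definition fuchs_index :: "nat \<Rightarrow> nat \<Rightarrow> (nat \<Rightarrow> real poly) \<Rightarrow> int" where
  "fuchs_index M N Q = Max ((\<lambda>k. int (degree (Q k)) - int k) ` {k \<in> {M..N}. Q k \<noteq> 0})"

definition nondegenerate :: "nat \<Rightarrow> nat \<Rightarrow> (nat \<Rightarrow> real poly) \<Rightarrow> bool" where
  "nondegenerate M N Q \<longleftrightarrow> int (degree (Q N)) = int N + fuchs_index M N Q"

text \<open>The real zeros in increasing order, repeated according to multiplicity; for a hyperbolic
  polynomial these are all its zeros.\<close>

definition zeros :: "real poly \<Rightarrow> real list" where
  "zeros p = sorted_list_of_multiset (proots p)"

text \<open>\<^term>\<open>splice xs ys\<close> is the list \<open>x1, y1, x2, y2, ...\<close>; the conditions on the lengths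
  exclude that it ends with two or more entries from the same list. With \<open>R\<close> being \<open>\<le>\<close> (or \<open><\<close>),
  this says that \<open>x1 R y1 R x2 R y2 R ...\<close>.\<close>

definition alternate :: "(real \<Rightarrow> real \<Rightarrow> bool) \<Rightarrow> real list \<Rightarrow> real list \<Rightarrow> bool" where
  "alternate R xs ys \<longleftrightarrow>
     length ys \<le> length xs \<and> length xs \<le> length ys + 1 \<and> sorted_wrt R (splice xs ys)"

definition interlace :: "real poly \<Rightarrow> real poly \<Rightarrow> bool" where
  "interlace f g \<longleftrightarrow> hyperbolic f \<and> hyperbolic g \<and>
     (alternate (\<le>) (zeros f) (zeros g) \<or> alternate (\<le>) (zeros g) (zeros f))"

definition strictly_interlace :: "real poly \<Rightarrow> real poly \<Rightarrow> bool" where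
  "strictly_interlace f g \<longleftrightarrow> hyperbolic f \<and> hyperbolic g \<and>
     (alternate (<) (zeros f) (zeros g) \<or> alternate (<) (zeros g) (zeros f))"

definition proper_position :: "real poly \<Rightarrow> real poly \<Rightarrow> bool" (infix "\<lless>" 50) where
  "f \<lless> g \<longleftrightarrow> interlace f g \<and> (\<forall>x. poly (pderiv f * g - f * pderiv g) x \<le> 0)"

text \<open>Indices of zeros start at 1, whereas list indices start at 0.\<close>

definition zero_pattern ::
    "nat \<Rightarrow> nat \<Rightarrow> nat set \<Rightarrow> nat set \<Rightarrow> real poly \<Rightarrow> real poly \<Rightarrow> bool" where
  "zero_pattern r n A B v f \<longleftrightarrow>
     A \<union> B = {1..n + r} \<and> A \<inter> B = {} \<and> card A = r \<and> card B = n \<and>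
     hyperbolic v \<and> hyperbolic f \<and> degree v = r \<and> degree f = n \<and>
     proots v = image_mset (\<lambda>i. zeros (v * f) ! (i - 1)) (mset_set A) \<and>
     proots f = image_mset (\<lambda>i. zeros (v * f) ! (i - 1)) (mset_set B)"

text \<open>The unique factorization \<open>p = v * f\<close> with \<open>f\<close> monic and \<open>(v, f)\<close> of zero pattern
  \<open>(A, [n + r] - A)\<close>; it exists if \<open>p\<close> is hyperbolic of degree \<open>n + r\<close>
  and \<open>A\<close> is an \<open>r\<close>-element subset of \<open>[n + r]\<close>.\<close>

definition pattern_factorization ::
    "nat \<Rightarrow> nat \<Rightarrow> nat set \<Rightarrow> real poly \<Rightarrow> real poly \<times> real poly" where
  "pattern_factorization r n A p =
     (THE (v, f). p = v * f \<and> lead_coeff f = 1 \<and> zero_pattern r n A ({1..n + r} - A) v f)"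

text \<open>The start \<open>a\<close> of the iteration. The polynomial \<open>Q e\<close> has no zero only if \<open>r = 0\<close> and
  \<open>n = 0\<close> or \<open>N = 0\<close>; then the value of \<open>a\<close> is irrelevant for the polynomials \<open>v\<close>.\<close>

definition start_point :: "nat \<Rightarrow> (nat \<Rightarrow> real poly) \<Rightarrow> nat \<Rightarrow> real" where
  "start_point N Q n = Min {x. poly (Q (min n N)) x = 0}"

primrec f_seq ::
    "nat \<Rightarrow> nat \<Rightarrow> (nat \<Rightarrow> real poly) \<Rightarrow> nat \<Rightarrow> nat \<Rightarrow> nat set \<Rightarrow> nat \<Rightarrow> real poly" where
  "f_seq M N Q r n A 0 = [:- start_point N Q n, 1:] ^ n"
| "f_seq M N Q r n A (Suc i) =
     snd (pattern_factorization r n A (diff_op M N Q (f_seq M N Q r n A i)))"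

text \<open>The entry with index \<open>i\<close> is the cofactor of \<open>f_seq M N Q r n A (Suc i)\<close>
  in the image of \<open>f_seq M N Q r n A i\<close>.\<close>

definition v_seq ::
    "nat \<Rightarrow> nat \<Rightarrow> (nat \<Rightarrow> real poly) \<Rightarrow> nat \<Rightarrow> nat \<Rightarrow> nat set \<Rightarrow> nat \<Rightarrow> real poly" where
  "v_seq M N Q r n A i =
     fst (pattern_factorization r n A (diff_op M N Q (f_seq M N Q r n A i)))"

text \<open>Coefficientwise limit; for sequences of bounded degree this is convergence in the usual
  topology of a finite-dimensional space.\<close>

definition poly_lim :: "(nat \<Rightarrow> real poly) \<Rightarrow> real poly" where
  "poly_lim s = (THE p. \<forall>k. (\<lambda>i. coeff (s i) k) \<longlonglongrightarrow> coeff p k)"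

definition v_poly ::
    "nat \<Rightarrow> nat \<Rightarrow> (nat \<Rightarrow> real poly) \<Rightarrow> nat \<Rightarrow> nat \<Rightarrow> nat set \<Rightarrow> real poly" where
  "v_poly M N Q r n A = poly_lim (v_seq M N Q r n A)"

end

theory Submission
  imports Defs "HOL-Analysis.Analysis"
begin

text \<open>The limit polynomials \<open>f\<close> and \<open>f'\<close> for \<open>A\<close> and \<open>A + 1\<close> are obtained by iterating from the same
  starting point. A hyperbolicity preserver maps two polynomials with a hyperbolic pencil to two such
  polynomials, and polynomials of equal degree with a hyperbolic pencil interlace; the order of
  interlacing is decided by the sums of the zeros. Hence the zeros of \<open>T f\<close> depend monotonically on
  those of \<open>f\<close>, which makes the iteration converge, and interlacing of the two iterates is inherited
  by the images, by the factors \<open>f\<close>, and by the factors \<open>v\<close>.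

  A common zero \<open>\<theta>\<close> of the two polynomials \<open>v\<close> is a zero of \<open>T f\<close> and of \<open>T f'\<close> that is not explained by
  \<open>f\<close> and \<open>f'\<close>. Freezing the coefficients of \<open>T\<close> at \<open>\<theta>\<close> gives a constant coefficient operator that is a
  product of factors \<open>D - \<rho>\<close>, and such an operator can create only simple zeros at \<open>\<theta>\<close>. So both zeros are
  simple, a suitable combination \<open>g\<close> of \<open>f\<close> and \<open>f'\<close> has an image with a double zero at \<open>\<theta>\<close>, and then \<open>g\<close>
  has a double zero at \<open>\<theta>\<close> although \<open>f(\<theta>) \<noteq> 0\<close>, which contradicts interlacing.\<close>

section \<open>Hyperbolic polynomials\<close>

text \<open>The obstacle is the order of interlacing. \<open>T\<close> multiplies differences of
  sums of zeros by \<open>lam (n - 1) / lam n\<close>, so it keeps the order only if this factor is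
  nonnegative. In large degrees it is, because \<open>lam\<close> is a polynomial in the degree.
  Applying \<open>T\<close> in these degrees alone already shows that the symbol, the sum of Q_k(z)
  w^k, has no zero with z in the upper and w in the lower half-plane. Its top coefficients
  \<open>c k\<close> then all have one sign, which settles the sign of \<open>lam\<close> in every
  degree. Interlacing is handled through sums of arctangents on the upper half-plane: there
  hyperbolicity of a pencil becomes a continuity argument, and the limit at the real axis counts
  zeros.\<close>

abbreviation cp :: "real poly \<Rightarrow> complex poly" where
  "cp \<equiv> map_poly of_real"

lemma cp_add: "cp (p + q) = cp p + cp q"
  by (rule poly_eqI) (simp add: coeff_map_poly)

lemma cp_diff: "cp (p - q) = cp p - cp q"
  by (rule poly_eqI) (simp add: coeff_map_poly)

lemma cp_mult: "cp (p * q) = cp p * cp q"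
  by (rule poly_eqI) (simp add: coeff_map_poly coeff_mult)

lemma cp_smult: "cp (smult c p) = smult (of_real c) (cp p)"
  by (rule poly_eqI) (simp add: coeff_map_poly)

lemma cp_pderiv: "cp (pderiv p) = pderiv (cp p)"
  by (rule poly_eqI) (simp add: coeff_map_poly coeff_pderiv)

lemma cp_sum: "cp (sum f A) = (\<Sum>x\<in>A. cp (f x))"
  by (induction A rule: infinite_finite_induct) (auto simp: cp_add)

lemma cp_higher_pderiv: "cp ((pderiv ^^ k) p) = (pderiv ^^ k) (cp p)"
  by (induction k) (auto simp: cp_pderiv)

lemma cp_eq_0_iff: "cp p = 0 \<longleftrightarrow> p = 0"
  by (auto simp: poly_eq_iff coeff_map_poly)

lemma poly_cp_of_real: "poly (cp p) (of_real x) = of_real (poly p x)"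
  by (induction p) (auto simp: map_poly_pCons)

lemma poly_cp_cnj: "poly (cp p) (cnj z) = cnj (poly (cp p) z)"
  by (induction p) (auto simp: map_poly_pCons)

section \<open>Polynomials with a prescribed multiset of zeros\<close>

definition monic_of :: "'a::idom multiset \<Rightarrow> 'a poly" where
  "monic_of X = (\<Prod>x\<in>#X. [:-x, 1:])"

lemma monic_of_empty [simp]: "monic_of {#} = 1"
  by (simp add: monic_of_def)

lemma monic_of_add_mset: "monic_of (add_mset x X) = [:-x, 1:] * monic_of X"
  by (simp add: monic_of_def)

lemma monic_of_union: "monic_of (X + Y) = monic_of X * monic_of Y"
  by (simp add: monic_of_def)

lemma monic_of_replicate: "monic_of (replicate_mset n x) = [:-x, 1:] ^ n"
  by (simp add: monic_of_def)

lemma monic_of_nz [simp]: "monic_of X \<noteq> 0"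
  by (induction X) (auto simp: monic_of_add_mset simp del: mult_pCons_left)

lemma degree_monic_of [simp]: "degree (monic_of X) = size X"
  by (induction X) (auto simp: monic_of_add_mset degree_mult_eq simp del: mult_pCons_left)

lemma lead_coeff_monic_of [simp]: "coeff (monic_of X) (size X) = 1"
proof -
  have "lead_coeff (monic_of X) = 1"
    by (induction X) (auto simp: monic_of_add_mset lead_coeff_mult simp del: degree_monic_of mult_pCons_left)
  then show ?thesis by simp
qed

lemma proots_monic_of [simp]: "proots (monic_of X) = X"
  by (induction X) (auto simp: monic_of_add_mset proots_mult simp del: mult_pCons_left)

lemma poly_monic_of: "poly (monic_of X) z = (\<Prod>x\<in>#X. z - x)"
  by (induction X) (auto simp: monic_of_add_mset algebra_simps)

lemma poly_cp_monic_of: "poly (cp (monic_of X)) z = (\<Prod>x\<in>#X. z - of_real x)"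
  by (induction X) (auto simp: monic_of_add_mset cp_mult map_poly_pCons simp del: mult_pCons_left)

text \<open>Vieta's formula: sums of zeros can be compared through one coefficient, on which
  \<open>T\<close> acts linearly.\<close>

lemma monic_of_coeff_penultimate:
  "size X = Suc n \<Longrightarrow> coeff (monic_of X) n = - sum_mset X"
proof (induction X arbitrary: n)
  case (add x X)
  show ?case
  proof (cases n)
    case 0
    with add.prems have "X = {#}" by simp
    with 0 show ?thesis by (simp add: monic_of_add_mset)
  next
    case (Suc m)
    with add have "coeff (monic_of X) m = - sum_mset X" "size X = Suc m" by auto
    with lead_coeff_monic_of[of X] Suc show ?thesis
      by (simp add: monic_of_add_mset)
  qed
qed auto

lemma hyperbolic_smult: "c \<noteq> 0 \<Longrightarrow> hyperbolic (smult c p) \<longleftrightarrow> hyperbolic p"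
  by (auto simp: hyperbolic_def cp_smult)

lemma hyperbolic_mult: "hyperbolic (p * q) \<longleftrightarrow> hyperbolic p \<and> hyperbolic q"
  by (auto simp: hyperbolic_def cp_mult)

lemma hyperbolic_monic_of: "hyperbolic (monic_of X)"
proof -
  have "z \<in> \<real>" if "poly (cp (monic_of X)) z = 0" for z
    using that by (auto simp: poly_cp_monic_of)
  then show ?thesis by (simp add: hyperbolic_def)
qed

lemma hyperbolic_ex:
  assumes "hyperbolic p" shows "\<exists>X. p = smult (lead_coeff p) (monic_of X)"
  using assms
proof (induction "degree p" arbitrary: p)
  case 0
  then have "p = [:lead_coeff p:]" by (simp add: degree_eq_zeroE)
      (metis degree_pCons_0 degree_eq_zeroE lead_coeff_pCons(2) pCons_0_0 coeff_pCons_0)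
  then show ?case by (intro exI[of _ "{#}"]) (simp add: smult_one)
next
  case (Suc d)
  have "degree (cp p) = degree p" by (intro degree_map_poly) auto
  then have "\<exists>z. poly (cp p) z = 0"
    using Suc.hyps(2) fundamental_theorem_of_algebra[of "cp p"] constant_degree[of "cp p"] by auto
  then obtain x where x: "poly (cp p) (of_real x) = 0"
    using Suc.prems by (auto simp: hyperbolic_def elim!: Reals_cases)
  then have "poly p x = 0" by (simp add: poly_cp_of_real)
  then obtain q where q: "p = [:-x, 1:] * q" by (auto simp: poly_eq_0_iff_dvd elim: dvdE)
  with Suc.prems have hq: "hyperbolic q" by (metis hyperbolic_mult)
  then have "q \<noteq> 0" by (auto simp: hyperbolic_def)
  with q Suc.hyps(2) have "d = degree q" by (simp add: degree_mult_eq del: mult_pCons_left)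
  from Suc.hyps(1)[OF this hq] obtain X where X: "q = smult (lead_coeff q) (monic_of X)" by auto
  have "lead_coeff p = lead_coeff q" unfolding q lead_coeff_mult by simp
  with X q show ?case by (intro exI[of _ "add_mset x X"]) (metis monic_of_add_mset mult_smult_right)
qed

lemma hyperbolic_decompose:
  assumes "hyperbolic p" shows "p = smult (lead_coeff p) (monic_of (proots p))"
proof -
  obtain X where X: "p = smult (lead_coeff p) (monic_of X)" using hyperbolic_ex[OF assms] by auto
  moreover have "lead_coeff p \<noteq> 0" using assms by (auto simp: hyperbolic_def)
  ultimately have "proots p = X" by (metis proots_smult proots_monic_of)
  with X show ?thesis by simp
qed

lemma hyperbolic_size_proots:
  assumes "hyperbolic p" shows "size (proots p) = degree p"
proof -
  have "lead_coeff p \<noteq> 0" using assms by (auto simp: hyperbolic_def)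
  then show ?thesis using hyperbolic_decompose[OF assms]
    by (metis degree_monic_of degree_smult_eq)
qed

text \<open>The nonreal zeros of a real polynomial come in conjugate pairs.\<close>

lemma hyperbolic_if_upper:
  assumes "p \<noteq> 0" "\<And>z. Im z > 0 \<Longrightarrow> poly (cp p) z \<noteq> 0"
  shows "hyperbolic p"
  unfolding hyperbolic_def
proof (intro conjI allI impI assms(1))
  fix z assume z: "poly (cp p) z = 0"
  then have "poly (cp p) (cnj z) = 0" by (simp add: poly_cp_cnj)
  with z assms(2)[of z] assms(2)[of "cnj z"] have "Im z = 0" by force
  then show "z \<in> \<real>" by (simp add: complex_is_Real_iff)
qed

lemma hyperbolic_upper: "hyperbolic p \<Longrightarrow> Im z > 0 \<Longrightarrow> poly (cp p) z \<noteq> 0"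
  by (auto simp: hyperbolic_def complex_is_Real_iff)

text \<open>For polynomials without zeros in the upper half-plane the modulus increases along vertical
  rays; in this form the property passes to pointwise limits.\<close>

definition upper_mono :: "(complex \<Rightarrow> complex) \<Rightarrow> bool" where
  "upper_mono g \<longleftrightarrow>
    (\<forall>x y y'. 0 \<le> y' \<and> y' \<le> y \<longrightarrow> cmod (g (Complex x y')) \<le> cmod (g (Complex x y)))"

lemma prod_mset_mono_cmod:
  assumes "\<And>x. x \<in># X \<Longrightarrow> cmod (f x) \<le> cmod (g x)"
  shows "cmod (\<Prod>x\<in>#X. f x) \<le> cmod (\<Prod>x\<in>#X. g x)"
  using assms by (induction X) (auto simp: norm_mult intro!: mult_mono)

text \<open>All zeros have imaginary part at most 0, so moving upwards from the real axis increases
  the distance to each of them.\<close>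

lemma upper_mono_poly:
  fixes p :: "complex poly"
  assumes "\<And>z. Im z > 0 \<Longrightarrow> poly p z \<noteq> 0"
  shows "upper_mono (poly p)"
  unfolding upper_mono_def
proof (intro allI impI)
  fix x y y' :: real assume y: "0 \<le> y' \<and> y' \<le> y"
  have dec: "poly p z = lead_coeff p * (\<Prod>x\<in>#proots p. z - x)" for z
    by (subst complex_poly_decompose_multiset[of p, symmetric])
       (simp add: poly_monic_of[unfolded monic_of_def] del: complex_poly_decompose_multiset)
  have p: "p \<noteq> 0" using assms[of \<i>] by auto
  have "cmod (Complex x y' - c) \<le> cmod (Complex x y - c)" if "c \<in># proots p" for c
  proof -
    have "poly p c = 0" using that p by simp
    then have "Im c \<le> 0" using assms[of c] by force
    then have "\<bar>y' - Im c\<bar> \<le> \<bar>y - Im c\<bar>" using y by auto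
    then have "(y' - Im c)\<^sup>2 \<le> (y - Im c)\<^sup>2" by (rule power2_mono) 
    then show ?thesis by (simp add: cmod_def)
  qed
  then show "cmod (poly p (Complex x y')) \<le> cmod (poly p (Complex x y))"
    unfolding dec norm_mult by (intro mult_left_mono prod_mset_mono_cmod) auto
qed

lemma upper_mono_tendsto:
  assumes "F \<noteq> bot" "eventually (\<lambda>i. upper_mono (g i)) F" "\<And>z. ((\<lambda>i. g i z) \<longlongrightarrow> h z) F"
  shows "upper_mono h"
  unfolding upper_mono_def
proof (intro allI impI)
  fix x y y' :: real assume y: "0 \<le> y' \<and> y' \<le> y"
  have "eventually (\<lambda>i. cmod (g i (Complex x y')) \<le> cmod (g i (Complex x y))) F"
    using assms(2) by eventually_elim (use y in \<open>auto simp: upper_mono_def\<close>)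
  with assms(1) show "cmod (h (Complex x y')) \<le> cmod (h (Complex x y))"
    by (intro tendsto_le[OF _ tendsto_norm[OF assms(3)] tendsto_norm[OF assms(3)]])
qed

text \<open>A substitute for Hurwitz's theorem: a zero in the open upper half-plane would force
  zeros on the whole vertical segment below it. The zero-free weight \<open>E\<close> makes room for
  the exponential that arises as the limit of \<open>(1 + a / m) ^ m\<close>.\<close>

lemma upper_mono_nonzero:
  fixes p :: "complex poly"
  assumes "upper_mono (\<lambda>z. E z * poly p z)" "\<And>z. E z \<noteq> 0" "p \<noteq> 0" "Im z > 0"
  shows "poly p z \<noteq> 0"
proof
  assume 0: "poly p z = 0"
  have "poly p (Complex (Re z) y) = 0" if "y \<in> {0..Im z}" for y
  proof -
    have "cmod (E (Complex (Re z) y) * poly p (Complex (Re z) y)) \<le> cmod (E z * poly p z)"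
      using assms(1) that unfolding upper_mono_def by (metis atLeastAtMost_iff complex_surj)
    with 0 assms(2) show ?thesis by auto
  qed
  then have "Complex (Re z) ` {0..Im z} \<subseteq> {z. poly p z = 0}" by auto
  moreover have "finite {z. poly p z = 0}" using assms(3) by (rule poly_roots_finite)
  ultimately have "finite (Complex (Re z) ` {0..Im z})" by (rule finite_subset)
  then have "finite {0..Im z}" by (rule finite_imageD) (auto simp: inj_on_def)
  with infinite_Icc[OF assms(4)] show False by simp
qed

lemma hyperbolic_tendsto:
  assumes "F \<noteq> bot" "eventually (\<lambda>i. g i = 0 \<or> hyperbolic (g i)) F"
    "\<And>z. ((\<lambda>i. poly (cp (g i)) z) \<longlongrightarrow> poly (cp p) z) F"
  shows "p = 0 \<or> hyperbolic p"
proof -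
  have "eventually (\<lambda>i. upper_mono (poly (cp (g i)))) F"
    using assms(2)
  proof eventually_elim
    case (elim i)
    then show ?case
    proof
      assume "hyperbolic (g i)"
      then show ?case by (intro upper_mono_poly hyperbolic_upper)
    qed (auto simp: upper_mono_def)
  qed
  from upper_mono_tendsto[OF assms(1) this assms(3)] have "upper_mono (\<lambda>z. 1 * poly (cp p) z)" by simp
  then have "poly (cp p) z \<noteq> 0" if "p \<noteq> 0" "Im z > 0" for z
    using that by (intro upper_mono_nonzero[of "\<lambda>_. 1"]) (auto simp: cp_eq_0_iff)
  then show ?thesis using hyperbolic_if_upper by blast
qed

definition pencil :: "real poly \<Rightarrow> real poly \<Rightarrow> bool" where
  "pencil f g \<longleftrightarrow> (\<forall>a b. smult a f + smult b g = 0 \<or> hyperbolic (smult a f + smult b g))"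

section \<open>Pencils and interlacing\<close>

text \<open>The number \<open>arctan ((a - x) / b)\<close> is \<open>pi / 2\<close> minus the argument of \<open>a + ib - x\<close>. Thus the quotient
  of two monic polynomials of equal degree is real at \<open>a + ib\<close> exactly if the difference of the
  angle sums is a multiple of \<open>pi\<close>.\<close>

definition ang :: "real multiset \<Rightarrow> real \<Rightarrow> real \<Rightarrow> real" where
  "ang X a b = (\<Sum>x\<in>#X. arctan ((a - x) / b))"

lemma ang_empty [simp]: "ang {#} a b = 0"
  by (simp add: ang_def)

lemma ang_add_mset [simp]: "ang (add_mset x X) a b = arctan ((a - x) / b) + ang X a b"
  by (simp add: ang_def)

lemma linear_factor_polar:
  assumes "b > 0"
  shows "Complex a b - of_real x
    = of_real (cmod (Complex a b - of_real x)) * cis (pi / 2 - arctan ((a - x) / b))"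
proof -
  define t where "t = (a - x) / b"
  have at: "a - x = b * t" using assms by (simp add: t_def)
  have "cmod (Complex a b - of_real x) = sqrt ((b * t)\<^sup>2 + b\<^sup>2)" by (simp add: cmod_def at)
  also have "(b * t)\<^sup>2 + b\<^sup>2 = b\<^sup>2 * (1 + t\<^sup>2)" by (simp add: algebra_simps power2_eq_square)
  finally have c: "cmod (Complex a b - of_real x) = b * sqrt (1 + t\<^sup>2)"
    using assms by (simp add: real_sqrt_mult)
  have s: "sqrt (1 + t\<^sup>2) > 0" by (smt (verit) real_sqrt_gt_zero zero_le_power2)
  have "cis (pi / 2 - arctan t) = Complex (t / sqrt (1 + t\<^sup>2)) (1 / sqrt (1 + t\<^sup>2))"
    by (simp add: complex_eq_iff cos_diff sin_diff sin_arctan cos_arctan)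
  then show ?thesis using s at unfolding c t_def[symmetric]
    by (simp add: complex_eq_iff)
qed

lemma monic_of_polar:
  assumes "b > 0"
  shows "poly (cp (monic_of X)) (Complex a b)
    = of_real (cmod (poly (cp (monic_of X)) (Complex a b)))
      * cis (real (size X) * (pi / 2) - ang X a b)"
proof (induction X)
  case empty
  then show ?case by simp
next
  case (add x X)
  let ?z = "Complex a b"
  have e: "poly (cp (monic_of (add_mset x X))) ?z = (?z - of_real x) * poly (cp (monic_of X)) ?z"
    by (simp add: poly_cp_monic_of)
  have s: "cis (real (size (add_mset x X)) * (pi / 2) - ang (add_mset x X) a b)
     = cis (pi / 2 - arctan ((a - x) / b)) * cis (real (size X) * (pi / 2) - ang X a b)"
    by (simp add: cis_mult algebra_simps add_divide_distrib)
  show ?case unfolding e s norm_mult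
    by (subst linear_factor_polar[OF assms], subst add.IH) simp
qed

text \<open>The product with the conjugate has the argument of the quotient and avoids a division;
  equal sizes make the multiples of pi / 2 cancel.\<close>

lemma Im_monic_of_mult_cnj:
  assumes "b > 0" "size X = size Y"
  shows "Im (poly (cp (monic_of X)) (Complex a b) * cnj (poly (cp (monic_of Y)) (Complex a b)))
    = - (cmod (poly (cp (monic_of X)) (Complex a b)) * cmod (poly (cp (monic_of Y)) (Complex a b))
        * sin (ang X a b - ang Y a b))"
proof -
  let ?P = "poly (cp (monic_of X)) (Complex a b)" and ?Q = "poly (cp (monic_of Y)) (Complex a b)"
  let ?c = "real (size Y) * (pi / 2)"
  have "?P * cnj ?Q = of_real (cmod ?P * cmod ?Q) * (cis (?c - ang X a b) * cnj (cis (?c - ang Y a b)))"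
    by (subst monic_of_polar[OF assms(1)], subst (2) monic_of_polar[OF assms(1)]) (simp add: assms(2))
  also have "cis (?c - ang X a b) * cnj (cis (?c - ang Y a b)) = cis (- (ang X a b - ang Y a b))"
    by (simp add: cis_cnj cis_mult)
  finally have "Im (?P * cnj ?Q) = cmod ?P * cmod ?Q * sin (- (ang X a b - ang Y a b))" by simp
  then show ?thesis unfolding sin_minus by simp
qed

text \<open>Interlacing in disguise, with \<open>X\<close> starting on the left, see
  \<open>interlaced_ang_le\<close> and \<open>ang_le_interlaced\<close>: the quotient of the two
  polynomials maps the upper half-plane into the open lower one. Equal multisets need their own
  clause, as their angle difference is 0.\<close>

definition ang_le :: "real multiset \<Rightarrow> real multiset \<Rightarrow> bool" where
  "ang_le X Y \<longleftrightarrow> size X = size Y \<and>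
    (X = Y \<or> (\<forall>a b. b > 0 \<longrightarrow> 0 < ang X a b - ang Y a b \<and> ang X a b - ang Y a b < pi))"

lemma monic_of_upper_nz: "Im z > 0 \<Longrightarrow> poly (cp (monic_of X)) z \<noteq> 0"
  by (intro hyperbolic_upper hyperbolic_monic_of)

lemma ang_le_Im:
  assumes "ang_le X Y" "Im z > 0"
  shows "Im (poly (cp (monic_of X)) z * cnj (poly (cp (monic_of Y)) z)) \<le> 0"
proof (cases "X = Y")
  case True
  then show ?thesis by (simp add: complex_mult_cnj)
next
  case False
  then have "0 < ang X (Re z) (Im z) - ang Y (Re z) (Im z)" "ang X (Re z) (Im z) - ang Y (Re z) (Im z) < pi"
    using assms by (auto simp: ang_le_def)
  then have "sin (ang X (Re z) (Im z) - ang Y (Re z) (Im z)) > 0" by (rule sin_gt_zero)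
  then show ?thesis using Im_monic_of_mult_cnj[of "Im z" X Y "Re z"] assms
    by (auto simp: ang_le_def)
qed

lemma ang_le_pencil:
  assumes "ang_le X Y"
  shows "pencil (monic_of X) (monic_of Y)"
  unfolding pencil_def
proof (intro allI)
  fix \<alpha> \<beta>
  let ?h = "smult \<alpha> (monic_of X) + smult \<beta> (monic_of Y)"
  show "?h = 0 \<or> hyperbolic ?h"
  proof (cases "X = Y")
    case True
    then have "?h = smult (\<alpha> + \<beta>) (monic_of X)" by (simp add: smult_add_left)
    then show ?thesis by (cases "\<alpha> + \<beta> = 0") (auto simp: hyperbolic_smult hyperbolic_monic_of)
  next
    case False
    have "poly (cp ?h) z \<noteq> 0" if "?h \<noteq> 0" "Im z > 0" for z
    proof
      let ?P = "poly (cp (monic_of X)) z" and ?Q = "poly (cp (monic_of Y)) z"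
      assume "poly (cp ?h) z = 0"
      then have 0: "of_real \<alpha> * ?P + of_real \<beta> * ?Q = 0" by (simp add: cp_add cp_smult)
      have nz: "?P \<noteq> 0" "?Q \<noteq> 0" using that monic_of_upper_nz by blast+
      have "\<alpha> \<noteq> 0" using 0 nz that by auto
      then have "?P = of_real (- (\<beta> / \<alpha>)) * ?Q" using 0 by (simp add: field_simps add_eq_0_iff)
      then have "Im (?P * cnj ?Q) = Im (of_real (- (\<beta> / \<alpha>)) * (?Q * cnj ?Q))" by (simp add: algebra_simps)
      also have "\<dots> = 0" by (simp add: complex_mult_cnj)
      finally have I: "Im (?P * cnj ?Q) = 0" .
      have "0 < ang X (Re z) (Im z) - ang Y (Re z) (Im z)" "ang X (Re z) (Im z) - ang Y (Re z) (Im z) < pi"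
        using assms that False by (auto simp: ang_le_def)
      then have "sin (ang X (Re z) (Im z) - ang Y (Re z) (Im z)) > 0" by (rule sin_gt_zero)
      with I nz Im_monic_of_mult_cnj[of "Im z" X Y "Re z"] assms that show False
        by (auto simp: ang_le_def)
    qed
    then show ?thesis using hyperbolic_if_upper by blast
  qed
qed

text \<open>At a multiple of pi the quotient of the two polynomials would be a real number \<kappa>.
  The member \<open>monic_of X - \<kappa> monic_of Y\<close> of the pencil then vanishes off the
  real axis, hence identically.\<close>

lemma pencil_sin_nonzero:
  assumes p: "pencil (monic_of X) (monic_of Y)" and s: "size X = size Y" and ne: "X \<noteq> Y" and b: "b > 0"
  shows "sin (ang X a b - ang Y a b) \<noteq> 0"
proof
  let ?z = "Complex a b"
  let ?P = "poly (cp (monic_of X)) ?z" and ?Q = "poly (cp (monic_of Y)) ?z"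
  assume "sin (ang X a b - ang Y a b) = 0"
  then have "Im (?P * cnj ?Q) = 0" using Im_monic_of_mult_cnj[OF b s] by simp
  then obtain r where r: "?P * cnj ?Q = of_real r" by (metis complex_is_Real_iff Reals_cases)
  have nz: "?Q \<noteq> 0" using b by (intro monic_of_upper_nz) auto
  define \<kappa> where "\<kappa> = r / (cmod ?Q)\<^sup>2"
  have "?P * (cnj ?Q * ?Q) = of_real r * ?Q" using r by (simp add: algebra_simps)
  then have "?P * of_real ((cmod ?Q)\<^sup>2) = of_real r * ?Q"
    by (metis complex_norm_square mult.commute)
  then have "?P = of_real \<kappa> * ?Q" using nz by (simp add: \<kappa>_def field_simps)
  then have 0: "poly (cp (smult 1 (monic_of X) + smult (-\<kappa>) (monic_of Y))) ?z = 0"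
    by (simp add: cp_add cp_diff cp_smult)
  have "smult 1 (monic_of X) + smult (-\<kappa>) (monic_of Y) = 0"
    using p hyperbolic_upper[OF _ _, of _ ?z] 0 b unfolding pencil_def by fastforce
  then have e: "monic_of X = smult \<kappa> (monic_of Y)" by simp
  from arg_cong[OF this, of "\<lambda>p. coeff p (size X)"] have "\<kappa> = 1"
    using s lead_coeff_monic_of[of X] lead_coeff_monic_of[of Y] by (simp del: lead_coeff_monic_of)
  with e have "monic_of X = monic_of Y" by simp
  then show False using ne by (metis proots_monic_of)
qed

lemma ang_tendsto_0: "((\<lambda>b. ang X a b) \<longlongrightarrow> 0) at_top"
proof (induction X)
  case (add x X)
  have "((\<lambda>b. arctan ((a - x) / b)) \<longlongrightarrow> arctan 0) at_top"
    by (intro tendsto_arctan tendsto_divide_0[OF tendsto_const] filterlim_at_top_imp_at_infinity filterlim_ident)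
  from tendsto_add[OF this add] show ?case by simp
qed simp

lemma ang_continuous:
  assumes "continuous_on S f" "continuous_on S g" "\<And>t. t \<in> S \<Longrightarrow> g t \<noteq> 0"
  shows "continuous_on S (\<lambda>t. ang X (f t) (g t))"
proof (induction X)
  case (add x X)
  then show ?case using assms by (auto intro!: continuous_intros)
qed simp

text \<open>The angle difference tends to 0 as \<open>b\<close> grows and never meets a multiple of
  pi. By the intermediate value theorem on vertical rays it stays below pi in modulus; on segments,
  which do not leave the convex upper half-plane, it keeps its sign.\<close>

lemma pencil_ang_le:
  assumes p: "pencil (monic_of X) (monic_of Y)" and s: "size X = size Y"
  shows "ang_le X Y \<or> ang_le Y X"
proof (cases "X = Y")
  case False
  define S where "S = (\<lambda>a b. ang X a b - ang Y a b)"
  have sin: "sin (S a b) \<noteq> 0" if "b > 0" for a b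
    using pencil_sin_nonzero[OF p s False that] by (simp add: S_def)
  have bd: "\<bar>S a b\<bar> < pi" if b: "b > 0" for a b
  proof (rule ccontr)
    assume c: "\<not> \<bar>S a b\<bar> < pi"
    have "((\<lambda>b. \<bar>S a b\<bar>) \<longlongrightarrow> \<bar>0 - 0\<bar>) at_top"
      unfolding S_def by (intro tendsto_intros ang_tendsto_0)
    then have "eventually (\<lambda>b. \<bar>S a b\<bar> < pi) at_top"
      by (rule order_tendstoD) simp
    then have "eventually (\<lambda>b'. \<bar>S a b'\<bar> < pi \<and> b \<le> b') at_top"
      by (intro eventually_conj eventually_ge_at_top)
    then obtain B where B: "\<bar>S a B\<bar> < pi" "b \<le> B"
      unfolding eventually_at_top_linorder by blast
    have "continuous_on {b..B} (\<lambda>b. \<bar>S a b\<bar>)"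
      unfolding S_def using b by (intro continuous_intros ang_continuous) auto
    then obtain b' where "b \<le> b'" "b' \<le> B" "\<bar>S a b'\<bar> = pi"
      using IVT2'[of "\<lambda>b. \<bar>S a b\<bar>" B pi b] B c by auto
    then have "sin (S a b') = 0" by (auto simp: abs_if split: if_splits) (metis sin_minus sin_pi minus_zero minus_minus)
    then show False using sin b \<open>b \<le> b'\<close> by force
  qed
  have nz: "S a b \<noteq> 0" if "b > 0" for a b using sin[OF that] by (metis sin_zero)
  have same: "S a b > 0" if ab: "b > 0" "b' > 0" "S a' b' > 0" for a b a' b'
  proof (rule ccontr)
    assume n: "\<not> S a b > 0"
    define f g where "f = (\<lambda>t. a + t * (a' - a))" and "g = (\<lambda>t. b + t * (b' - b))"
    have g: "g t > 0" if "t \<in> {0..1}" for t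
    proof -
      have "g t = (1 - t) * b + t * b'" by (simp add: g_def algebra_simps)
      moreover have "(1 - t) * b \<ge> 0" "t * b' \<ge> 0" using that ab by auto
      moreover have "(1 - t) * b > 0 \<or> t * b' > 0" using that ab by (cases "t = 1") auto
      ultimately show ?thesis by linarith
    qed
    have "continuous_on {0..1} (\<lambda>t. S (f t) (g t))"
      unfolding S_def using g
      by (intro continuous_intros ang_continuous) (auto simp: f_def g_def less_imp_neq[symmetric] intro!: continuous_intros)
    moreover have "S (f 0) (g 0) \<le> 0" "0 \<le> S (f 1) (g 1)" using n ab by (auto simp: f_def g_def)
    ultimately obtain t where "0 \<le> t" "t \<le> 1" "S (f t) (g t) = 0"
      using IVT'[of "\<lambda>t. S (f t) (g t)" 0 0 1] by auto
    then show False using nz[OF g] by auto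
  qed
  show ?thesis
  proof (cases "\<exists>a b. b > 0 \<and> S a b > 0")
    case True
    then have "\<forall>a b. b > 0 \<longrightarrow> S a b > 0" using same by blast
    then have "ang_le X Y" using s bd unfolding ang_le_def S_def abs_less_iff by blast
    then show ?thesis ..
  next
    case False
    then have "\<forall>a b. b > 0 \<longrightarrow> S a b < 0" using nz by (meson linorder_neqE_linordered_idom)
    then have "0 < ang Y a b - ang X a b \<and> ang Y a b - ang X a b < pi" if "b > 0" for a b
      using bd[OF that, of a] that by (auto simp: S_def abs_less_iff)
    then have "ang_le Y X" using s by (auto simp: ang_le_def)
    then show ?thesis ..
  qed
qed (auto simp: ang_le_def)

section \<open>Angle sums and interlacing of sorted lists\<close>

definition interlaced :: "real list \<Rightarrow> real list \<Rightarrow> bool" where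
  "interlaced xs ys \<longleftrightarrow> length xs = length ys \<and> (\<forall>j<length xs. xs ! j \<le> ys ! j) \<and>
     (\<forall>j. Suc j < length xs \<longrightarrow> ys ! j \<le> xs ! Suc j)"

lemma ang_mset: "ang (mset xs) a b = (\<Sum>j<length xs. arctan ((a - xs ! j) / b))"
proof -
  have "ang (mset xs) a b = sum_list (map (\<lambda>x. arctan ((a - x) / b)) xs)"
    by (simp add: ang_def sum_mset_sum_list flip: mset_map)
  then show ?thesis by (simp add: sum_list_sum_nth atLeast0LessThan)
qed

text \<open>Comparing \<open>xs ! j\<close> with \<open>ys ! j\<close> gives positivity. For the
  upper bound \<open>xs ! Suc j\<close> is compared with \<open>ys ! j\<close>, which leaves only
  the first entry of \<open>xs\<close> and the last of \<open>ys\<close>, and two arctangents differ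
  by less than pi.\<close>

lemma interlaced_ang_le:
  assumes "interlaced xs ys"
  shows "ang_le (mset xs) (mset ys)"
proof (cases "xs = ys")
  case False
  have l: "length xs = length ys" and le: "\<And>j. j < length ys \<Longrightarrow> xs ! j \<le> ys ! j"
    and le': "\<And>j. Suc j < length ys \<Longrightarrow> ys ! j \<le> xs ! Suc j" using assms by (auto simp: interlaced_def)
  obtain i where i: "i < length ys" "xs ! i \<noteq> ys ! i" using False l nth_equalityI by metis
  have "0 < ang (mset xs) a b - ang (mset ys) a b \<and> ang (mset xs) a b - ang (mset ys) a b < pi" if "b > 0" for a b
  proof
    let ?g = "\<lambda>x. arctan ((a - x) / b)"
    have S: "ang (mset xs) a b - ang (mset ys) a b = (\<Sum>j<length ys. ?g (xs ! j)) - (\<Sum>j<length ys. ?g (ys ! j))"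
      by (simp add: ang_mset l)
    have "(\<Sum>j<length ys. ?g (ys ! j)) < (\<Sum>j<length ys. ?g (xs ! j))"
    proof (rule sum_strict_mono_ex1)
      show "\<forall>j\<in>{..<length ys}. ?g (ys ! j) \<le> ?g (xs ! j)"
        using le that by (auto simp: arctan_le_iff divide_right_mono)
      have "xs ! i < ys ! i" using i le[of i] by auto
      then show "\<exists>j\<in>{..<length ys}. ?g (ys ! j) < ?g (xs ! j)"
        using i that by (intro bexI[of _ i]) (auto simp: arctan_less_iff divide_strict_right_mono)
    qed simp
    then show "0 < ang (mset xs) a b - ang (mset ys) a b" using S by simp
    obtain m where m: "length ys = Suc m" using i by (cases "length ys") auto
    have "(\<Sum>j<Suc m. ?g (xs ! j)) = ?g (xs ! 0) + (\<Sum>j<m. ?g (xs ! Suc j))" by (rule sum.lessThan_Suc_shift)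
    also have "(\<Sum>j<m. ?g (xs ! Suc j)) \<le> (\<Sum>j<m. ?g (ys ! j))"
      using le' that m by (intro sum_mono) (auto simp: arctan_le_iff divide_right_mono)
    also have "\<dots> = (\<Sum>j<Suc m. ?g (ys ! j)) - ?g (ys ! m)" by simp
    finally have "ang (mset xs) a b - ang (mset ys) a b \<le> ?g (xs ! 0) - ?g (ys ! m)"
      using S m by simp
    then show "ang (mset xs) a b - ang (mset ys) a b < pi"
      using arctan_ubound[of "(a - xs ! 0) / b"] arctan_lbound[of "(a - ys ! m) / b"] by linarith
  qed
  then show ?thesis using l by (auto simp: ang_le_def)
qed (auto simp: ang_le_def)

text \<open>Near the real axis each arctangent tends to pi / 2 or - pi / 2, according to the side of
  \<open>t\<close> on which \<open>x\<close> lies.\<close>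

lemma ang_at_right_0:
  assumes "t \<notin># X"
  shows "((\<lambda>b. ang X t b) \<longlongrightarrow> (pi / 2) * (2 * real (size {#x \<in># X. x < t#}) - real (size X))) (at_right 0)"
  using assms
proof (induction X)
  case empty
  then show ?case by (simp add: ang_def)
next
  case (add x X)
  have "((\<lambda>b. arctan ((t - x) / b)) \<longlongrightarrow> (if x < t then pi / 2 else - (pi / 2))) (at_right 0)"
  proof (cases "x < t")
    case True
    have "filterlim (\<lambda>b. (t - x) / b) at_top (at_right 0)"
      unfolding divide_inverse using True
      by (intro filterlim_tendsto_pos_mult_at_top[OF tendsto_const _ filterlim_inverse_at_top_right]) auto
    from filterlim_compose[OF tendsto_arctan_at_top this] True show ?thesis by simp
  next
    case False
    then have "x > t" using add.prems by auto
    have "filterlim (\<lambda>b. (x - t) / b) at_top (at_right 0)"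
      unfolding divide_inverse using \<open>x > t\<close>
      by (intro filterlim_tendsto_pos_mult_at_top[OF tendsto_const _ filterlim_inverse_at_top_right]) auto
    from filterlim_compose[OF tendsto_arctan_at_top this]
    have "((\<lambda>b. - arctan ((x - t) / b)) \<longlongrightarrow> - (pi / 2)) (at_right 0)" by (rule tendsto_minus)
    moreover have "- arctan ((x - t) / b) = arctan ((t - x) / b)" for b
      using arctan_minus[of "(x - t) / b"] by (simp add: minus_divide_left)
    ultimately show ?thesis using False by simp
  qed
  moreover have "(pi / 2) * (2 * real (size {#y \<in># add_mset x X. y < t#}) - real (size (add_mset x X)))
      = (if x < t then pi / 2 else - (pi / 2)) + (pi / 2) * (2 * real (size {#y \<in># X. y < t#}) - real (size X))"
  proof -
    have *: "real (size {#y \<in># add_mset x X. y < t#})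
        = (if x < t then 1 else 0) + real (size {#y \<in># X. y < t#})" "real (size (add_mset x X)) = 1 + real (size X)"
      by simp_all
    have "c * (2 * ((if x < t then 1 else 0) + s) - (1 + n)) = (if x < t then c else - c) + c * (2 * s - n)"
      for c s n :: real by (simp add: algebra_simps)
    then show ?thesis unfolding * .
  qed
  moreover have "t \<notin># X" using add.prems by simp
  note add.IH[OF this]
  ultimately show ?case by (simp only: ang_add_mset) (intro tendsto_add)
qed

text \<open>At the real axis the angle difference, which lies between 0 and pi, tends to pi times
  the difference of the two counts.\<close>

lemma ang_le_count:
  assumes "ang_le X Y" "t \<notin># X" "t \<notin># Y"
  shows "size {#x \<in># Y. x < t#} \<le> size {#x \<in># X. x < t#} \<and> size {#x \<in># X. x < t#} \<le> Suc (size {#x \<in># Y. x < t#})"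
proof (cases "X = Y")
  case False
  let ?S = "\<lambda>b. ang X t b - ang Y t b" and ?c = "real (size {#x \<in># X. x < t#}) - real (size {#x \<in># Y. x < t#})"
  have "(?S \<longlongrightarrow> (pi / 2) * (2 * real (size {#x \<in># X. x < t#}) - real (size X))
      - (pi / 2) * (2 * real (size {#x \<in># Y. x < t#}) - real (size Y))) (at_right 0)"
    by (intro tendsto_diff ang_at_right_0 assms)
  also have "(pi / 2) * (2 * real (size {#x \<in># X. x < t#}) - real (size X))
      - (pi / 2) * (2 * real (size {#x \<in># Y. x < t#}) - real (size Y)) = pi * ?c"
    using assms(1) by (simp add: ang_le_def algebra_simps)
  finally have L: "(?S \<longlongrightarrow> pi * ?c) (at_right 0)" .
  have S: "0 < ?S b \<and> ?S b < pi" if "b > 0" for b using assms(1) False that by (auto simp: ang_le_def)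
  have ev: "eventually (\<lambda>b. b > 0) (at_right (0::real))" by (rule eventually_at_right_less)
  have "0 \<le> pi * ?c"
    by (rule tendsto_lowerbound[OF L]) (use ev S in \<open>auto elim!: eventually_mono simp: less_imp_le\<close>)
  moreover have "pi * ?c \<le> pi * 1"
    by (rule tendsto_upperbound[OF L]) (use ev S in \<open>auto elim!: eventually_mono simp: less_imp_le\<close>)
  ultimately have "0 \<le> ?c" "?c \<le> 1"
    using pi_gt_zero mult_le_cancel_left_pos[of pi ?c 1] mult_le_cancel_left_pos[of pi 0 ?c] by linarith+
  then show ?thesis by linarith
qed auto

lemma sorted_count_less:
  assumes "sorted xs" "j < length xs"
  shows "xs ! j < t \<Longrightarrow> Suc j \<le> size {#x \<in># mset xs. x < t#}"
    and "t \<le> xs ! j \<Longrightarrow> size {#x \<in># mset xs. x < t#} \<le> j"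
proof -
  have e: "size {#x \<in># mset xs. x < t#} = card {i. i < length xs \<and> xs ! i < t}"
    using size_mset[of "filter (\<lambda>x. x < t) xs"] by (simp add: length_filter_conv_card)
  show "Suc j \<le> size {#x \<in># mset xs. x < t#}" if "xs ! j < t"
  proof -
    have "{..j} \<subseteq> {i. i < length xs \<and> xs ! i < t}"
      using assms that by (auto intro: le_less_trans[OF sorted_nth_mono])
    then have "card {..j} \<le> card {i. i < length xs \<and> xs ! i < t}" by (intro card_mono) auto
    with e show ?thesis by simp
  qed
  show "size {#x \<in># mset xs. x < t#} \<le> j" if "t \<le> xs ! j"
  proof -
    have "i < j" if "i < length xs" "xs ! i < t" for i
      using sorted_nth_mono[OF assms(1), of j i] that \<open>t \<le> xs ! j\<close> by fastforce
    then have "{i. i < length xs \<and> xs ! i < t} \<subseteq> {..<j}" by auto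
    then have "card {i. i < length xs \<and> xs ! i < t} \<le> card {..<j}" by (intro card_mono) auto
    with e show ?thesis by simp
  qed
qed

text \<open>A violated inequality leaves a gap between two entries; counting the zeros left of a
  point \<open>t\<close> in the gap contradicts \<open>ang_le_count\<close>. The point has to avoid
  all entries, where the limit of the angles is different.\<close>

lemma ang_le_interlaced:
  assumes "ang_le (mset xs) (mset ys)" "sorted xs" "sorted ys"
  shows "interlaced xs ys"
proof -
  have l: "length xs = length ys" using assms(1) by (auto simp: ang_le_def dest: mset_eq_length)
  have ex: "\<exists>t. x < t \<and> t < y \<and> t \<notin># mset xs \<and> t \<notin># mset ys" if "x < y" for x y
  proof -
    have "infinite ({x<..<y} - (set xs \<union> set ys))"
      using infinite_Ioo[OF that] by (intro Diff_infinite_finite) auto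
    then have "{x<..<y} - (set xs \<union> set ys) \<noteq> {}" by (metis finite.emptyI)
    then show ?thesis by auto
  qed
  have "xs ! j \<le> ys ! j" if j: "j < length xs" for j
  proof (rule ccontr)
    assume "\<not> xs ! j \<le> ys ! j"
    then obtain t where t: "ys ! j < t" "t < xs ! j" "t \<notin># mset xs" "t \<notin># mset ys" using ex[of "ys ! j" "xs ! j"] by auto
    then have "Suc j \<le> size {#x \<in># mset ys. x < t#}" "size {#x \<in># mset xs. x < t#} \<le> j"
      using assms j l by (auto intro!: sorted_count_less)
    with ang_le_count[OF assms(1) t(3,4)] show False by linarith
  qed
  moreover have "ys ! j \<le> xs ! Suc j" if j: "Suc j < length xs" for j
  proof (rule ccontr)
    assume "\<not> ys ! j \<le> xs ! Suc j"
    then obtain t where t: "xs ! Suc j < t" "t < ys ! j" "t \<notin># mset xs" "t \<notin># mset ys" using ex[of "xs ! Suc j" "ys ! j"] by auto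
    then have "Suc (Suc j) \<le> size {#x \<in># mset xs. x < t#}" "size {#x \<in># mset ys. x < t#} \<le> j"
      using assms j l by (auto intro!: sorted_count_less)
    with ang_le_count[OF assms(1) t(3,4)] show False by linarith
  qed
  ultimately show ?thesis using l by (auto simp: interlaced_def)
qed

text \<open>Only one arctangent changes. Since \<open>ang_le\<close> is not transitive, monotonicity
  in all zeros is later assembled from such single moves.\<close>

lemma ang_le_move:
  assumes "x \<le> y"
  shows "ang_le (add_mset x Z) (add_mset y Z)"
proof (cases "x = y")
  case False
  then have "x < y" using assms by auto
  have "0 < arctan ((a - x) / b) - arctan ((a - y) / b) \<and> arctan ((a - x) / b) - arctan ((a - y) / b) < pi" if "b > 0" for a b
    using that \<open>x < y\<close> arctan_ubound[of "(a - x) / b"] arctan_lbound[of "(a - y) / b"]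
    by (auto simp: arctan_less_iff divide_strict_right_mono)
  then show ?thesis by (auto simp: ang_le_def)
qed (auto simp: ang_le_def)

text \<open>Interlacing compares sorted zeros entry by entry, so equal sums force equal entries.
  Together with \<open>pencil_ang_le\<close> this lets one coefficient decide the order.\<close>

lemma ang_le_sum:
  assumes "ang_le X Y"
  shows "sum_mset X \<le> sum_mset Y" and "sum_mset X = sum_mset Y \<Longrightarrow> X = Y"
proof -
  let ?xs = "sorted_list_of_multiset X" and ?ys = "sorted_list_of_multiset Y"
  have il: "interlaced ?xs ?ys" using assms by (intro ang_le_interlaced) auto
  have len: "length ?xs = length ?ys" and le: "\<forall>j<length ?ys. ?xs ! j \<le> ?ys ! j"
    using il by (auto simp: interlaced_def)
  have sX: "sum_mset X = (\<Sum>j<length ?ys. ?xs ! j)"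
    by (metis len sum_mset_sum_list mset_sorted_list_of_multiset sum_list_sum_nth atLeast0LessThan)
  have sY: "sum_mset Y = (\<Sum>j<length ?ys. ?ys ! j)"
    by (metis sum_mset_sum_list mset_sorted_list_of_multiset sum_list_sum_nth atLeast0LessThan)
  show "sum_mset X \<le> sum_mset Y" unfolding sX sY using le by (intro sum_mono) auto
  show "X = Y" if "sum_mset X = sum_mset Y"
  proof -
    have "?xs ! j = ?ys ! j" if j: "j < length ?ys" for j
    proof (rule ccontr)
      assume "?xs ! j \<noteq> ?ys ! j"
      with le j have "?xs ! j < ?ys ! j" by fastforce
      with j le have "(\<Sum>j<length ?ys. ?xs ! j) < (\<Sum>j<length ?ys. ?ys ! j)"
        by (intro sum_strict_mono_ex1) auto
      then show False using \<open>sum_mset X = sum_mset Y\<close> sX sY by simp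
    qed
    then have "?xs = ?ys" using len by (intro nth_equalityI) auto
    then show ?thesis by (metis mset_sorted_list_of_multiset)
  qed
qed

section \<open>Nondegenerate hyperbolicity preservers\<close>

lemma coeff_mult_top:
  assumes "degree p \<le> i" "degree q \<le> j"
  shows "coeff (p * q) (i + j) = coeff p i * coeff q j"
proof -
  have "coeff p l * coeff q (i + j - l) = 0" if "l \<in> {..i + j} - {i}" for l
  proof (cases "l < i")
    case True
    then have "degree q < i + j - l" using assms by auto
    then show ?thesis by (simp add: coeff_eq_0)
  next
    case False
    with that have "degree p < l" using assms by auto
    then show ?thesis by (simp add: coeff_eq_0)
  qed
  then have "(\<Sum>l\<le>i + j. coeff p l * coeff q (i + j - l)) = coeff p i * coeff q (i + j - i)"
    by (subst sum.remove[of _ i]) auto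
  then show ?thesis by (simp add: coeff_mult)
qed

lemma higher_pderiv_degree_less:
  fixes p :: "'a::{idom, semiring_char_0} poly"
  assumes "degree p < k" shows "(pderiv ^^ k) p = 0"
  by (rule poly_eqI) (use assms in \<open>simp add: coeff_higher_pderiv coeff_eq_0\<close>)

lemma higher_pderiv_linear_power:
  fixes c :: "'a::field_char_0"
  shows "(pderiv ^^ k) ([:c, 1:] ^ n) = smult (of_nat (n choose k) * fact k) ([:c, 1:] ^ (n - k))"
proof (induction k)
  case (Suc k)
  have "(n choose Suc k) * Suc k = (n - k) * (n choose k)"
    by (metis binomial_absorb_comp binomial_absorption mult.commute)
  then have *: "of_nat (n choose Suc k) * of_nat (Suc k) = (of_nat (n - k) * of_nat (n choose k) :: 'a)"
    by (metis of_nat_mult)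
  have "(pderiv ^^ Suc k) ([:c, 1:] ^ n)
    = smult (of_nat (n choose k) * fact k) (pderiv ([:c, 1:] ^ (n - k)))"
    by (simp add: Suc pderiv_smult)
  also have "pderiv ([:c, 1:] ^ (n - k)) = smult (of_nat (n - k)) ([:c, 1:] ^ (n - Suc k))"
    by (simp add: pderiv_power pderiv_pCons)
  also have "smult (of_nat (n choose k) * fact k) (smult (of_nat (n - k)) ([:c, 1:] ^ (n - Suc k)))
    = smult (of_nat (n choose Suc k) * of_nat (Suc k) * fact k) ([:c, 1:] ^ (n - Suc k))"
    unfolding * by (simp add: mult_ac)
  finally show ?case by (simp add: mult_ac)
qed simp

text \<open>The falling factorial m (m - 1) ... (m - k + 1), the factor in the \<open>k\<close>-th
  derivative of z^m; in this form it is visibly nonnegative, and 0 for \<open>m < k\<close>.\<close>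

definition ffactorial :: "nat \<Rightarrow> nat \<Rightarrow> real" where
  "ffactorial m k = real (m choose k) * fact k"

lemma ffactorial_nonneg [simp]: "ffactorial m k \<ge> 0"
  by (simp add: ffactorial_def)

lemma ffactorial_pos: "k \<le> m \<Longrightarrow> ffactorial m k > 0"
  by (simp add: ffactorial_def)

lemma ffactorial_eq_0: "m < k \<Longrightarrow> ffactorial m k = 0"
  by (simp add: ffactorial_def)

lemma ffactorial_prod: "ffactorial m k = (\<Prod>i<k. real m - real i)"
  by (simp add: ffactorial_def binomial_gbinomial gbinomial_prod_rev atLeast0LessThan)

lemma coeff_higher_pderiv_ffactorial:
  assumes "k \<le> m"
  shows "coeff ((pderiv ^^ k) p) (m - k) = ffactorial m k * coeff (p :: real poly) m"
proof -
  have "pochhammer (of_nat (Suc (m - k))) k = ffactorial m k"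
    using assms by (simp add: ffactorial_def binomial_gbinomial gbinomial_pochhammer' of_nat_diff algebra_simps)
  then show ?thesis using assms by (simp add: coeff_higher_pderiv)
qed

lemma pencil_sym: "pencil f g \<Longrightarrow> pencil g f"
  unfolding pencil_def by (metis add.commute)

locale nondegenerate_preserver =
  fixes Q :: "nat \<Rightarrow> real poly" and M N r :: nat
  assumes supp: "\<And>k. k < M \<or> N < k \<Longrightarrow> Q k = 0"
    and QM: "Q M \<noteq> 0" and QN: "Q N \<noteq> 0"
    and pres: "preserves_hyperbolicity (diff_op M N Q)"
    and fuchs: "fuchs_index M N Q = int r"
    and nondeg: "nondegenerate M N Q"
begin

abbreviation T :: "real poly \<Rightarrow> real poly" where "T \<equiv> diff_op M N Q"

text \<open>The coefficient at the largest degree that the Fuchs index allows; it is 0 if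
  \<open>Q k\<close> does not attain that degree.\<close>

definition c :: "nat \<Rightarrow> real" where "c k = coeff (Q k) (k + r)"

text \<open>The coefficient of z^(m + r) in the image of z^m, see \<open>coeff_T\<close>.\<close>

definition lam :: "nat \<Rightarrow> real" where "lam m = (\<Sum>k=M..N. c k * ffactorial m k)"

lemma M_le_N: "M \<le> N"
  using supp[of M] QM by (meson linorder_not_le)

lemma degree_Q: "degree (Q k) \<le> k + r"
proof (cases "Q k = 0")
  case False
  then have "k \<in> {k \<in> {M..N}. Q k \<noteq> 0}" using supp[of k] by (auto simp: not_less[symmetric])
  then have "int (degree (Q k)) - int k \<le> fuchs_index M N Q"
    unfolding fuchs_index_def by (intro Max_ge) auto
  then show ?thesis using fuchs by simp
qed simp

lemma degree_QN: "degree (Q N) = N + r"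
  using nondeg fuchs by (simp add: nondegenerate_def)

lemma c_N: "c N \<noteq> 0"
  using QN degree_QN by (metis c_def leading_coeff_0_iff)

lemma c_outside: "k < M \<or> N < k \<Longrightarrow> c k = 0"
  by (simp add: c_def supp)

lemma T_add: "T (f + g) = T f + T g"
  by (simp add: diff_op_def higher_pderiv_add algebra_simps sum.distrib)

lemma T_smult: "T (smult a f) = smult a (T f)"
  unfolding diff_op_def higher_pderiv_smult mult_smult_right by (rule poly_eqI) (simp add: coeff_sum sum_distrib_left)

lemma T_0 [simp]: "T 0 = 0"
  by (simp add: diff_op_def)

lemma T_diff: "T (f - g) = T f - T g"
  using T_add[of f "smult (-1) g"] T_smult[of "-1" g] by simp

lemma T_pencil:
  assumes "pencil f g" shows "pencil (T f) (T g)"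
  unfolding pencil_def
proof (intro allI)
  fix a b
  have "smult a (T f) + smult b (T g) = T (smult a f + smult b g)" by (simp add: T_add T_smult)
  then show "smult a (T f) + smult b (T g) = 0 \<or> hyperbolic (smult a (T f) + smult b (T g))"
    using assms pres unfolding pencil_def preserves_hyperbolicity_def by (metis T_0)
qed

lemma degree_T:
  assumes "degree h \<le> m" shows "degree (T h) \<le> m + r"
  unfolding diff_op_def
proof (intro degree_sum_le)
  fix k
  show "degree (Q k * (pderiv ^^ k) h) \<le> m + r"
  proof (cases "k \<le> m")
    case True
    have "degree (Q k * (pderiv ^^ k) h) \<le> degree (Q k) + degree ((pderiv ^^ k) h)" by (rule degree_mult_le)
    also have "\<dots> \<le> (k + r) + (m - k)" using degree_Q[of k] assms by (intro add_mono) (auto simp: degree_higher_pderiv)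
    finally show ?thesis using True by simp
  next
    case False
    then show ?thesis using assms by (simp add: higher_pderiv_degree_less)
  qed
qed simp

lemma coeff_T:
  assumes "degree h \<le> m" shows "coeff (T h) (m + r) = lam m * coeff h m"
proof -
  have "coeff (Q k * (pderiv ^^ k) h) (m + r) = c k * ffactorial m k * coeff h m" for k
  proof (cases "k \<le> m")
    case True
    then have "coeff (Q k * (pderiv ^^ k) h) ((k + r) + (m - k)) = c k * (ffactorial m k * coeff h m)"
      using degree_Q[of k] assms
      by (subst coeff_mult_top) (auto simp: degree_higher_pderiv c_def coeff_higher_pderiv_ffactorial)
    then show ?thesis using True by (simp add: ac_simps)
  next
    case False
    then show ?thesis using assms by (simp add: higher_pderiv_degree_less ffactorial_eq_0)
  qed
  then show ?thesis by (simp add: diff_op_def coeff_sum lam_def sum_distrib_right)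
qed

lemma T_hyperbolic:
  assumes "hyperbolic f" "degree f = n" "lead_coeff f = 1" "lam n \<noteq> 0"
  shows "hyperbolic (T f)" "degree (T f) = n + r" "lead_coeff (T f) = lam n"
    "size (proots (T f)) = n + r" "T f = smult (lam n) (monic_of (proots (T f)))"
proof -
  have c: "coeff (T f) (n + r) = lam n" using coeff_T[of f n] assms by simp
  then show deg: "degree (T f) = n + r" using degree_T[of f n] assms le_degree[of "T f" "n + r"] by simp
  show lc: "lead_coeff (T f) = lam n" using c deg by simp
  then have "T f \<noteq> 0" using assms(4) by auto
  then show h: "hyperbolic (T f)" using pres assms(1) by (auto simp: preserves_hyperbolicity_def)
  then show "size (proots (T f)) = n + r" using deg hyperbolic_size_proots by auto
  show "T f = smult (lam n) (monic_of (proots (T f)))" using hyperbolic_decompose[OF h] lc by simp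
qed

lemma pencil_hyperbolic:
  "pencil f g \<Longrightarrow> f \<noteq> 0 \<Longrightarrow> hyperbolic f" "pencil f g \<Longrightarrow> g \<noteq> 0 \<Longrightarrow> hyperbolic g"
  unfolding pencil_def by (metis add.right_neutral smult_0_left smult_1_left, metis add.left_neutral smult_0_left smult_1_left)

text \<open>Two members of a pencil interlace in one of the two orders; the order is read off from the
  sums of the zeros, which \<^term>\<open>T\<close> maps affinely with slope \<^term>\<open>lam (n - 1) / lam n\<close>.\<close>

lemma T_ang_le:
  assumes p: "pencil f g" and f: "degree f = n" "lead_coeff f = 1" and g: "degree g = n" "lead_coeff g = 1"
    and n: "n \<ge> 1" and lam: "lam n \<noteq> 0" "lam (n - 1) * lam n \<ge> 0"
    and le: "coeff g (n - 1) \<le> coeff f (n - 1)"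
  shows "ang_le (proots (T f)) (proots (T g))"
    and "lam (n - 1) = 0 \<Longrightarrow> T f = T g"
proof -
  have "f \<noteq> 0" "g \<noteq> 0" using f(2) g(2) by auto
  then have hf: "hyperbolic f" and hg: "hyperbolic g" using pencil_hyperbolic[OF p] by auto
  note Tf = T_hyperbolic[OF hf f lam(1)] and Tg = T_hyperbolic[OF hg g lam(1)]
  define X Y where "X = proots (T f)" and "Y = proots (T g)"
  have "pencil (monic_of X) (monic_of Y)"
    unfolding pencil_def
  proof (intro allI)
    fix a b
    have "monic_of X = smult (1 / lam n) (T f)" "monic_of Y = smult (1 / lam n) (T g)"
      using Tf(5) Tg(5) lam(1) unfolding X_def Y_def by (metis nonzero_divide_eq_eq smult_1_left smult_smult)+
    then have "smult a (monic_of X) + smult b (monic_of Y) = smult (a / lam n) (T f) + smult (b / lam n) (T g)"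
      by simp
    then show "smult a (monic_of X) + smult b (monic_of Y) = 0 \<or> hyperbolic (smult a (monic_of X) + smult b (monic_of Y))"
      using T_pencil[OF p] unfolding pencil_def by metis
  qed
  moreover have s: "size X = n + r" "size Y = n + r" using Tf(4) Tg(4) by (auto simp: X_def Y_def)
  ultimately have or: "ang_le X Y \<or> ang_le Y X" by (intro pencil_ang_le) auto
  \<comment> \<open>The leading terms cancel, so the next coefficient of \<open>T f - T g\<close>
    involves only \<open>lam (n - 1)\<close>.\<close>
  have "coeff (f - g) n = 0" using f g by auto
  moreover have "degree (f - g) \<le> n" using f g degree_diff_le[of f n g] by auto
  ultimately have "degree (f - g) \<le> n - 1"
    by (intro degree_le allI impI) (metis Suc_pred' coeff_eq_0 le_less_trans less_antisym linorder_not_le n not_less_eq zero_less_one less_le_trans le_neq_implies_less)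
  then have "coeff (T f - T g) (n - 1 + r) = lam (n - 1) * (coeff f (n - 1) - coeff g (n - 1))"
    using coeff_T[of "f - g" "n - 1"] by (simp add: T_diff)
  moreover have "coeff (monic_of X) (n - 1 + r) = - sum_mset X" "coeff (monic_of Y) (n - 1 + r) = - sum_mset Y"
    using s n by (auto intro!: monic_of_coeff_penultimate)
  then have "coeff (T f) (n - 1 + r) = - lam n * sum_mset X" "coeff (T g) (n - 1 + r) = - lam n * sum_mset Y"
    using Tf(5) Tg(5) unfolding X_def Y_def by (metis coeff_smult mult_minus_left mult_minus_right)+
  ultimately have e: "lam n * (sum_mset Y - sum_mset X) = lam (n - 1) * (coeff f (n - 1) - coeff g (n - 1))"
    by (simp add: algebra_simps)
  \<comment> \<open>Multiplying by \<open>lam n\<close> avoids a distinction by its sign.\<close>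
  then have "(lam n * lam n) * (sum_mset Y - sum_mset X) = (lam (n - 1) * lam n) * (coeff f (n - 1) - coeff g (n - 1))"
    by (simp add: ac_simps)
  moreover have "\<dots> \<ge> 0" using lam(2) le by (intro mult_nonneg_nonneg[of "lam (n - 1) * lam n"]) auto
  moreover have "lam n * lam n > 0" using lam(1) by (metis not_real_square_gt_zero)
  ultimately have sle: "sum_mset X \<le> sum_mset Y" by (metis diff_ge_0_iff_ge zero_le_mult_iff linorder_not_le less_asym)
  show a: "ang_le (proots (T f)) (proots (T g))"
    using or
  proof
    assume "ang_le Y X"
    with ang_le_sum[OF this] sle have "X = Y" by auto
    then show ?thesis by (simp add: X_def Y_def ang_le_def)
  qed (simp add: X_def Y_def)
  show "T f = T g" if "lam (n - 1) = 0"
  proof -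
    have "sum_mset X = sum_mset Y" using e lam(1) that by simp
    then have "X = Y" using a ang_le_sum(2) unfolding X_def Y_def by blast
    then show ?thesis using Tf(5) Tg(5) unfolding X_def Y_def by metis
  qed
qed

text \<open>As a function of \<open>m\<close>, \<open>ffactorial m k\<close> is a monic polynomial
  of degree \<open>k\<close>; hence \<open>lam\<close> is a polynomial of degree \<open>N\<close>
  with leading coefficient \<open>c N\<close>.\<close>

lemma lam_eventually_pos: "\<exists>m0. \<forall>m\<ge>m0. c N * lam m > 0"
proof -
  define ff where "ff = (\<lambda>k. \<Prod>i<k. [:- real i, 1:])"
  have ff: "degree (ff k) = k" "lead_coeff (ff k) = 1" for k
  proof -
    have "ff k = monic_of (image_mset real (mset_set {..<k}))"
      by (simp add: ff_def monic_of_def prod_unfold_prod_mset image_mset.compositionality o_def)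
    then show "degree (ff k) = k" "lead_coeff (ff k) = 1"
      using lead_coeff_monic_of[of "image_mset real (mset_set {..<k})"] by simp_all
  qed
  define L where "L = smult (c N) (\<Sum>k=M..N. smult (c k) (ff k))"
  have pL: "poly L (real m) = c N * lam m" for m
    by (simp add: L_def lam_def ff_def poly_sum poly_prod ffactorial_prod sum_distrib_left)
  have "degree L \<le> N" unfolding L_def
    by (intro order_trans[OF degree_smult_le] degree_sum_le order_trans[OF degree_smult_le]) (auto simp: ff)
  moreover have cL: "coeff L N = c N * c N"
  proof -
    have "(\<Sum>k=M..N. c k * coeff (ff k) N) = (\<Sum>k\<in>{N}. c k * coeff (ff k) N)"
      using M_le_N ff by (intro sum.mono_neutral_right) (auto intro!: coeff_eq_0)
    then show ?thesis using ff[of N] by (simp add: L_def coeff_sum)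
  qed
  moreover have pos: "c N * c N > 0" using c_N by (metis not_real_square_gt_zero)
  ultimately have "degree L = N" using le_degree[of L N] by (intro antisym) force+
  then have "lead_coeff L > 0" using cL pos by simp
  from poly_pinfty_gt_lc[OF this] obtain x where x: "\<forall>y\<ge>x. lead_coeff L \<le> poly L y" by auto
  have "c N * lam m > 0" if "m \<ge> nat \<lceil>x\<rceil>" for m
    using x that \<open>lead_coeff L > 0\<close> pL[of m] by (smt (verit) nat_le_iff of_nat_ceiling of_nat_le_iff ceiling_le_iff of_int_of_nat_eq)
  then show ?thesis by blast
qed

end

section \<open>Stability of the symbol\<close>

text \<open>The logarithm m Ln (1 + a / m) is a difference quotient of Ln (1 + a x) at 0, taken
  along x = 1 / m.\<close>

lemma tendsto_exp_limit_complex: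
  fixes a :: complex
  shows "(\<lambda>m. (1 + a / of_nat m) ^ m) \<longlonglongrightarrow> exp a"
proof -
  have s: "(\<lambda>m. a / of_nat m) \<longlonglongrightarrow> 0"
    by (rule tendsto_divide_0[OF tendsto_const filterlim_compose[OF tendsto_of_nat filterlim_ident]])
  have "((\<lambda>x. Ln (1 + a * x)) has_field_derivative a) (at 0)"
    by (auto intro!: derivative_eq_intros)
  then have "((\<lambda>x. Ln (1 + a * x) / x) \<longlongrightarrow> a) (at 0)"
    by (simp add: has_field_derivative_iff)
  moreover have "filterlim (\<lambda>m. inverse (of_nat m) :: complex) (at 0) sequentially"
    unfolding filterlim_at
    by (intro conjI tendsto_inverse_0_at_top filterlim_real_sequentially eventually_sequentiallyI[of 1] tendsto_inverse_0[THEN filterlim_compose] tendsto_of_nat[THEN filterlim_compose] filterlim_ident) auto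
  ultimately have "(\<lambda>m. Ln (1 + a * inverse (of_nat m)) / inverse (of_nat m)) \<longlonglongrightarrow> a"
    by (rule filterlim_compose)
  then have "(\<lambda>m. exp (of_nat m * Ln (1 + a / of_nat m))) \<longlonglongrightarrow> exp a"
    by (intro tendsto_exp) (simp add: divide_inverse mult.commute)
  moreover have "eventually (\<lambda>m. exp (of_nat m * Ln (1 + a / of_nat m)) = (1 + a / of_nat m) ^ m) sequentially"
  proof -
    have "eventually (\<lambda>m. dist (a / of_nat m) 0 < 1) sequentially" using s by (rule tendstoD) simp
    then show ?thesis
    proof eventually_elim
      case (elim m)
      then have "1 + a / of_nat m \<noteq> 0" by (metis add_eq_0_iff dist_0_norm dist_commute norm_minus_cancel norm_one order_less_irrefl)
      then show ?case by (simp add: exp_of_nat_mult)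
    qed
  qed
  ultimately show ?thesis by (rule Lim_transform_eventually)
qed

lemma ffactorial_tendsto: "(\<lambda>m. ffactorial m k / real m ^ k) \<longlonglongrightarrow> 1"
proof -
  have "(\<lambda>m. \<Prod>i<k. 1 - real i / real m) \<longlonglongrightarrow> (\<Prod>i<k. 1 - 0)"
    by (intro tendsto_prod tendsto_intros tendsto_divide_0[OF tendsto_const]
        filterlim_at_top_imp_at_infinity filterlim_real_sequentially)
  moreover have "eventually (\<lambda>m. (\<Prod>i<k. 1 - real i / real m) = ffactorial m k / real m ^ k) sequentially"
  proof (rule eventually_sequentiallyI[of 1])
    fix m :: nat assume "1 \<le> m"
    then have "(\<Prod>i<k. 1 - real i / real m) = (\<Prod>i<k. (real m - real i) / real m)"
      by (intro prod.cong) (auto simp: field_simps)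
    then show "(\<Prod>i<k. 1 - real i / real m) = ffactorial m k / real m ^ k"
      by (simp add: ffactorial_prod prod_dividef)
  qed
  ultimately show ?thesis using Lim_transform_eventually by fastforce
qed

text \<open>Real and imaginary parts are taken coefficientwise. Their values \<open>A\<close> and
  \<open>B\<close> at \<open>z\<close> satisfy A + iB = (z + w)^m and A - iB = (z + cnj w)^m. A
  vanishing real combination would make the moduli equal, but |z + w| > |z + cnj w| in the upper
  half-plane.\<close>

lemma pencil_Re_Im_linear_power:
  fixes w :: complex
  assumes w: "Im w > 0" and m: "m \<ge> 1"
  defines "p \<equiv> [:w, 1:] ^ m"
  shows "pencil (map_poly Re p) (map_poly Im p)"
  unfolding pencil_def
proof (intro allI)
  fix a b :: real
  let ?h = "smult a (map_poly Re p) + smult b (map_poly Im p)"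
  have "poly (cp ?h) z \<noteq> 0" if nz: "?h \<noteq> 0" and z: "Im z > 0" for z
  proof
    assume 0: "poly (cp ?h) z = 0"
    define A B where "A = poly (cp (map_poly Re p)) z" and "B = poly (cp (map_poly Im p)) z"
    have "cp (map_poly Re p) + smult \<i> (cp (map_poly Im p)) = p"
      by (rule poly_eqI) (simp add: coeff_map_poly complex_eq_iff)
    then have u: "A + \<i> * B = (z + w) ^ m"
      unfolding A_def B_def by (metis (no_types, lifting) add.commute mult.right_neutral p_def poly_add poly_pCons poly_power poly_smult poly_0 mult_zero_right add.right_neutral)
    have "cp (map_poly Re p) - smult \<i> (cp (map_poly Im p)) = map_poly cnj p"
      by (rule poly_eqI) (simp add: coeff_map_poly complex_eq_iff)
    then have "A - \<i> * B = poly (map_poly cnj p) z"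
      unfolding A_def B_def by (metis poly_diff poly_smult)
    then have v: "A - \<i> * B = (z + cnj w) ^ m"
      by (simp add: p_def add.commute)
    have "a *\<^sub>R A + b *\<^sub>R B = 0" using 0 by (simp add: A_def B_def cp_add cp_smult scaleR_conv_of_real)
    then have "Complex a (- b) * (A + \<i> * B) = - (Complex a b * (A - \<i> * B))"
      by (simp add: complex_eq_iff algebra_simps)
    then have "cmod (Complex a (- b)) * cmod (A + \<i> * B) = cmod (Complex a b) * cmod (A - \<i> * B)"
      by (metis norm_minus_cancel norm_mult)
    moreover have "cmod (Complex a (- b)) = cmod (Complex a b)" by (simp add: cmod_def)
    moreover have "cmod (Complex a b) \<noteq> 0" using nz by (auto simp: complex_eq_iff)
    ultimately have "cmod (z + w) ^ m = cmod (z + cnj w) ^ m" using u v by (simp add: norm_power)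
    moreover have "0 < m" using m by simp
    ultimately have "cmod (z + w) = cmod (z + cnj w)"
      by (rule power_eq_imp_eq_base[OF _ norm_ge_zero norm_ge_zero])
    then have "(Im z + Im w)\<^sup>2 = (Im z - Im w)\<^sup>2" by (simp add: cmod_def)
    then have "Im z * Im w = 0" by (simp add: power2_sum power2_diff)
    then show False using z w by simp
  qed
  then show "?h = 0 \<or> hyperbolic ?h" using hyperbolic_if_upper by blast
qed

context nondegenerate_preserver
begin

lemma lam_eventually_mult_nonneg: "\<exists>m0. \<forall>m\<ge>m0. m \<ge> 1 \<and> lam m \<noteq> 0 \<and> lam (m - 1) * lam m \<ge> 0"
proof -
  obtain m0 where m0: "\<And>m. m \<ge> m0 \<Longrightarrow> c N * lam m > 0" using lam_eventually_pos by auto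
  have "m \<ge> 1 \<and> lam m \<noteq> 0 \<and> lam (m - 1) * lam m \<ge> 0" if "m \<ge> Suc m0" for m
  proof -
    have "c N * lam m > 0" "c N * lam (m - 1) > 0" using m0[of m] m0[of "m - 1"] that by auto
    then show ?thesis using that by (auto simp: zero_less_mult_iff zero_le_mult_iff)
  qed
  then show ?thesis by blast
qed

lemma poly_cp_T: "poly (cp (T h)) z = (\<Sum>k=M..N. poly (cp (Q k)) z * poly ((pderiv ^^ k) (cp h)) z)"
  by (simp add: diff_op_def cp_sum cp_mult cp_higher_pderiv poly_sum)

text \<open>The sum is the image of \<open>(z + w) ^ m\<close>, as a polynomial in \<open>z\<close>. Its real and imaginary parts are the
  images of the real and imaginary parts of \<open>(z + w) ^ m\<close>, which span a hyperbolic pencil.\<close>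

lemma symbol_nonzero:
  "\<exists>m0. \<forall>m\<ge>m0. \<forall>z w. Im z > 0 \<longrightarrow> Im w > 0 \<longrightarrow>
     (\<Sum>k=M..N. poly (cp (Q k)) z * (of_real (ffactorial m k) * (z + w) ^ (m - k))) \<noteq> 0"
proof -
  obtain m0 where m0: "\<And>m. m \<ge> m0 \<Longrightarrow> m \<ge> 1 \<and> lam m \<noteq> 0 \<and> lam (m - 1) * lam m \<ge> 0"
    using lam_eventually_mult_nonneg by auto
  have "(\<Sum>k=M..N. poly (cp (Q k)) z * (of_real (ffactorial m k) * (z + w) ^ (m - k))) \<noteq> 0"
    if m: "m \<ge> m0" and z: "Im z > 0" and w: "Im w > 0" for m z w
  proof
    assume 0: "(\<Sum>k=M..N. poly (cp (Q k)) z * (of_real (ffactorial m k) * (z + w) ^ (m - k))) = 0"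
    define p where "p = [:w, 1:] ^ m"
    define P I where "P = map_poly Re p" and "I = map_poly Im p"
    have m1: "m \<ge> 1" and lam: "lam m \<noteq> 0" "lam (m - 1) * lam m \<ge> 0" using m0[OF m] by auto
    have pm: "p = monic_of (replicate_mset m (- w))" by (simp add: p_def monic_of_replicate)
    have dp: "degree p = m" "coeff p m = 1" using lead_coeff_monic_of[of "replicate_mset m (- w)"] by (simp_all add: pm)
    have c1: "coeff p (m - 1) = of_nat m * w"
      unfolding pm using m1 by (subst monic_of_coeff_penultimate) auto
    have dP: "degree P \<le> m" "coeff P m = 1" "degree I \<le> m" "coeff I m = 0"
      using dp by (auto simp: P_def I_def coeff_map_poly coeff_eq_0 intro!: degree_le)
    have pen: "pencil P I" unfolding P_def I_def p_def by (rule pencil_Re_Im_linear_power[OF w m1])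
    \<comment> \<open>\<open>I\<close> has smaller degree than \<open>P\<close>; adding
      \<open>P\<close> yields a second monic member of degree \<open>m\<close>, as
      \<open>T_ang_le\<close> demands.\<close>
    then have pen': "pencil (P + I) P"
      unfolding pencil_def
    proof (intro allI)
      fix a b
      assume *: "\<forall>a b. smult a P + smult b I = 0 \<or> hyperbolic (smult a P + smult b I)"
      have "smult a (P + I) + smult b P = smult (a + b) P + smult a I"
        by (simp add: smult_add_left smult_add_right)
      with * show "smult a (P + I) + smult b P = 0 \<or> hyperbolic (smult a (P + I) + smult b P)" by metis
    qed
    have d1: "degree P = m" "degree (P + I) = m"
      using dP le_degree[of P m] le_degree[of "P + I" m] degree_add_le[of P m I] by (simp_all add: antisym)
    have l1: "lead_coeff P = 1" "lead_coeff (P + I) = 1" using d1 dP by simp_all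
    \<comment> \<open>The coefficient of \<open>I\<close> at m - 1 is m Im w > 0, so the half-plane
      of \<open>w\<close> fixes the order of the two images.\<close>
    have ci: "coeff P (m - 1) \<le> coeff (P + I) (m - 1)"
      using c1 w by (simp add: I_def coeff_map_poly)
    have ang: "ang_le (proots (T (P + I))) (proots (T P))"
      by (rule T_ang_le(1)[OF pen' d1(2) l1(2) d1(1) l1(1) m1 lam ci])
    have "P \<noteq> 0" "P + I \<noteq> 0" using l1 by (metis leading_coeff_0_iff zero_neq_one)+
    then have hyp: "hyperbolic P" "hyperbolic (P + I)" using pencil_hyperbolic[OF pen'] by auto
    define A B where "A = poly (cp (T P)) z" and "B = poly (cp (T I)) z"
    have A: "A \<noteq> 0" unfolding A_def by (intro hyperbolic_upper z T_hyperbolic[OF hyp(1) d1(1) l1(1) lam(1)])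
    have TP: "A = of_real (lam m) * poly (cp (monic_of (proots (T P)))) z"
      unfolding A_def by (subst T_hyperbolic(5)[OF hyp(1) d1(1) l1(1) lam(1)]) (simp add: cp_smult)
    have "A + B = poly (cp (T (P + I))) z" by (simp add: A_def B_def T_add cp_add)
    also have "\<dots> = of_real (lam m) * poly (cp (monic_of (proots (T (P + I))))) z"
      by (subst T_hyperbolic(5)[OF hyp(2) d1(2) l1(2) lam(1)]) (simp add: cp_smult)
    finally have "(A + B) * cnj A = of_real ((lam m)\<^sup>2) *
        (poly (cp (monic_of (proots (T (P + I))))) z * cnj (poly (cp (monic_of (proots (T P)))) z))"
      using TP by (simp add: power2_eq_square)
    then have "Im ((A + B) * cnj A) \<le> 0"
      using ang_le_Im[OF ang z] by (simp only: Im_complex_of_real Re_complex_of_real times_complex.sel) (simp add: mult_nonneg_nonpos)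
    then have BA: "Im (B * cnj A) \<le> 0" by (simp add: algebra_simps)
    have "poly ((pderiv ^^ k) p) z = of_real (ffactorial m k) * (z + w) ^ (m - k)" for k
      by (simp add: p_def higher_pderiv_linear_power ffactorial_def add.commute)
    then have "(\<Sum>k=M..N. poly (cp (Q k)) z * poly ((pderiv ^^ k) p) z) = 0" using 0 by simp
    moreover have "p = cp P + smult \<i> (cp I)"
      by (rule poly_eqI) (simp add: P_def I_def coeff_map_poly complex_eq_iff)
    ultimately have "A + \<i> * B = 0"
      by (simp add: A_def B_def poly_cp_T higher_pderiv_add higher_pderiv_smult algebra_simps sum.distrib sum_distrib_left)
    then have AB: "A = - (\<i> * B)" by (simp add: add_eq_0_iff2)
    \<comment> \<open>If the sum vanished, this imaginary part would be the squared modulus of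
      \<open>B\<close>, against the sign found above unless \<open>B = 0\<close>.\<close>
    then have "Im (B * cnj A) = (Re B)\<^sup>2 + (Im B)\<^sup>2" by (simp add: power2_eq_square)
    then have "(Re B)\<^sup>2 + (Im B)\<^sup>2 \<le> 0" using BA by linarith
    then have "B = 0" by (simp add: complex_eq_iff sum_power2_le_zero_iff)
    with AB A show False by simp
  qed
  then show ?thesis by blast
qed

text \<open>The sum is exp(- w z) T(exp(w z)), and exp(w z) is the limit of (1 + w z / m)^m = (w /
  m)^m (z + m / w)^m. As m / w is in the upper half-plane if \<open>w\<close> is in the lower one,
  \<open>symbol_nonzero\<close> applies before the limit, and \<open>upper_mono\<close> rescues the
  conclusion in the limit.\<close>

lemma symbol_exp_nonzero:
  assumes z: "Im z > 0" and w: "Im w < 0"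
  shows "(\<Sum>k=M..N. poly (cp (Q k)) z * w ^ k) \<noteq> 0"
proof -
  obtain m0 where m0: "\<And>m z w. m \<ge> m0 \<Longrightarrow> Im z > 0 \<Longrightarrow> Im w > 0 \<Longrightarrow>
     (\<Sum>k=M..N. poly (cp (Q k)) z * (of_real (ffactorial m k) * (z + w) ^ (m - k))) \<noteq> 0"
    using symbol_nonzero by auto
  \<comment> \<open>\<open>G m\<close> is the image of (1 + w z / m)^m, as a polynomial in
    \<open>z\<close>.\<close>
  define G where "G = (\<lambda>m. \<Sum>k=M..N. smult (of_real (ffactorial m k / real m ^ k) * w ^ k)
      (cp (Q k) * [:1, w / of_nat m:] ^ (m - k)))"
  define F where "F = (\<Sum>k=M..N. smult (w ^ k) (cp (Q k)))"
  have w0: "w \<noteq> 0" using w by auto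
  have Gz: "poly (G m) z = (\<Sum>k=M..N. of_real (ffactorial m k / real m ^ k) * w ^ k *
      (poly (cp (Q k)) z * (1 + w * z / of_nat m) ^ (m - k)))" for m z
    by (simp add: G_def poly_sum mult.commute)
  have Gnz: "poly (G m) z \<noteq> 0" if m: "m \<ge> max m0 1" and z: "Im z > 0" for m z
  proof -
    have "Im (of_nat m / w) > 0" using w m by (simp add: Im_divide divide_neg_pos mult_pos_neg sum_power2_gt_zero_iff zero_less_divide_iff)
    with m0[of m z "of_nat m / w"] m z
    have nz: "(\<Sum>k=M..N. poly (cp (Q k)) z * (of_real (ffactorial m k) * (z + of_nat m / w) ^ (m - k))) \<noteq> 0" by auto
    have m': "of_nat m \<noteq> (0::complex)" using m by auto
    have "of_real (ffactorial m k / real m ^ k) * w ^ k * (poly (cp (Q k)) z * (1 + w * z / of_nat m) ^ (m - k))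
      = (w / of_nat m) ^ m * (poly (cp (Q k)) z * (of_real (ffactorial m k) * (z + of_nat m / w) ^ (m - k)))" for k
    proof (cases "k \<le> m")
      case True
      have "1 + w * z / of_nat m = (w / of_nat m) * (z + of_nat m / w)" using w0 m' by (simp add: field_simps)
      then have "(1 + w * z / of_nat m) ^ (m - k) = (w / of_nat m) ^ (m - k) * (z + of_nat m / w) ^ (m - k)"
        by (simp only: power_mult_distrib)
      moreover have "(w / of_nat m) ^ m = (w / of_nat m) ^ k * (w / of_nat m) ^ (m - k)"
        using True by (simp flip: power_add)
      ultimately show ?thesis by (simp add: power_divide)
    qed (simp add: ffactorial_eq_0)
    then have "poly (G m) z = (w / of_nat m) ^ m *
       (\<Sum>k=M..N. poly (cp (Q k)) z * (of_real (ffactorial m k) * (z + of_nat m / w) ^ (m - k)))"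
      unfolding Gz by (simp add: sum_distrib_left)
    with nz w0 m' show ?thesis by simp
  qed
  have lim: "(\<lambda>m. poly (G m) z) \<longlonglongrightarrow> exp (w * z) * poly F z" for z
  proof -
    have "(\<lambda>m. (1 + w * z / of_nat m) ^ (m - k)) \<longlonglongrightarrow> exp (w * z)" for k
    proof -
      have "(\<lambda>m. w * z / of_nat m) \<longlonglongrightarrow> 0"
        by (rule tendsto_divide_0[OF tendsto_const filterlim_compose[OF tendsto_of_nat filterlim_ident]])
      then have l1: "(\<lambda>m. 1 + w * z / of_nat m) \<longlonglongrightarrow> 1" by (auto intro!: tendsto_eq_intros)
      then have "(\<lambda>m. (1 + w * z / of_nat m) ^ m / (1 + w * z / of_nat m) ^ k) \<longlonglongrightarrow> exp (w * z) / 1 ^ k"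
        by (intro tendsto_divide tendsto_exp_limit_complex tendsto_power) auto
      moreover have "eventually (\<lambda>m. (1 + w * z / of_nat m) ^ m / (1 + w * z / of_nat m) ^ k = (1 + w * z / of_nat m) ^ (m - k)) sequentially"
        using tendsto_imp_eventually_ne[OF l1 zero_neq_one[symmetric]] eventually_ge_at_top[of k]
        by eventually_elim (auto simp: power_diff)
      ultimately show ?thesis using Lim_transform_eventually by fastforce
    qed
    then have "(\<lambda>m. poly (G m) z) \<longlonglongrightarrow> (\<Sum>k=M..N. of_real 1 * w ^ k * (poly (cp (Q k)) z * exp (w * z)))"
      unfolding Gz by (intro tendsto_sum tendsto_mult tendsto_of_real tendsto_const ffactorial_tendsto)
    then show ?thesis by (simp add: F_def poly_sum sum_distrib_left mult_ac)
  qed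
  have "eventually (\<lambda>m. upper_mono (poly (G m))) sequentially"
    by (rule eventually_sequentiallyI[of "max m0 1"]) (intro upper_mono_poly Gnz)
  from upper_mono_tendsto[OF _ this lim] have um: "upper_mono (\<lambda>z. exp (w * z) * poly F z)" by simp
  \<comment> \<open>Only \<open>Q N\<close> reaches degree \<open>N + r\<close>, by nondegeneracy;
    this excludes that the limit is zero identically.\<close>
  have "coeff F (N + r) = w ^ N * of_real (c N)"
  proof -
    have "coeff F (N + r) = (\<Sum>k=M..N. w ^ k * of_real (coeff (Q k) (N + r)))"
      by (simp add: F_def coeff_sum coeff_map_poly)
    also have "\<dots> = (\<Sum>k\<in>{N}. w ^ k * of_real (coeff (Q k) (N + r)))"
    proof (rule sum.mono_neutral_right)
      show "\<forall>i\<in>{M..N} - {N}. w ^ i * complex_of_real (coeff (Q i) (N + r)) = 0"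
      proof
        fix i assume "i \<in> {M..N} - {N}"
        then have "degree (Q i) < N + r" using degree_Q[of i] by auto
        then show "w ^ i * complex_of_real (coeff (Q i) (N + r)) = 0" by (simp add: coeff_eq_0)
      qed
    qed (use M_le_N in auto)
    finally show ?thesis by (simp add: c_def)
  qed
  then have "F \<noteq> 0" using w0 c_N by auto
  from upper_mono_nonzero[OF um _ this z] show ?thesis by (simp add: F_def poly_sum mult.commute)
qed

text \<open>Replacing z by j z and w by w / j in the symbol and letting \<open>j\<close> grow keeps
  only the top coefficients \<open>c k\<close>. Products of a point of the upper and a point of the
  lower half-plane fill the plane except for the nonpositive real axis.\<close>

lemma top_symbol_nonzero:
  fixes x :: complex
  assumes "x \<notin> \<real>\<^sub>\<le>\<^sub>0"
  shows "(\<Sum>k=M..N. of_real (c k) * x ^ k) \<noteq> 0"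
proof -
  have nz: "(\<Sum>k=M..N. of_real (c k) * (z * w) ^ k) \<noteq> 0" if z: "Im z > 0" and w: "Im w < 0" for z w
  proof -
    \<comment> \<open>The symbol at (j z, w / j), divided by j^r; its limit is
      \<open>L\<close>.\<close>
    define H where "H = (\<lambda>j::nat. \<Sum>k=M..N. smult (w ^ k / of_nat j ^ (k + r)) (pcompose (cp (Q k)) [:0, of_nat j:]))"
    define L where "L = (\<Sum>k=M..N. monom (of_real (c k) * w ^ k) (k + r))"
    have Hz: "poly (H j) z = (\<Sum>k=M..N. w ^ k / of_nat j ^ (k + r) * poly (cp (Q k)) (of_nat j * z))" for j z
      by (simp add: H_def poly_sum poly_pcompose mult.commute)
    have w0: "w \<noteq> 0" using w by auto
    have "upper_mono (poly (H j))" if j: "j \<ge> 1" for j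
    proof (rule upper_mono_poly)
      fix z :: complex assume z: "Im z > 0"
      have j0: "of_nat j \<noteq> (0::complex)" using j by auto
      have "poly (H j) z = (1 / of_nat j ^ r) * (\<Sum>k=M..N. poly (cp (Q k)) (of_nat j * z) * (w / of_nat j) ^ k)"
        unfolding Hz sum_distrib_left by (intro sum.cong refl) (simp add: power_add power_divide mult_ac)
      moreover have "Im (of_nat j * z) > 0" "Im (w / of_nat j) < 0" using z w j by (auto simp: divide_neg_pos)
      ultimately show "poly (H j) z \<noteq> 0" using symbol_exp_nonzero j0 by simp
    qed
    then have ev: "eventually (\<lambda>j. upper_mono (poly (H j))) sequentially" by (rule eventually_sequentiallyI)
    have "(\<lambda>j. poly (H j) z) \<longlonglongrightarrow> poly L z" for z
    proof -
      have Qlim: "(\<lambda>j. poly (cp (Q k)) (of_nat j * z) / of_nat j ^ (k + r)) \<longlonglongrightarrow> of_real (c k) * z ^ (k + r)" for k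
      proof -
        have e: "poly (cp (Q k)) (of_nat j * z) = (\<Sum>i\<le>k + r. of_real (coeff (Q k) i) * (of_nat j * z) ^ i)" for j
        proof -
          have d: "degree (cp (Q k)) \<le> k + r" using degree_Q[of k] by (subst degree_map_poly) auto
          have "poly (cp (Q k)) x = (\<Sum>i\<le>k + r. coeff (cp (Q k)) i * x ^ i)" for x
            unfolding poly_altdef using d by (intro sum.mono_neutral_left) (auto simp: coeff_eq_0)
          then show ?thesis by (simp add: coeff_map_poly)
        qed
        have "(\<lambda>j. \<Sum>i\<le>k + r. of_real (coeff (Q k) i) * z ^ i * (of_nat j ^ i / of_nat j ^ (k + r)))
          \<longlonglongrightarrow> (\<Sum>i\<le>k + r. of_real (coeff (Q k) i) * z ^ i * (if i = k + r then 1 else 0))"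
        proof (intro tendsto_sum tendsto_mult tendsto_const)
          fix i assume i: "i \<in> {..k + r}"
          show "(\<lambda>j. of_nat j ^ i / of_nat j ^ (k + r) :: complex) \<longlonglongrightarrow> (if i = k + r then 1 else 0)"
          proof (cases "i = k + r")
            case True
            then show ?thesis by (intro tendsto_eventually eventually_sequentiallyI[of 1]) auto
          next
            case False
            with i have lt: "i < k + r" by auto
            have "(\<lambda>j. (inverse (of_nat j)) ^ (k + r - i) :: complex) \<longlonglongrightarrow> 0 ^ (k + r - i)"
              by (intro tendsto_power tendsto_inverse_0[THEN filterlim_compose] tendsto_of_nat)
            moreover have "eventually (\<lambda>j. (inverse (of_nat j)) ^ (k + r - i) = (of_nat j ^ i / of_nat j ^ (k + r) :: complex)) sequentially"
            proof (rule eventually_sequentiallyI[of 1])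
              fix j :: nat assume "1 \<le> j"
              then have "of_nat j \<noteq> (0::complex)" by auto
              moreover have "of_nat j ^ (k + r) = of_nat j ^ i * (of_nat j ^ (k + r - i) :: complex)"
                using lt by (simp flip: power_add)
              ultimately show "(inverse (of_nat j)) ^ (k + r - i) = (of_nat j ^ i / of_nat j ^ (k + r) :: complex)"
                by (simp add: field_simps)
            qed
            ultimately show ?thesis using False lt Lim_transform_eventually by (fastforce simp: power_0_left)
          qed
        qed
        also have "(\<Sum>i\<le>k + r. of_real (coeff (Q k) i) * z ^ i * (if i = k + r then 1 else 0)) = of_real (c k) * z ^ (k + r)"
          by (simp add: c_def if_distrib sum.delta cong: if_cong)
        finally show ?thesis unfolding e sum_divide_distrib power_mult_distrib by (simp add: mult_ac)
      qed
      have "(\<lambda>j. \<Sum>k=M..N. w ^ k * (poly (cp (Q k)) (of_nat j * z) / of_nat j ^ (k + r)))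
         \<longlonglongrightarrow> (\<Sum>k=M..N. w ^ k * (of_real (c k) * z ^ (k + r)))"
        by (intro tendsto_sum tendsto_mult tendsto_const Qlim)
      then show ?thesis by (simp add: Hz L_def poly_sum poly_monom mult_ac)
    qed
    from upper_mono_tendsto[OF _ ev this] have um: "upper_mono (\<lambda>z. 1 * poly L z)" by simp
    have "coeff L (N + r) = of_real (c N) * w ^ N"
      using M_le_N by (simp add: L_def coeff_sum sum.delta)
    then have "L \<noteq> 0" using w0 c_N by auto
    from upper_mono_nonzero[OF um _ this z] have "poly L z \<noteq> 0" by simp
    moreover have "poly L z = z ^ r * (\<Sum>k=M..N. of_real (c k) * (z * w) ^ k)"
      by (simp add: L_def poly_sum poly_monom sum_distrib_left power_add power_mult_distrib mult_ac)
    ultimately show ?thesis by auto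
  qed
  \<comment> \<open>Write \<open>x = z w\<close> with \<open>z = \<i> * csqrt x\<close> in the upper and \<open>w = - \<i> * csqrt x\<close> in the lower half-plane.\<close>
  have "Re (csqrt x) \<noteq> 0"
  proof
    assume "Re (csqrt x) = 0"
    then have "csqrt x = \<i> * of_real (Im (csqrt x))" by (simp add: complex_eq_iff)
    then have "x = (\<i> * of_real (Im (csqrt x)))\<^sup>2" by (metis power2_csqrt)
    then have "x = of_real (- (Im (csqrt x))\<^sup>2)" by (simp add: power_mult_distrib)
    then show False using assms by (metis neg_le_0_iff_le nonpos_Reals_of_real_iff zero_le_power2)
  qed
  then have "Re (csqrt x) > 0" using Re_csqrt[of x] by linarith
  then have "Im (\<i> * csqrt x) > 0" "Im (- \<i> * csqrt x) < 0" by auto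
  moreover have "(\<i> * csqrt x) * (- \<i> * csqrt x) = x" by (simp add: algebra_simps flip: power2_eq_square)
  ultimately show ?thesis using nz[of "\<i> * csqrt x" "- \<i> * csqrt x"] by simp
qed

text \<open>The characteristic polynomial of the operator with coefficients frozen at
  \<theta>.\<close>

definition symbol_at :: "real \<Rightarrow> real poly" where
  "symbol_at \<theta> = (\<Sum>k=M..N. monom (poly (Q k) \<theta>) k)"

lemma symbol_at_hyperbolic: "symbol_at \<theta> = 0 \<or> hyperbolic (symbol_at \<theta>)"
proof -
  \<comment> \<open>The real point is approached from above. The signs replace \<open>w\<close> by
    \<open>- w\<close>, which moves the zero-free half-plane to the upper one, as
    \<open>upper_mono\<close> requires.\<close>
  define G where "G = (\<lambda>j::nat. \<Sum>k=M..N. monom (poly (cp (Q k)) (Complex \<theta> (1 / Suc j)) * (-1) ^ k) k)"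
  define L where "L = (\<Sum>k=M..N. monom (poly (cp (Q k)) (of_real \<theta>) * (-1) ^ k) k)"
  have e: "(a * (-1) ^ k) * w ^ k = a * (- w) ^ k" for a w :: complex and k by (metis mult.assoc mult_minus1 power_mult_distrib)
  have ev: "eventually (\<lambda>j. upper_mono (poly (G j))) sequentially"
  proof (intro always_eventually allI upper_mono_poly)
    fix j and w :: complex assume "Im w > 0"
    then show "poly (G j) w \<noteq> 0"
      using symbol_exp_nonzero[of "Complex \<theta> (1 / Suc j)" "- w"] by (simp add: G_def poly_sum poly_monom e del: of_nat_Suc)
  qed
  have "(\<lambda>j. Complex \<theta> (1 / Suc j)) \<longlonglongrightarrow> Complex \<theta> 0"
    by (intro tendsto_Complex tendsto_const LIMSEQ_Suc[OF lim_const_over_n])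
  then have lz: "(\<lambda>j. Complex \<theta> (1 / Suc j)) \<longlonglongrightarrow> of_real \<theta>" by (simp add: complex_of_real_def)
  have "(\<lambda>j. poly (G j) w) \<longlonglongrightarrow> poly L w" for w
    unfolding G_def L_def poly_sum poly_monom by (intro tendsto_intros tendsto_poly lz)
  from upper_mono_tendsto[OF _ ev this] have um: "upper_mono (\<lambda>z. 1 * poly L z)" by simp
  have pL: "poly L w = poly (cp (symbol_at \<theta>)) (- w)" for w
    by (simp add: L_def symbol_at_def poly_sum cp_sum map_poly_monom poly_monom poly_cp_of_real e)
  have "poly (cp (symbol_at \<theta>)) z \<noteq> 0" if "symbol_at \<theta> \<noteq> 0" "Im z > 0" for z
  proof -
    have "L \<noteq> 0"
    proof
      assume "L = 0"
      then have "poly (cp (symbol_at \<theta>)) w = 0" for w using pL[of "- w"] by simp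
      then have "cp (symbol_at \<theta>) = 0" by (metis poly_all_0_iff_0)
      with that show False by (simp add: cp_eq_0_iff)
    qed
    \<comment> \<open>The point - cnj z is again in the upper half-plane, and \<open>L\<close> takes
      there the value of the symbol at cnj z.\<close>
    have "poly L (- cnj z) \<noteq> 0" by (rule upper_mono_nonzero[OF um]) (use \<open>L \<noteq> 0\<close> that in auto)
    then show ?thesis by (simp add: pL poly_cp_cnj)
  qed
  then show ?thesis using hyperbolic_if_upper by blast
qed

end

section \<open>Monotonicity and bounds for the zeros of images\<close>

text \<open>A factor z + |x| only adds nonnegative terms, so nothing cancels: no coefficient becomes
  negative and no gap opens below the leading one.\<close>

lemma monic_of_coeff_nonpos_roots:
  assumes "\<And>x. x \<in># X \<Longrightarrow> x \<le> (0::real)"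
  shows "(\<forall>k. coeff (monic_of X) k \<ge> 0) \<and>
    (\<forall>k j. coeff (monic_of X) k > 0 \<longrightarrow> k \<le> j \<longrightarrow> j \<le> size X \<longrightarrow> coeff (monic_of X) j > 0)"
  using assms
proof (induction X)
  case empty
  then show ?case by auto
next
  case (add x X)
  let ?h = "monic_of X"
  have nn: "\<And>k. coeff ?h k \<ge> 0" and
    up: "\<And>k j. coeff ?h k > 0 \<Longrightarrow> k \<le> j \<Longrightarrow> j \<le> size X \<Longrightarrow> coeff ?h j > 0" using add by auto
  have x: "x \<le> 0" using add.prems by auto
  define pr where "pr = (\<lambda>k. case k of 0 \<Rightarrow> 0 | Suc i \<Rightarrow> coeff ?h i)"
  have pr: "pr k \<ge> 0" for k using nn by (auto simp: pr_def split: nat.splits)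
  have e: "coeff (monic_of (add_mset x X)) k = pr k + (- x) * coeff ?h k" for k
    by (auto simp: monic_of_add_mset coeff_pCons pr_def split: nat.splits)
  have nn': "(- x) * coeff ?h k \<ge> 0" for k using nn x by (intro mult_nonneg_nonneg) auto
  show ?case
  proof (intro conjI allI impI)
    fix k show "coeff (monic_of (add_mset x X)) k \<ge> 0"
      unfolding e by (intro add_nonneg_nonneg pr nn')
  next
    fix k j assume k: "coeff (monic_of (add_mset x X)) k > 0" and kj: "k \<le> j" "j \<le> size (add_mset x X)"
    have "pr k > 0 \<or> (- x) * coeff ?h k > 0" using k unfolding e by linarith
    then consider (pred) i where "k = Suc i" "coeff ?h i > 0" | (same) "(- x) * coeff ?h k > 0"
      by (cases k) (auto simp: pr_def)
    then show "coeff (monic_of (add_mset x X)) j > 0"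
    proof cases
      case pred
      then obtain l where "j = Suc l" "i \<le> l" using kj by (cases j) auto
      moreover from this have "coeff ?h l > 0" using up[OF pred(2)] kj by auto
      ultimately have "pr j > 0" by (simp add: pr_def)
      then show ?thesis unfolding e using nn'[of j] by linarith
    next
      case same
      then have s: "- x > 0" "coeff ?h k > 0" using x nn[of k] by (auto simp: mult_less_0_iff)
      show ?thesis
      proof (cases "j \<le> size X")
        case True
        then have "(- x) * coeff ?h j > 0" using s up[OF s(2) kj(1)] by (intro mult_pos_pos) auto
        then show ?thesis unfolding e using pr[of j] by linarith
      next
        case False
        then have "j = Suc (size X)" using kj by auto
        then have "pr j > 0" using lead_coeff_monic_of[of X] by (simp add: pr_def)
        then show ?thesis unfolding e using nn'[of j] by linarith
      qed
    qed
  qed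
qed

context nondegenerate_preserver
begin

text \<open>By \<open>top_symbol_nonzero\<close> the polynomial with coefficients \<open>c k\<close>
  has only nonpositive real zeros, hence neither sign changes nor gaps among its
  coefficients.\<close>

lemma c_sign: "c N * c k \<ge> 0" "c k \<noteq> 0 \<Longrightarrow> k \<le> j \<Longrightarrow> j \<le> N \<Longrightarrow> c N * c j > 0"
proof -
  define C where "C = (\<Sum>k=M..N. monom (c k) k)"
  have cC: "coeff C k = c k" for k
    using c_outside[of k] by (auto simp: C_def coeff_sum sum.delta)
  have "degree C = N" using c_N cC by (intro antisym degree_le le_degree) (auto simp: c_outside)
  then have lC: "lead_coeff C = c N" by (simp add: cC)
  have pC: "poly (cp C) x = (\<Sum>k=M..N. of_real (c k) * x ^ k)" for x
    by (simp add: C_def cp_sum map_poly_monom poly_sum poly_monom)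
  have "C \<noteq> 0" using lC c_N by auto
  moreover have "poly (cp C) z \<noteq> 0" if "Im z > 0" for z
    unfolding pC using that by (intro top_symbol_nonzero) (auto simp: complex_nonpos_Reals_iff)
  ultimately have "hyperbolic C" by (rule hyperbolic_if_upper)
  from hyperbolic_decompose[OF this] lC have dec: "C = smult (c N) (monic_of (proots C))" by simp
  have sz: "size (proots C) = N" using hyperbolic_size_proots[OF \<open>hyperbolic C\<close>] \<open>degree C = N\<close> by simp
  have np: "x \<le> 0" if "x \<in># proots C" for x
  proof (rule ccontr)
    assume "\<not> x \<le> 0"
    then have "poly (cp C) (of_real x) \<noteq> 0" unfolding pC by (intro top_symbol_nonzero) auto
    then show False using that \<open>C \<noteq> 0\<close> by (simp add: poly_cp_of_real)
  qed
  have nr: "coeff (monic_of (proots C)) k \<ge> 0"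
    "coeff (monic_of (proots C)) k > 0 \<Longrightarrow> k \<le> j \<Longrightarrow> j \<le> N \<Longrightarrow> coeff (monic_of (proots C)) j > 0" for k j
    using monic_of_coeff_nonpos_roots[of "proots C"] np sz by blast+
  have ck: "c k = c N * coeff (monic_of (proots C)) k" for k using cC[of k] dec by (metis coeff_smult)
  have sq: "c N * c N > 0" using c_N by (metis not_real_square_gt_zero)
  have e: "c N * c k = (c N * c N) * coeff (monic_of (proots C)) k" for k using ck[of k] by simp
  show "c N * c k \<ge> 0" by (subst e) (intro mult_nonneg_nonneg less_imp_le[OF sq] nr(1))
  show "c N * c j > 0" if "c k \<noteq> 0" "k \<le> j" "j \<le> N"
  proof -
    have "coeff (monic_of (proots C)) k \<noteq> 0" using ck[of k] that(1) by auto
    then have "coeff (monic_of (proots C)) k > 0" using nr(1)[of k] by linarith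
    then have "coeff (monic_of (proots C)) j > 0" using nr(2) that by blast
    then show ?thesis by (subst e) (intro mult_pos_pos sq)
  qed
qed

lemma lam_nonneg: "c N * lam m \<ge> 0"
  unfolding lam_def sum_distrib_left mult.assoc[symmetric] by (intro sum_nonneg mult_nonneg_nonneg[OF c_sign(1) ffactorial_nonneg])

lemma lam_pos:
  assumes "c k \<noteq> 0" "k \<le> m" shows "c N * lam m > 0"
proof -
  have "k \<in> {M..N}" using c_outside[of k] assms(1) by (auto simp: not_less[symmetric])
  moreover have "c N * c k > 0" using c_sign(2)[of k k] assms(1) \<open>k \<in> {M..N}\<close> by auto
  ultimately have "(\<Sum>k=M..N. c N * c k * ffactorial m k) > 0"
    using \<open>k \<in> {M..N}\<close> mult_pos_pos[OF _ ffactorial_pos[OF assms(2)]] mult_nonneg_nonneg[OF c_sign(1) ffactorial_nonneg]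
    by (intro sum_pos2[of _ k]) auto
  then show ?thesis by (simp add: lam_def sum_distrib_left mult.assoc)
qed

lemma poly_T_linear_power:
  "poly (T ([:- w, 1:] ^ n)) x = (\<Sum>k=M..N. poly (Q k) x * (ffactorial n k * (x - w) ^ (n - k)))"
  by (simp add: diff_op_def poly_sum higher_pderiv_linear_power ffactorial_def mult_ac)

lemma ang_le_coeff:
  assumes "ang_le X Y" "size X = n" "n \<ge> 1"
  shows "coeff (monic_of Y) (n - 1) \<le> coeff (monic_of X) (n - 1)"
proof -
  have "size Y = n" using assms by (simp add: ang_le_def)
  then show ?thesis using assms ang_le_sum(1)[OF assms(1)]
    by (subst (1 2) monic_of_coeff_penultimate) auto
qed

text \<open>If \<^term>\<open>c M\<close> vanished, then at the first degree with \<^term>\<open>lam m \<noteq> 0\<close> the sums of zeros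
  of all images would agree, and so would the images themselves.\<close>

lemma c_M: "c M \<noteq> 0"
proof
  assume 0: "c M = 0"
  define m0 where "m0 = (LEAST k. c k \<noteq> 0)"
  have m0: "c m0 \<noteq> 0" unfolding m0_def using c_N by (rule LeastI)
  have min: "c k = 0" if "k < m0" for k using not_less_Least that unfolding m0_def by blast
  have "M < m0" using m0 0 c_outside[of m0] by (metis linorder_neqE_nat)
  define d where "d = m0 - 1"
  have d: "M \<le> d" "m0 = Suc d" using \<open>M < m0\<close> by (auto simp: d_def)
  have lam0: "lam d = 0" unfolding lam_def
    using min ffactorial_eq_0 d(2) by (intro sum.neutral) (metis less_Suc_eq_le mult_eq_0_iff not_less)
  have lam1: "lam m0 \<noteq> 0" using lam_pos[OF m0 order_refl] by auto
  \<comment> \<open>The power (z - w)^d is the difference of z (z - w)^d and (z - 1) (z - w)^d,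
    which are monic of degree \<open>m0\<close> and have equal images because
    \<open>lam d = 0\<close>.\<close>
  have kill: "T ([:- w, 1:] ^ d) = 0" for w
  proof -
    define W where "W = replicate_mset d w"
    have a: "ang_le (add_mset 0 W) (add_mset 1 W)" by (rule ang_le_move) simp
    have "T (monic_of (add_mset 0 W)) = T (monic_of (add_mset 1 W))"
    proof (rule T_ang_le(2)[OF ang_le_pencil[OF a], of m0])
      show "coeff (monic_of (add_mset 1 W)) (m0 - 1) \<le> coeff (monic_of (add_mset 0 W)) (m0 - 1)"
        by (rule ang_le_coeff[OF a]) (simp_all add: W_def d)
    qed (use d lam0 lam1 lead_coeff_monic_of[of "add_mset 0 W"] lead_coeff_monic_of[of "add_mset 1 W"] in \<open>auto simp: W_def\<close>)
    then have "T (monic_of (add_mset 0 W) - monic_of (add_mset 1 W)) = 0" by (simp add: T_diff)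
    moreover have "monic_of (add_mset 0 W) - monic_of (add_mset 1 W) = ([:0, 1:] - [:-1, 1:]) * monic_of W"
      by (simp only: monic_of_add_mset left_diff_distrib minus_zero)
    then have "monic_of (add_mset 0 W) - monic_of (add_mset 1 W) = [:- w, 1:] ^ d"
      by (simp add: W_def monic_of_replicate)
    ultimately show ?thesis by simp
  qed
  have "poly (Q M) \<theta> = 0" for \<theta>
  proof -
    \<comment> \<open>The value at the fixed point \<theta> of the image of (z - w)^d, as a
      polynomial in u = \<theta> - w; its coefficient at \<open>d - M\<close> isolates
      \<open>Q M\<close>.\<close>
    define R where "R = (\<Sum>k=M..N. monom (poly (Q k) \<theta> * ffactorial d k) (d - k))"
    have "poly R u = 0" for u
      using poly_T_linear_power[of "\<theta> - u" d \<theta>] kill[of "\<theta> - u"]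
      by (simp add: R_def poly_sum poly_monom mult.assoc)
    then have "R = 0" by (metis poly_all_0_iff_0)
    have "coeff R (d - M) = (\<Sum>k=M..N. if k = M then poly (Q M) \<theta> * ffactorial d M else 0)"
      unfolding R_def coeff_sum coeff_monom
      using d(1) by (intro sum.cong refl) (auto simp: ffactorial_eq_0)
    also have "\<dots> = poly (Q M) \<theta> * ffactorial d M" using M_le_N by (simp add: sum.delta)
    finally show ?thesis using \<open>R = 0\<close> ffactorial_pos[OF d(1)] by auto
  qed
  then have "Q M = 0" by (metis poly_all_0_iff_0)
  then show False using QM by simp
qed

lemma c_pos: "k \<in> {M..N} \<Longrightarrow> c N * c k > 0"
  using c_sign(2)[OF c_M] by auto

lemma lam_nz: "M \<le> n \<Longrightarrow> lam n \<noteq> 0"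
  using lam_pos[OF c_M, of n] by auto

text \<open>Supplies the sign condition of \<open>T_ang_le\<close> in every degree, not only in the
  large ones.\<close>

lemma lam_mult_nonneg: "lam m * lam n \<ge> 0"
  using lam_nonneg[of m] lam_nonneg[of n] c_N by (auto simp: zero_le_mult_iff)

section \<open>Dependence of the zeros of the image on the zeros of the argument\<close>

definition image_zeros :: "real multiset \<Rightarrow> real list" where
  "image_zeros X = zeros (T (monic_of X))"

lemma T_monic_of:
  assumes "M \<le> size X"
  shows "hyperbolic (T (monic_of X))" "lead_coeff (T (monic_of X)) = lam (size X)"
    "sorted (image_zeros X)" "length (image_zeros X) = size X + r" "mset (image_zeros X) = proots (T (monic_of X))"
    "T (monic_of X) = smult (lam (size X)) (monic_of (mset (image_zeros X)))"
proof -
  have l: "lead_coeff (monic_of X) = 1" by simp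
  note * = T_hyperbolic[OF hyperbolic_monic_of degree_monic_of l lam_nz[OF assms]]
  show "mset (image_zeros X) = proots (T (monic_of X))" by (simp add: image_zeros_def zeros_def)
  with * show "hyperbolic (T (monic_of X))" "lead_coeff (T (monic_of X)) = lam (size X)"
    "length (image_zeros X) = size X + r" "T (monic_of X) = smult (lam (size X)) (monic_of (mset (image_zeros X)))"
    by (auto simp flip: size_mset)
  show "sorted (image_zeros X)" by (simp add: image_zeros_def zeros_def)
qed

lemma T_interlace:
  assumes "ang_le X Y" "M \<le> size X"
  shows "interlaced (image_zeros X) (image_zeros Y)"
proof -
  have sY: "size Y = size X" using assms by (simp add: ang_le_def)
  have "ang_le (mset (image_zeros X)) (mset (image_zeros Y))"
  proof (cases "size X = 0")
    case True
    then have "X = {#}" "Y = {#}" using sY by auto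
    then show ?thesis by (simp add: ang_le_def)
  next
    case False
    then have n: "size X \<ge> 1" by linarith
    have "ang_le (proots (T (monic_of X))) (proots (T (monic_of Y)))"
      using lead_coeff_monic_of[of X] lead_coeff_monic_of[of Y] sY
      by (intro T_ang_le(1)[OF ang_le_pencil[OF assms(1)], of "size X"] n lam_nz lam_mult_nonneg assms(2)
          ang_le_coeff[OF assms(1)]) auto
    then show ?thesis using T_monic_of(5) assms sY by simp
  qed
  then show ?thesis using assms sY by (intro ang_le_interlaced T_monic_of(3)) auto
qed

text \<open>The zeros are moved one at a time, \<open>J\<close> being the set of indices already
  moved. Each move is an instance of \<open>ang_le_move\<close>, and \<open>T_interlace\<close>
  compares the images before and after it.\<close>

lemma T_mono:
  assumes I: "finite I" "M \<le> card I" and le: "\<And>i. i \<in> I \<Longrightarrow> x i \<le> y i" and j: "j < card I + r"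
  shows "image_zeros (image_mset x (mset_set I)) ! j \<le> image_zeros (image_mset y (mset_set I)) ! j"
proof -
  let ?x = "\<lambda>J i. if i \<in> J then y i else x i"
  have "image_zeros (image_mset x (mset_set I)) ! j \<le> image_zeros (image_mset (?x J) (mset_set I)) ! j" if "J \<subseteq> I" for J
    using finite_subset[OF that I(1)] that
  proof (induction J rule: finite_induct)
    case empty
    then show ?case by simp
  next
    case (insert k J)
    have I': "mset_set I = add_mset k (mset_set (I - {k}))" using insert.prems I by (simp add: mset_set.remove)
    let ?W = "image_mset (?x J) (mset_set (I - {k}))"
    have "image_mset (?x J) (mset_set I) = add_mset (x k) ?W" using insert.hyps by (simp add: I')
    moreover have "image_mset (?x (insert k J)) (mset_set I) = add_mset (y k) ?W"
      using I(1) by (simp add: I') (intro image_mset_cong, auto)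
    moreover have "ang_le (add_mset (x k) ?W) (add_mset (y k) ?W)" using le insert.prems by (intro ang_le_move) auto
    moreover have "size (image_mset (?x J) (mset_set I)) = card I" by simp
    ultimately have "interlaced (image_zeros (image_mset (?x J) (mset_set I))) (image_zeros (image_mset (?x (insert k J)) (mset_set I)))"
      and len: "length (image_zeros (image_mset (?x J) (mset_set I))) = card I + r"
      using I(2) T_monic_of(4)[of "image_mset (?x J) (mset_set I)"] by (auto intro!: T_interlace simp: size_image_mset)
    then have "image_zeros (image_mset (?x J) (mset_set I)) ! j \<le> image_zeros (image_mset (?x (insert k J)) (mset_set I)) ! j"
      using j by (simp add: interlaced_def)
    with insert show ?case by auto
  qed
  from this[of I] have "image_zeros (image_mset x (mset_set I)) ! j \<le> image_zeros (image_mset (?x I) (mset_set I)) ! j" by simp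
  also have "image_mset (?x I) (mset_set I) = image_mset y (mset_set I)"
    using I(1) by (intro image_mset_cong) auto
  finally show ?thesis .
qed

lemma lead_coeff_Q:
  assumes "k \<in> {M..N}" shows "degree (Q k) = k + r" "lead_coeff (Q k) = c k"
proof -
  have "c k \<noteq> 0" using c_pos[OF assms] by auto
  then have "k + r \<le> degree (Q k)" by (intro le_degree) (simp add: c_def)
  then show "degree (Q k) = k + r" using degree_Q[of k] by simp
  then show "lead_coeff (Q k) = c k" by (simp add: c_def)
qed

text \<open>For large arguments every \<open>Q k\<close> has the sign of \<open>c N\<close>, so the
  terms of the image at x > b cannot cancel.\<close>

lemma upper_bound:
  assumes "M \<le> n"
  shows "\<exists>b0. \<forall>b\<ge>b0. \<forall>x>b. poly (T ([:- b, 1:] ^ n)) x \<noteq> 0"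
proof -
  have "eventually (\<lambda>x. c N * poly (Q k) x > 0) at_top" if k: "k \<in> {M..N}" for k
  proof -
    have l: "lead_coeff (smult (c N) (Q k)) > 0" using c_pos[OF k] lead_coeff_Q[OF k] c_N by simp
    from poly_pinfty_gt_lc[OF this] obtain b where "\<forall>x\<ge>b. poly (smult (c N) (Q k)) x \<ge> lead_coeff (smult (c N) (Q k))" by auto
    with l show ?thesis unfolding eventually_at_top_linorder by (intro exI[of _ b]) fastforce
  qed
  then have "eventually (\<lambda>x. \<forall>k\<in>{M..N}. c N * poly (Q k) x > 0) at_top"
    by (intro eventually_ball_finite) auto
  then obtain b0 where b0: "\<And>x k. x \<ge> b0 \<Longrightarrow> k \<in> {M..N} \<Longrightarrow> c N * poly (Q k) x > 0"
    unfolding eventually_at_top_linorder by blast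
  have "poly (T ([:- b, 1:] ^ n)) x \<noteq> 0" if "b \<ge> b0" "x > b" for b x
  proof -
    have "(\<Sum>k=M..N. c N * poly (Q k) x * (ffactorial n k * (x - b) ^ (n - k))) > 0"
    proof (rule sum_pos2[of _ M])
      show "c N * poly (Q M) x * (ffactorial n M * (x - b) ^ (n - M)) > 0"
        using that M_le_N ffactorial_pos[OF assms] by (intro mult_pos_pos[OF b0] mult_pos_pos zero_less_power) auto
      show "c N * poly (Q k) x * (ffactorial n k * (x - b) ^ (n - k)) \<ge> 0" if "k \<in> {M..N}" for k
        using \<open>b \<ge> b0\<close> \<open>x > b\<close> that by (intro mult_nonneg_nonneg[OF less_imp_le[OF b0]] mult_nonneg_nonneg zero_le_power) auto
    qed (use M_le_N in auto)
    then have "c N * poly (T ([:- b, 1:] ^ n)) x > 0"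
      by (simp add: poly_T_linear_power sum_distrib_left mult.assoc)
    then show ?thesis by auto
  qed
  then show ?thesis by blast
qed

text \<open>On the far left \<open>Q k\<close> has the sign of \<open>c N\<close> times (-1)^(k +
  r), and (x - a)^(n - k) contributes (-1)^(n - k); the product does not depend on
  \<open>k\<close>.\<close>

lemma lower_bound_far:
  assumes "M \<le> n"
  shows "\<exists>a0. \<forall>a\<le>a0. \<forall>x<a. poly (T ([:- a, 1:] ^ n)) x \<noteq> 0"
proof -
  have "eventually (\<lambda>x. c N * ((- 1) ^ (k + r) * poly (Q k) (- x)) > 0) at_top" if k: "k \<in> {M..N}" for k
  proof -
    let ?p = "smult (c N * (-1) ^ (k + r)) (pcompose (Q k) [:0, -1:])"
    have "lead_coeff (pcompose (Q k) [:0, -1:]) = c k * (-1) ^ (k + r)"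
      by (subst lead_coeff_comp) (simp_all add: lead_coeff_Q(1)[OF k] c_def)
    moreover have "(-1) ^ (k + r) * (-1) ^ (k + r) = (1::real)" by (simp flip: power_mult_distrib)
    ultimately have lp: "lead_coeff ?p = c N * c k"
      by (simp only: lead_coeff_smult) (metis mult.assoc mult.commute mult.right_neutral)
    have l: "lead_coeff ?p > 0" unfolding lp by (rule c_pos[OF k])
    from poly_pinfty_gt_lc[OF this] obtain b where "\<forall>x\<ge>b. poly ?p x \<ge> lead_coeff ?p" by auto
    with l have "\<forall>x\<ge>b. poly ?p x > 0" by (meson less_le_trans)
    then show ?thesis unfolding eventually_at_top_linorder by (intro exI[of _ b]) (auto simp: poly_pcompose mult.assoc)
  qed
  then have "eventually (\<lambda>x. \<forall>k\<in>{M..N}. c N * ((- 1) ^ (k + r) * poly (Q k) (- x)) > 0) at_top"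
    by (intro eventually_ball_finite) auto
  then obtain b0 where b0: "\<And>x k. x \<ge> b0 \<Longrightarrow> k \<in> {M..N} \<Longrightarrow> c N * ((- 1) ^ (k + r) * poly (Q k) (- x)) > 0"
    unfolding eventually_at_top_linorder by blast
  have "poly (T ([:- a, 1:] ^ n)) x \<noteq> 0" if ax: "a \<le> - b0" "x < a" for a x
  proof -
    have pos: "c N * ((- 1) ^ (k + r) * poly (Q k) x) > 0" if "k \<in> {M..N}" for k
      using b0[of "- x" k] ax that by simp
    have "(\<Sum>k=M..N. c N * ((- 1) ^ (k + r) * poly (Q k) x) * (ffactorial n k * (a - x) ^ (n - k))) > 0"
    proof (rule sum_pos2[of _ M])
      show "c N * ((- 1) ^ (M + r) * poly (Q M) x) * (ffactorial n M * (a - x) ^ (n - M)) > 0"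
        using pos[of M] ax M_le_N ffactorial_pos[OF assms] by (intro mult_pos_pos[OF pos] mult_pos_pos zero_less_power) auto
      show "c N * ((- 1) ^ (k + r) * poly (Q k) x) * (ffactorial n k * (a - x) ^ (n - k)) \<ge> 0" if "k \<in> {M..N}" for k
        using pos[OF that] ax by (intro mult_nonneg_nonneg[OF less_imp_le[OF pos[OF that]]] mult_nonneg_nonneg zero_le_power) auto
    qed (use M_le_N in auto)
    also have "(\<Sum>k=M..N. c N * ((- 1) ^ (k + r) * poly (Q k) x) * (ffactorial n k * (a - x) ^ (n - k)))
      = (\<Sum>k=M..N. c N * (- 1) ^ (n + r) * (poly (Q k) x * (ffactorial n k * (x - a) ^ (n - k))))"
    proof (intro sum.cong refl)
      fix k
      show "c N * ((- 1) ^ (k + r) * poly (Q k) x) * (ffactorial n k * (a - x) ^ (n - k))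
        = c N * (- 1) ^ (n + r) * (poly (Q k) x * (ffactorial n k * (x - a) ^ (n - k)))"
      proof (cases "k \<le> n")
        case True
        have "(a - x) ^ (n - k) = ((- 1) * (x - a)) ^ (n - k)" by simp
        then have e: "(a - x) ^ (n - k) = (- 1) ^ (n - k) * (x - a) ^ (n - k)" by (simp only: power_mult_distrib)
        have "(- 1 :: real) ^ (n + r) = (- 1) ^ (k + r) * (- 1) ^ (n - k)" using True by (simp add: add.commute flip: power_add)
        then show ?thesis unfolding e by (simp only: mult_ac)
      qed (simp add: ffactorial_eq_0)
    qed
    finally have "c N * (- 1) ^ (n + r) * poly (T ([:- a, 1:] ^ n)) x > 0"
      by (simp add: poly_T_linear_power sum_distrib_left)
    then show ?thesis by auto
  qed
  then show ?thesis by blast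
qed

text \<open>After division by the common power of z - w only the term \<open>k = min n N\<close>
  survives at \<open>w\<close>: smaller \<open>k\<close> keep a factor z - w, larger ones have
  falling factorial 0.\<close>

lemma order_T_linear_power:
  assumes "M \<le> n"
  shows "n - min n N \<le> order w (T ([:- w, 1:] ^ n))"
    and "poly (Q (min n N)) w \<noteq> 0 \<Longrightarrow> order w (T ([:- w, 1:] ^ n)) = n - min n N"
proof -
  let ?e = "min n N"
  define H where "H = (\<Sum>k=M..N. smult (ffactorial n k) (Q k * [:- w, 1:] ^ (?e - k)))"
  have "T ([:- w, 1:] ^ n) = (\<Sum>k=M..N. [:- w, 1:] ^ (n - ?e) * smult (ffactorial n k) (Q k * [:- w, 1:] ^ (?e - k)))"
    unfolding diff_op_def higher_pderiv_linear_power
  proof (intro sum.cong refl)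
    fix k assume "k \<in> {M..N}"
    show "Q k * smult (of_nat (n choose k) * fact k) ([:- w, 1:] ^ (n - k))
      = [:- w, 1:] ^ (n - ?e) * smult (ffactorial n k) (Q k * [:- w, 1:] ^ (?e - k))"
    proof (cases "k \<le> n")
      case True
      then have "n - k = (n - ?e) + (?e - k)" using \<open>k \<in> {M..N}\<close> by auto
      then have "[:- w, 1:] ^ (n - k) = [:- w, 1:] ^ (n - ?e) * [:- w, 1:] ^ (?e - k)"
        by (simp only: power_add)
      then show ?thesis by (simp add: ffactorial_def mult_ac del: mult_pCons_left mult_pCons_right)
    qed (simp add: ffactorial_def binomial_eq_0)
  qed
  then have e: "T ([:- w, 1:] ^ n) = [:- w, 1:] ^ (n - ?e) * H" by (simp only: H_def sum_distrib_left)
  have nz: "T ([:- w, 1:] ^ n) \<noteq> 0"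
    using T_monic_of(1)[of "replicate_mset n w"] assms by (auto simp: monic_of_replicate hyperbolic_def)
  then have o: "order w (T ([:- w, 1:] ^ n)) = n - ?e + order w H"
    unfolding e by (subst order_mult) (auto simp: order_power_n_n)
  then show "n - ?e \<le> order w (T ([:- w, 1:] ^ n))" by simp
  assume q: "poly (Q ?e) w \<noteq> 0"
  have "poly H w = (\<Sum>k=M..N. if k = ?e then ffactorial n ?e * poly (Q ?e) w else 0)"
    unfolding H_def poly_sum
  proof (intro sum.cong refl)
    fix k assume k: "k \<in> {M..N}"
    show "poly (smult (ffactorial n k) (Q k * [:- w, 1:] ^ (?e - k))) w
      = (if k = ?e then ffactorial n ?e * poly (Q ?e) w else 0)"
    proof (cases "k = ?e")
      case False
      then have "?e - k \<noteq> 0 \<or> ffactorial n k = 0" using k by (auto simp: ffactorial_eq_0)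
      then show ?thesis using False by (auto simp: power_0_left)
    qed simp
  qed
  also have "\<dots> = ffactorial n ?e * poly (Q ?e) w" using assms M_le_N by (simp add: sum.delta)
  finally have "poly H w \<noteq> 0" using q ffactorial_pos[of ?e n] by auto
  then have "order w H = 0" by (rule order_0I)
  then show "order w (T ([:- w, 1:] ^ n)) = n - ?e" using o by simp
qed

lemma count_mset_nth: "count (mset xs) x = card {i. i < length xs \<and> xs ! i = x}"
proof -
  have "count (mset xs) x = length (filter ((=) x) xs)" by (metis count_mset count_list_eq_length_filter)
  then show ?thesis by (simp add: length_filter_conv_card eq_commute)
qed

text \<open>As \<open>w\<close> increases, the zeros of the image of \<open>(z - w) ^ n\<close> do not decrease, and \<open>w\<close> itself is a zero
  of multiplicity exactly \<open>n - min n N\<close> until it reaches a zero of \<^term>\<open>Q (min n N)\<close>. So \<open>w\<close> cannot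
  overtake any other zero before that.\<close>

lemma lower_bound:
  assumes n: "M \<le> n" and r: "r \<ge> 1" and Qe: "\<And>x. x < a \<Longrightarrow> poly (Q (min n N)) x \<noteq> 0"
  shows "\<forall>x<a. poly (T ([:- a, 1:] ^ n)) x \<noteq> 0"
proof -
  define e where "e = min n N"
  define \<zeta> where "\<zeta> = (\<lambda>w. image_zeros (replicate_mset n w))"
  have P: "T (monic_of (replicate_mset n w)) = T ([:- w, 1:] ^ n)" for w by (simp add: monic_of_replicate)
  have Tn: "T ([:- w, 1:] ^ n) \<noteq> 0" for w
    using T_monic_of(1)[of "replicate_mset n w"] n by (auto simp: P hyperbolic_def)
  have len: "length (\<zeta> w) = n + r" and srt: "sorted (\<zeta> w)" and ms: "mset (\<zeta> w) = proots (T ([:- w, 1:] ^ n))" for w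
    using T_monic_of(3,4,5)[of "replicate_mset n w"] n by (auto simp: \<zeta>_def P)
  have set: "set (\<zeta> w) = {x. poly (T ([:- w, 1:] ^ n)) x = 0}" for w
    using Tn by (metis ms set_count_proots set_mset_mset)
  have mono: "\<zeta> w ! j \<le> \<zeta> w' ! j" if "w \<le> w'" "j < n + r" for w w' j
    using T_mono[of "{..<n}" "\<lambda>_. w" "\<lambda>_. w'" j] n that by (simp add: \<zeta>_def image_mset_const_eq)
  define C where "C = (\<lambda>w. \<forall>x<w. poly (T ([:- w, 1:] ^ n)) x \<noteq> 0)"
  have C: "C w \<longleftrightarrow> w \<le> \<zeta> w ! 0" for w
  proof
    assume "C w"
    moreover have "\<zeta> w ! 0 \<in> set (\<zeta> w)" using len r by (intro nth_mem) auto
    ultimately show "w \<le> \<zeta> w ! 0" by (auto simp: C_def set not_less[symmetric])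
  next
    assume w: "w \<le> \<zeta> w ! 0"
    have "w \<le> x" if x: "poly (T ([:- w, 1:] ^ n)) x = 0" for x
    proof -
      have "x \<in> set (\<zeta> w)" using x set by auto
      then obtain j where "j < length (\<zeta> w)" "x = \<zeta> w ! j" by (auto simp: in_set_conv_nth)
      then show ?thesis using w sorted_nth_mono[OF srt[of w], of 0 j] by auto
    qed
    then show "C w" by (force simp: C_def)
  qed
  \<comment> \<open>The points up to \<open>a\<close> that no zero of their image has overtaken. The
    supremum will turn out to be \<open>a\<close>.\<close>
  define E where "E = {w. w \<le> a \<and> C w}"
  obtain a0 where a0: "\<And>w. w \<le> a0 \<Longrightarrow> C w" using lower_bound_far[OF n] by (auto simp: C_def)
  have ne: "E \<noteq> {}" using a0[of "min a a0"] by (auto simp: E_def intro!: exI[of _ "min a a0"])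
  have bdd: "bdd_above E" by (auto simp: E_def bdd_above_def)
  define s where "s = Sup E"
  have sa: "s \<le> a" unfolding s_def using ne by (intro cSup_least) (auto simp: E_def)
  \<comment> \<open>A zero left of \<open>s\<close> would already have been left of some
    \<open>w\<close> in \<open>E\<close>, since zeros only move to the right as \<open>w\<close>
    grows.\<close>
  have Cs: "C s"
  proof (rule ccontr)
    assume "\<not> C s"
    then have "\<zeta> s ! 0 < s" by (simp add: C)
    then obtain w where w: "w \<in> E" "\<zeta> s ! 0 < w" unfolding s_def using ne by (auto elim: less_cSupE)
    then have "w \<le> s" unfolding s_def using bdd by (intro cSup_upper)
    then have "\<zeta> w ! 0 \<le> \<zeta> s ! 0" using mono r by simp
    with w show False by (auto simp: E_def C)
  qed
  have "s = a"
  proof (rule ccontr)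
    assume "s \<noteq> a"
    with sa have lt: "s < a" by simp
    have ord: "count (mset (\<zeta> s)) s = n - e"
      using order_T_linear_power(2)[OF n Qe[OF lt]] Tn by (simp add: ms e_def)
    have ne': "n - e < n + r" using r by auto
    \<comment> \<open>No zero lies left of \<open>s\<close>, and \<open>s\<close> occurs n - e
      times, so index n - e, counted from 0, is the first zero beyond \<open>s\<close>. It exists
      because \<open>r \<ge> 1\<close>.\<close>
    have gt: "\<zeta> s ! (n - e) > s"
    proof (rule ccontr)
      assume "\<not> \<zeta> s ! (n - e) > s"
      then have "\<zeta> s ! j = s" if "j \<le> n - e" for j
        using Cs sorted_nth_mono[OF srt[of s], of 0 j] sorted_nth_mono[OF srt[of s], of j "n - e"] that ne' len[of s]
        by (auto simp: C)
      then have "{..n - e} \<subseteq> {i. i < length (\<zeta> s) \<and> \<zeta> s ! i = s}" using ne' len[of s] by auto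
      then have "card {..n - e} \<le> count (mset (\<zeta> s)) s" unfolding count_mset_nth by (intro card_mono) auto
      with ord show False by simp
    qed
    \<comment> \<open>A point beyond \<open>s\<close>, but still short of the next zero for
      \<open>s\<close>, and hence short of the zero with the same index for
      \<open>w\<close>.\<close>
    define w where "w = min a ((s + \<zeta> s ! (n - e)) / 2)"
    have w: "s < w" "w \<le> a" "w < \<zeta> s ! (n - e)" using lt gt by (auto simp: w_def min_def field_simps)
    then have wz: "w < \<zeta> w ! (n - e)" using mono[of s w "n - e"] ne' by auto
    have "C w"
    proof (rule ccontr)
      assume "\<not> C w"
      then have 0: "\<zeta> w ! 0 < w" by (simp add: C)
      \<comment> \<open>With the first zero left of \<open>w\<close> and the one at index n - e
        right of it, there are at most n - e - 1 places for the zero \<open>w\<close>, fewer than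
        its multiplicity.\<close>
      have "j \<in> {1..<n - e}" if j: "j < length (\<zeta> w)" "\<zeta> w ! j = w" for j
      proof -
        have "j \<noteq> 0" using 0 j(2) by (metis less_irrefl)
        moreover have "j < n - e"
          using sorted_nth_mono[OF srt[of w], of "n - e" j] wz j by (auto simp: not_less[symmetric])
        ultimately show ?thesis by auto
      qed
      then have "card {i. i < length (\<zeta> w) \<and> \<zeta> w ! i = w} \<le> card {1..<n - e}" by (intro card_mono) auto
      moreover have "n - e \<le> count (mset (\<zeta> w)) w"
        using order_T_linear_power(1)[OF n, of w] Tn by (simp add: ms e_def)
      moreover have "n - e \<noteq> 0" using 0 wz by auto
      ultimately show False by (simp add: count_mset_nth)
    qed
    with w have "w \<in> E" by (simp add: E_def)
    then have "w \<le> s" unfolding s_def using bdd by (intro cSup_upper)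
    with w show False by simp
  qed
  with Cs show ?thesis by (simp add: C_def)
qed

lemma start_point_lower_bound:
  assumes n: "M \<le> n" and r: "r \<ge> 1"
  shows "\<forall>x<start_point N Q n. poly (T ([:- start_point N Q n, 1:] ^ n)) x \<noteq> 0"
proof -
  let ?S = "{x. poly (Q (min n N)) x = 0}"
  have "Q (min n N) \<noteq> 0"
    using lead_coeff_Q(1)[of "min n N"] n M_le_N r by auto
  then have fin: "finite ?S" by (rule poly_roots_finite)
  \<comment> \<open>Otherwise \<open>lower_bound\<close> holds at every point. With
    \<open>upper_bound\<close> at a large \<open>b\<close> the only zero of the image would be
    \<open>b\<close>, of multiplicity n + r instead of \<open>n - min n N\<close>.\<close>
  have "?S \<noteq> {}"
  proof
    assume "?S = {}"
    then have nz: "poly (Q (min n N)) x \<noteq> 0" for x by auto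
    obtain b where "\<forall>x>b. poly (T ([:- b, 1:] ^ n)) x \<noteq> 0" using upper_bound[OF n] by blast
    moreover have "\<forall>x<b. poly (T ([:- b, 1:] ^ n)) x \<noteq> 0" by (rule lower_bound[OF n r nz])
    ultimately have all: "poly (T ([:- b, 1:] ^ n)) x = 0 \<Longrightarrow> x = b" for x by (metis linorder_neqE_linordered_idom)
    let ?P = "T ([:- b, 1:] ^ n)"
    have h: "hyperbolic ?P" "size (proots ?P) = n + r"
      using T_monic_of(1,4,5)[of "replicate_mset n b"] n by (auto simp: monic_of_replicate simp flip: size_mset)
    then have P0: "?P \<noteq> 0" by (auto simp: hyperbolic_def)
    have "set_mset (proots ?P) \<subseteq> {b}" using all P0 by auto
    then have "proots ?P = replicate_mset (size (proots ?P)) b" by (metis set_mset_subset_singletonD)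
    then have "count (proots ?P) b = n + r" using h by (metis count_replicate_mset)
    then have "order b ?P = n + r" using P0 by simp
    with order_T_linear_power(2)[OF n nz[of b]] r show False by simp
  qed
  have "poly (Q (min n N)) x \<noteq> 0" if "x < start_point N Q n" for x
    using Min_le[OF fin, of x] that by (auto simp: start_point_def)
  then show ?thesis by (rule lower_bound[OF n r])
qed

end

section \<open>Convergence of the iteration\<close>

lemma tendsto_coeff_monic_of:
  assumes "finite I" "\<And>j. j \<in> I \<Longrightarrow> (\<lambda>i. x i j) \<longlonglongrightarrow> (xl j :: real)"
  shows "(\<lambda>i. coeff (monic_of (image_mset (x i) (mset_set I))) k)
    \<longlonglongrightarrow> coeff (monic_of (image_mset xl (mset_set I))) k"
  using assms
proof (induction I arbitrary: k rule: finite_induct)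
  case (insert j I)
  have e: "coeff (monic_of (image_mset y (mset_set (insert j I)))) k
    = (case k of 0 \<Rightarrow> 0 | Suc l \<Rightarrow> coeff (monic_of (image_mset y (mset_set I))) l)
      - y j * coeff (monic_of (image_mset y (mset_set I))) k" for y :: "'a \<Rightarrow> real"
    using insert.hyps by (auto simp: monic_of_add_mset coeff_pCons split: nat.splits)
  have "(\<lambda>i. case k of 0 \<Rightarrow> 0 | Suc l \<Rightarrow> coeff (monic_of (image_mset (x i) (mset_set I))) l)
    \<longlonglongrightarrow> (case k of 0 \<Rightarrow> 0 | Suc l \<Rightarrow> coeff (monic_of (image_mset xl (mset_set I))) l)"
    using insert by (cases k) auto
  then show ?case unfolding e using insert by (intro tendsto_intros) auto
qed simp

lemma poly_lim_eqI:
  assumes "\<And>k. (\<lambda>i. coeff (s i) k) \<longlonglongrightarrow> coeff p k"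
  shows "poly_lim s = p"
  unfolding poly_lim_def
proof (rule the_equality)
  fix q assume "\<forall>k. (\<lambda>i. coeff (s i) k) \<longlonglongrightarrow> coeff q k"
  then show "q = p" using assms LIMSEQ_unique by (intro poly_eqI) blast
qed (use assms in blast)

lemma image_mset_nth_pred:
  "image_mset (\<lambda>i. xs ! (i - 1)) (mset_set {1..length xs}) = mset xs"
proof -
  have "mset xs = image_mset ((!) xs) (mset_set {0..<length xs})"
    by (metis map_nth mset_map mset_upt)
  moreover have "mset_set {1..length xs} = image_mset Suc (mset_set {0..<length xs})"
    by (subst image_mset_mset_set) (auto simp: image_Suc_atLeastLessThan atLeastLessThanSuc_atLeastAtMost)
  ultimately show ?thesis by (simp add: image_mset.compositionality o_def)
qed

lemma mset_set_split:
  assumes "A \<subseteq> I" "finite I" shows "mset_set A + mset_set (I - A) = mset_set I"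
  using assms mset_set_Union[of A "I - A"] by (metis Diff_disjoint Un_Diff_cancel finite_Diff finite_subset sup.absorb2)

text \<open>Evaluates the definite description: leading coefficient and zeros determine a hyperbolic
  polynomial, and as \<open>f\<close> is monic the leading coefficient goes to
  \<open>v\<close>.\<close>

lemma pattern_factorization_eq:
  assumes p: "hyperbolic p" "degree p = n + r" and A: "A \<subseteq> {1..n + r}" "card A = r"
  defines "B \<equiv> {1..n + r} - A" and "x \<equiv> \<lambda>i. zeros p ! (i - 1)"
  shows "pattern_factorization r n A p
    = (smult (lead_coeff p) (monic_of (image_mset x (mset_set A))), monic_of (image_mset x (mset_set B)))"
proof -
  let ?v = "smult (lead_coeff p) (monic_of (image_mset x (mset_set A)))"
  let ?f = "monic_of (image_mset x (mset_set B))"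
  have l: "lead_coeff p \<noteq> 0" using p(1) by (simp add: hyperbolic_def)
  have len: "length (zeros p) = n + r" "mset (zeros p) = proots p"
    using hyperbolic_size_proots[OF p(1)] p(2) by (auto simp: zeros_def simp flip: size_mset)
  have cB: "card B = n" using A card_Diff_subset[of A "{1..n + r}"] finite_subset[OF A(1)] by (simp add: B_def)
  have vf: "p = ?v * ?f"
  proof -
    have "image_mset x (mset_set A) + image_mset x (mset_set B) = image_mset x (mset_set {1..n + r})"
      using mset_set_split[OF A(1)] by (simp add: B_def flip: image_mset_union)
    also have "\<dots> = proots p" using image_mset_nth_pred[of "zeros p"] len by (simp add: x_def)
    finally show ?thesis using hyperbolic_decompose[OF p(1)] by (simp flip: monic_of_union)
  qed
  have fin: "finite A" "finite B" using A finite_subset by (auto simp: B_def)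
  show ?thesis
    unfolding pattern_factorization_def
  proof (rule the_equality)
    show "case (?v, ?f) of (v, f) \<Rightarrow> p = v * f \<and> lead_coeff f = 1 \<and> zero_pattern r n A ({1..n + r} - A) v f"
    proof -
      have "zero_pattern r n A B ?v ?f"
        unfolding zero_pattern_def vf[symmetric] x_def[symmetric]
        using l A cB fin by (auto simp: hyperbolic_smult hyperbolic_monic_of B_def)
      moreover have "lead_coeff ?f = 1" using lead_coeff_monic_of[of "image_mset x (mset_set B)"] by simp
      ultimately show ?thesis using vf by (simp only: split B_def)
    qed
  next
    fix q assume q: "case q of (v, f) \<Rightarrow> p = v * f \<and> lead_coeff f = 1 \<and> zero_pattern r n A ({1..n + r} - A) v f"
    obtain v f where vf: "q = (v, f)" by (cases q)
    with q have e: "p = v * f" "lead_coeff f = 1" and z: "zero_pattern r n A B v f" by (auto simp: B_def)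
    have h: "hyperbolic v" "hyperbolic f" and r: "proots v = image_mset x (mset_set A)" "proots f = image_mset x (mset_set B)"
      using z unfolding zero_pattern_def x_def e(1) by auto
    have "lead_coeff v = lead_coeff p" unfolding e(1) lead_coeff_mult using e(2) by simp
    then have "v = ?v" using hyperbolic_decompose[OF h(1)] r by metis
    moreover have "f = ?f" using hyperbolic_decompose[OF h(2)] r e(2) by (metis smult_1_left)
    ultimately show "q = (?v, ?f)" using vf by simp
  qed
qed

lemma interlaced_imp_sorted:
  assumes "interlaced xs ys" shows "sorted xs" "sorted ys"
  using assms unfolding interlaced_def sorted_iff_nth_Suc by (auto, meson Suc_lessD order_trans, metis Suc_lessD order_trans)

lemma set_splice: "set (splice xs ys) = set xs \<union> set ys"
  using set_shuffles[OF splice_in_shuffles] .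

text \<open>Neighbours in the spliced list come from different lists, so disjointness makes every
  inequality between neighbours strict.\<close>

lemma interlaced_splice:
  assumes "interlaced xs ys" shows "sorted_wrt (\<le>) (splice xs ys)"
    and "set xs \<inter> set ys = {} \<Longrightarrow> sorted_wrt (<) (splice xs ys)"
proof -
  have *: "interlaced (a # as) (b # bs) \<longleftrightarrow> a \<le> b \<and> interlaced as bs \<and> (as \<noteq> [] \<longrightarrow> b \<le> hd as)" for a b and as bs :: "real list"
    unfolding interlaced_def by (auto simp: All_less_Suc2 hd_conv_nth nth_Cons split: nat.splits)
  have "length xs = length ys" using assms by (simp add: interlaced_def)
  then show "sorted_wrt (\<le>) (splice xs ys)" using assms
  proof (induction xs ys rule: list_induct2)
    case (Cons x xs y ys)
    then have i: "x \<le> y" "interlaced xs ys" "xs \<noteq> [] \<Longrightarrow> y \<le> hd xs" by (auto simp: *)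
    have s: "sorted xs" "sorted ys" "sorted (y # ys)" using interlaced_imp_sorted[OF i(2)] interlaced_imp_sorted[OF Cons.prems] by auto
    have "y \<le> z" if "z \<in> set xs \<union> set ys" for z
    proof (cases xs)
      case Nil
      then show ?thesis using that s(3) by auto
    next
      case (Cons x' xs')
      then show ?thesis using that s i(3) by (auto intro: order_trans)
    qed
    with i Cons.IH[OF i(2)] show ?case by (auto simp: set_splice intro: order_trans)
  qed simp
  from \<open>length xs = length ys\<close> show "sorted_wrt (<) (splice xs ys)" if "set xs \<inter> set ys = {}"
    using assms that
  proof (induction xs ys rule: list_induct2)
    case (Cons x xs y ys)
    then have i: "x \<le> y" "interlaced xs ys" "xs \<noteq> [] \<Longrightarrow> y \<le> hd xs" by (auto simp: *)
    have xy: "x < y" using i(1) Cons.prems by (auto simp: less_le)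
    have s: "sorted xs" using interlaced_imp_sorted[OF i(2)] by auto
    have le: "ys \<noteq> [] \<Longrightarrow> hd xs \<le> hd ys" "length xs = length ys" "sorted ys"
      using i(2) interlaced_imp_sorted[OF i(2)] by (cases xs; cases ys; auto simp: interlaced_def)+
    have "y < z" if "z \<in> set xs \<union> set ys" for z
    proof -
      have "xs \<noteq> []" "ys \<noteq> []" using that le(2) by auto
      then have "y < hd xs" using i(3) Cons.prems by (metis disjoint_iff hd_in_set less_le list.set_intros)
      moreover have "hd xs \<le> z" using that s le \<open>xs \<noteq> []\<close> \<open>ys \<noteq> []\<close>
        by (cases xs; cases ys) (auto intro: order_trans)
      ultimately show ?thesis by simp
    qed
    moreover have "sorted_wrt (<) (splice xs ys)" using Cons.IH[OF i(2)] Cons.prems by auto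
    ultimately show ?case using xy by (auto simp: set_splice intro: less_trans)
  qed simp
qed

text \<open>The Wronskian at a real point is the upward derivative of Im (p cnj q), which is 0 on
  the real axis and at most 0 above it.\<close>

lemma ang_le_wronskian:
  assumes "ang_le X Y"
  shows "poly (pderiv (monic_of X) * monic_of Y - monic_of X * pderiv (monic_of Y)) x \<le> 0"
proof -
  define p q where "p = cp (monic_of X)" and "q = cp (monic_of Y)"
  let ?z = "\<lambda>t. of_real x + \<i> * of_real t"
  let ?h = "\<lambda>t. Im (poly p (?z t) * cnj (poly q (?z t)))"
  have vd: "((\<lambda>t. poly s (?z t)) has_vector_derivative (\<i> * poly (pderiv s) (of_real x))) (at 0)" for s
  proof -
    have "((\<lambda>t. ?z t) has_vector_derivative \<i>) (at 0)"
      by (auto intro!: derivative_eq_intros)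
    moreover have "(poly s has_field_derivative poly (pderiv s) (of_real x)) (at (?z 0))"
      by (simp add: poly_DERIV)
    ultimately show ?thesis using field_vector_diff_chain_at[of ?z \<i> 0 "poly s"] by (simp add: o_def)
  qed
  let ?d = "poly (pderiv (monic_of X)) x * poly (monic_of Y) x - poly (monic_of X) x * poly (pderiv (monic_of Y)) x"
  have "((\<lambda>t. poly p (?z t) * cnj (poly q (?z t))) has_vector_derivative
     (poly p (?z 0) * cnj (\<i> * poly (pderiv q) (of_real x)) + \<i> * poly (pderiv p) (of_real x) * cnj (poly q (?z 0)))) (at 0)"
    by (intro has_vector_derivative_mult has_vector_derivative_cnj vd)
  also have "(poly p (?z 0) * cnj (\<i> * poly (pderiv q) (of_real x)) + \<i> * poly (pderiv p) (of_real x) * cnj (poly q (?z 0))) = \<i> * of_real ?d"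
    by (simp add: p_def q_def poly_cp_of_real flip: cp_pderiv) (simp add: algebra_simps)
  finally have "(?h has_vector_derivative Im (\<i> * of_real ?d)) (at 0)"
    by (rule bounded_linear.has_vector_derivative[OF bounded_linear_Im])
  then have "(?h has_real_derivative ?d) (at 0)"
    by (simp add: has_real_derivative_iff_has_vector_derivative)
  then have "((\<lambda>t. (?h t - ?h 0) / t) \<longlongrightarrow> ?d) (at_right 0)"
    by (auto simp: has_field_derivative_iff intro: filterlim_mono at_le)
  moreover have "eventually (\<lambda>t. (?h t - ?h 0) / t \<le> 0) (at_right 0)"
    using eventually_at_right_less[of 0]
  proof eventually_elim
    case (elim t)
    have "?h t \<le> 0" unfolding p_def q_def using elim by (intro ang_le_Im[OF assms]) auto
    moreover have "?h 0 = 0" by (simp add: p_def q_def poly_cp_of_real)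
    ultimately show ?case using elim by (simp add: divide_nonpos_pos)
  qed
  ultimately have "?d \<le> 0" by (intro tendsto_upperbound) auto
  then show ?thesis by simp
qed

section \<open>The iteration as a monotone sequence of indexed zeros\<close>

context nondegenerate_preserver
begin

text \<open>Working with indexed zeros instead of polynomials gives monotone convergence entry by
  entry. All n + r indices begin at the starting point, also those in \<open>A\<close>, so that the
  first comparison covers every index. Indices start at 1, hence \<open>j - 1\<close>.\<close>

primrec zero_iter :: "nat \<Rightarrow> nat set \<Rightarrow> nat \<Rightarrow> nat \<Rightarrow> real" where
  "zero_iter n A 0 = (\<lambda>_. start_point N Q n)"
| "zero_iter n A (Suc i) = (\<lambda>j. image_zeros (image_mset (zero_iter n A i) (mset_set ({1..n + r} - A))) ! (j - 1))"

definition zero_lim :: "nat \<Rightarrow> nat set \<Rightarrow> nat \<Rightarrow> real" where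
  "zero_lim n A j = lim (\<lambda>i. zero_iter n A i j)"

definition zero_set_f :: "nat \<Rightarrow> nat set \<Rightarrow> nat \<Rightarrow> real multiset" where
  "zero_set_f n A i = image_mset (zero_iter n A i) (mset_set ({1..n + r} - A))"

lemma tendsto_coeff_T:
  assumes "\<And>k. (\<lambda>i. coeff (f i) k) \<longlonglongrightarrow> coeff g k"
  shows "(\<lambda>i. coeff (T (f i)) k) \<longlonglongrightarrow> coeff (T g) k"
  unfolding diff_op_def coeff_sum coeff_mult coeff_higher_pderiv by (intro tendsto_intros assms)

context
  fixes n :: nat and A :: "nat set"
  assumes n: "M \<le> n" and A: "A \<subseteq> {1..n + r}" "card A = r"
begin

lemma card_complement: "card ({1..n + r} - A) = n"
  using A card_Diff_subset[of A "{1..n + r}"] finite_subset[OF A(1)] by simp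

lemma size_zero_set_f: "size (zero_set_f n A i) = n"
  using card_complement by (simp add: zero_set_f_def)

lemma image_zeros_zero_set_f:
  shows "sorted (image_zeros (zero_set_f n A i))" "length (image_zeros (zero_set_f n A i)) = n + r"
    "T (monic_of (zero_set_f n A i)) = smult (lam n) (monic_of (image_mset (zero_iter n A (Suc i)) (mset_set {1..n + r})))"
    "j \<in> {1..n + r} \<Longrightarrow> zero_iter n A (Suc i) j = image_zeros (zero_set_f n A i) ! (j - 1)"
    "map (zero_iter n A (Suc i)) [1..<Suc (n + r)] = image_zeros (zero_set_f n A i)"
proof -
  note * = T_monic_of[of "zero_set_f n A i", unfolded size_zero_set_f, OF n]
  show "sorted (image_zeros (zero_set_f n A i))" "length (image_zeros (zero_set_f n A i)) = n + r" by (rule *(3), rule *(4))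
  show e: "zero_iter n A (Suc i) j = image_zeros (zero_set_f n A i) ! (j - 1)" for j by (simp add: zero_set_f_def)
  show "map (zero_iter n A (Suc i)) [1..<Suc (n + r)] = image_zeros (zero_set_f n A i)"
  proof (rule nth_equalityI)
    show "length (map (zero_iter n A (Suc i)) [1..<Suc (n + r)]) = length (image_zeros (zero_set_f n A i))"
      using *(4) by (simp del: upt_Suc)
    fix l assume "l < length (map (zero_iter n A (Suc i)) [1..<Suc (n + r)])"
    then show "map (zero_iter n A (Suc i)) [1..<Suc (n + r)] ! l = image_zeros (zero_set_f n A i) ! l"
      using e[of "1 + l"] by (simp del: upt_Suc zero_iter.simps)
  qed
  have "image_mset (zero_iter n A (Suc i)) (mset_set {1..n + r}) = mset (image_zeros (zero_set_f n A i))"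
  proof -
    have "zero_iter n A (Suc i) = (\<lambda>j. image_zeros (zero_set_f n A i) ! (j - 1))" by (simp add: zero_set_f_def fun_eq_iff)
    then show ?thesis using image_mset_nth_pred[of "image_zeros (zero_set_f n A i)"] unfolding *(4) by (simp only:)
  qed
  then show "T (monic_of (zero_set_f n A i)) = smult (lam n) (monic_of (image_mset (zero_iter n A (Suc i)) (mset_set {1..n + r})))"
    using *(6) by simp
qed

lemma pattern_factorization_T:
  "pattern_factorization r n A (T (monic_of (zero_set_f n A i)))
    = (smult (lam n) (monic_of (image_mset (zero_iter n A (Suc i)) (mset_set A))), monic_of (zero_set_f n A (Suc i)))"
proof -
  note * = T_monic_of[of "zero_set_f n A i", unfolded size_zero_set_f, OF n]
  have "degree (T (monic_of (zero_set_f n A i))) = n + r"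
    using *(6) *(4) lam_nz[OF n] by (metis degree_monic_of degree_smult_eq size_mset)
  from pattern_factorization_eq[OF *(1) this A] *(2)
  show ?thesis by (simp add: zero_set_f_def image_zeros_def)
qed

lemma f_seq_eq: "f_seq M N Q r n A i = monic_of (zero_set_f n A i)"
proof (induction i)
  case 0
  have "zero_set_f n A 0 = replicate_mset n (start_point N Q n)"
    using card_complement by (simp add: zero_set_f_def image_mset_const_eq)
  then show ?case by (simp add: monic_of_replicate)
qed (simp add: pattern_factorization_T)

lemma v_seq_eq: "v_seq M N Q r n A i = smult (lam n) (monic_of (image_mset (zero_iter n A (Suc i)) (mset_set A)))"
  by (simp only: v_seq_def f_seq_eq pattern_factorization_T fst_conv)

context
  assumes r: "r \<ge> 1"
begin

lemma image_zeros_replicate_bounds: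
  assumes j: "j < n + r"
  shows "\<forall>x<a. poly (T ([:- a, 1:] ^ n)) x \<noteq> 0 \<Longrightarrow> a \<le> image_zeros (replicate_mset n a) ! j"
    and "\<forall>x>a. poly (T ([:- a, 1:] ^ n)) x \<noteq> 0 \<Longrightarrow> image_zeros (replicate_mset n a) ! j \<le> a"
proof -
  note * = T_monic_of[of "replicate_mset n a", simplified, OF n]
  have "image_zeros (replicate_mset n a) ! j \<in># mset (image_zeros (replicate_mset n a))" using *(4) j by simp
  then have "poly (T ([:- a, 1:] ^ n)) (image_zeros (replicate_mset n a) ! j) = 0"
    using *(1,5) by (simp add: monic_of_replicate hyperbolic_def)
  then show "\<forall>x<a. poly (T ([:- a, 1:] ^ n)) x \<noteq> 0 \<Longrightarrow> a \<le> image_zeros (replicate_mset n a) ! j"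
    "\<forall>x>a. poly (T ([:- a, 1:] ^ n)) x \<noteq> 0 \<Longrightarrow> image_zeros (replicate_mset n a) ! j \<le> a"
    by (auto simp: not_less[symmetric])
qed

text \<open>By \<open>start_point_lower_bound\<close> no zero of the first image lies left of the
  starting point; \<open>T_mono\<close> propagates this inequality.\<close>

lemma zero_iter_mono: "j \<in> {1..n + r} \<Longrightarrow> zero_iter n A i j \<le> zero_iter n A (Suc i) j"
proof (induction i arbitrary: j)
  case 0
  have "image_mset (\<lambda>_. start_point N Q n) (mset_set ({1..n + r} - A)) = replicate_mset n (start_point N Q n)"
    using card_complement by (simp add: image_mset_const_eq)
  then show ?case using image_zeros_replicate_bounds(1)[OF _ start_point_lower_bound[OF n r], of "j - 1"] 0
    by auto
next
  case (Suc i)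
  have "image_zeros (image_mset (zero_iter n A i) (mset_set ({1..n + r} - A))) ! (j - 1)
    \<le> image_zeros (image_mset (zero_iter n A (Suc i)) (mset_set ({1..n + r} - A))) ! (j - 1)"
    using Suc n by (intro T_mono) (auto simp: card_complement[simplified] simp del: zero_iter.simps)
  then show ?case by simp
qed

text \<open>For large \<open>b\<close> the image of (z - b)^n has no zero beyond \<open>b\<close>,
  and by \<open>T_mono\<close> its zeros dominate those of every image of a polynomial with zeros at
  most \<open>b\<close>. So this bound reproduces itself.\<close>

lemma zero_iter_bounded: "\<exists>b. \<forall>i. \<forall>j\<in>{1..n + r}. zero_iter n A i j \<le> b"
proof -
  obtain b0 where b0: "\<And>b. b \<ge> b0 \<Longrightarrow> \<forall>x>b. poly (T ([:- b, 1:] ^ n)) x \<noteq> 0" using upper_bound[OF n] by blast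
  define b where "b = max b0 (start_point N Q n)"
  have "zero_iter n A i j \<le> b" if "j \<in> {1..n + r}" for i j
    using that
  proof (induction i arbitrary: j)
    case (Suc i)
    have "image_zeros (image_mset (zero_iter n A i) (mset_set ({1..n + r} - A))) ! (j - 1)
      \<le> image_zeros (image_mset (\<lambda>_. b) (mset_set ({1..n + r} - A))) ! (j - 1)"
      using Suc n by (intro T_mono) (auto simp: card_complement[simplified])
    also have "\<dots> \<le> b"
      using image_zeros_replicate_bounds(2)[OF _ b0, of "j - 1" b] Suc.prems card_complement
      by (auto simp: image_mset_const_eq b_def)
    finally show ?case by simp
  qed (simp add: b_def)
  then show ?thesis by blast
qed

lemma zero_iter_tendsto:
  assumes j: "j \<in> {1..n + r}" shows "(\<lambda>i. zero_iter n A i j) \<longlonglongrightarrow> zero_lim n A j"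
proof -
  have "incseq (\<lambda>i. zero_iter n A i j)" using zero_iter_mono[OF j] by (intro incseq_SucI)
  moreover obtain b where "\<forall>i. zero_iter n A i j \<le> b" using zero_iter_bounded j by blast
  then have "bdd_above (range (\<lambda>i. zero_iter n A i j))" by (auto simp: bdd_above_def)
  ultimately have "(\<lambda>i. zero_iter n A i j) \<longlonglongrightarrow> (SUP i. zero_iter n A i j)" by (intro LIMSEQ_incseq_SUP)
  then show ?thesis unfolding zero_lim_def by (simp add: limI)
qed

lemma v_poly_eq: "v_poly M N Q r n A = smult (lam n) (monic_of (image_mset (zero_lim n A) (mset_set A)))"
  unfolding v_poly_def
proof (rule poly_lim_eqI)
  fix k
  have "(\<lambda>i. coeff (monic_of (image_mset (zero_iter n A (Suc i)) (mset_set A))) k)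
    \<longlonglongrightarrow> coeff (monic_of (image_mset (zero_lim n A) (mset_set A))) k"
    using A by (intro tendsto_coeff_monic_of LIMSEQ_Suc zero_iter_tendsto) (auto intro: finite_subset)
  then show "(\<lambda>i. coeff (v_seq M N Q r n A i) k) \<longlonglongrightarrow> coeff (smult (lam n) (monic_of (image_mset (zero_lim n A) (mset_set A)))) k"
    unfolding v_seq_eq coeff_smult by (intro tendsto_mult tendsto_const)
qed

text \<open>The fixed point equation: coefficientwise continuity of \<open>T\<close> carries the
  recursion over to the limit.\<close>

lemma T_limit:
  "T (monic_of (image_mset (zero_lim n A) (mset_set ({1..n + r} - A))))
    = smult (lam n) (monic_of (image_mset (zero_lim n A) (mset_set {1..n + r})))"
proof (rule poly_eqI)
  fix k
  have "(\<lambda>i. coeff (T (monic_of (zero_set_f n A i))) k) \<longlonglongrightarrow>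
    coeff (T (monic_of (image_mset (zero_lim n A) (mset_set ({1..n + r} - A))))) k"
    unfolding zero_set_f_def by (intro tendsto_coeff_T tendsto_coeff_monic_of zero_iter_tendsto) auto
  moreover have "(\<lambda>i. coeff (monic_of (image_mset (zero_iter n A (Suc i)) (mset_set {1..n + r}))) k)
    \<longlonglongrightarrow> coeff (monic_of (image_mset (zero_lim n A) (mset_set {1..n + r}))) k"
    by (intro tendsto_coeff_monic_of LIMSEQ_Suc zero_iter_tendsto) auto
  then have "(\<lambda>i. coeff (T (monic_of (zero_set_f n A i))) k) \<longlonglongrightarrow>
    coeff (smult (lam n) (monic_of (image_mset (zero_lim n A) (mset_set {1..n + r})))) k"
    unfolding image_zeros_zero_set_f(3) coeff_smult by (intro tendsto_mult tendsto_const)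
  ultimately show "coeff (T (monic_of (image_mset (zero_lim n A) (mset_set ({1..n + r} - A))))) k
    = coeff (smult (lam n) (monic_of (image_mset (zero_lim n A) (mset_set {1..n + r})))) k"
    by (rule LIMSEQ_unique)
qed

end
end
end

section \<open>Interlacing of the iterates\<close>

lemma sorted_list_of_set_Suc_image:
  "finite A \<Longrightarrow> sorted_list_of_set (Suc ` A) = map Suc (sorted_list_of_set A)"
  using sorted_list_of_set.idem_if_sorted_distinct[of "map Suc (sorted_list_of_set A)"]
  by (simp add: sorted_map distinct_map)

lemma mset_sorted_list_of_set_eq: "mset (sorted_list_of_set A) = mset_set A"
  by (metis mset_sorted_list_of_multiset sorted_list_of_mset_set)

text \<open>Let \<open>B0\<close> be the complement of \<open>A\<close> in [m - 1]. The complement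
  of \<open>A\<close> in [m] is \<open>B0\<close> followed by m, that of A + 1 is 1 followed by B0 +
  1; all relations can be read off from this.\<close>

lemma complement_Suc_image:
  fixes A :: "nat set"
  assumes A: "A \<subseteq> {1..m - 1}" and m: "m \<ge> 1"
  defines "B \<equiv> sorted_list_of_set ({1..m} - A)" and "B' \<equiv> sorted_list_of_set ({1..m} - Suc ` A)"
  shows "length B' = length B" "\<And>j. j < length B \<Longrightarrow> B' ! j \<le> B ! j"
    "\<And>j. Suc j < length B \<Longrightarrow> B' ! Suc j = Suc (B ! j)" "length B > 0 \<Longrightarrow> B' ! 0 = 1"
proof -
  define B0 where "B0 = sorted_list_of_set ({1..m - 1} - A)"
  have sB: "sorted_wrt (<) B0" "set B0 = {1..m - 1} - A" unfolding B0_def by (simp_all del: strict_sorted_iff)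
  have B: "B = B0 @ [m]"
  proof -
    have "set (B0 @ [m]) = {1..m} - A" using A m sB(2) by auto
    moreover have "sorted_wrt (<) (B0 @ [m])" using sB m by (auto simp: sorted_wrt_append)
    ultimately show ?thesis unfolding B_def
      by (metis sorted_list_of_set.idem_if_sorted_distinct strict_sorted_iff)
  qed
  have B': "B' = 1 # map Suc B0"
  proof -
    have "set (1 # map Suc B0) = {1..m} - Suc ` A"
    proof (intro set_eqI iffI)
      fix i assume "i \<in> {1..m} - Suc ` A"
      then show "i \<in> set (1 # map Suc B0)" using sB(2) by (cases i) (auto simp: image_iff)
    qed (use A m sB(2) in auto)
    moreover have "sorted_wrt (<) (1 # map Suc B0)" using sB by (auto simp: sorted_wrt_map)
    ultimately show ?thesis unfolding B'_def
      by (metis sorted_list_of_set.idem_if_sorted_distinct strict_sorted_iff)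
  qed
  show len: "length B' = length B" by (simp add: B B')
  show s: "B' ! Suc j = Suc (B ! j)" if "Suc j < length B" for j using that by (simp add: B B' nth_append)
  show z: "B' ! 0 = 1" by (simp add: B')
  have st: "sorted_wrt (<) B" unfolding B_def by (simp del: strict_sorted_iff)
  have ge1: "B ! j \<ge> 1" if "j < length B" for j
  proof -
    have "B ! j \<in> set B" using that by simp
    then show ?thesis by (auto simp: B_def)
  qed
  show "B' ! j \<le> B ! j" if "j < length B" for j
  proof (cases j)
    case (Suc i)
    then have "B ! i < B ! j" using st that by (auto simp: sorted_wrt_iff_nth_less)
    then show ?thesis using s[of i] Suc that by simp
  qed (use ge1[OF that] z in simp)
qed

lemma interlaced_map_upt_iff:
  "interlaced (map x [1..<Suc m]) (map y [1..<Suc m]) \<longleftrightarrow>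
    (\<forall>j\<in>{1..m}. x j \<le> y j) \<and> (\<forall>j\<in>{1..<m}. y j \<le> x (Suc j))"
proof -
  have "interlaced (map x [1..<Suc m]) (map y [1..<Suc m]) \<longleftrightarrow>
    (\<forall>j<m. x (Suc j) \<le> y (Suc j)) \<and> (\<forall>j. Suc j < m \<longrightarrow> y (Suc j) \<le> x (Suc (Suc j)))"
    unfolding interlaced_def by (auto simp: nth_map_upt simp del: upt_Suc)
  also have "(\<forall>j<m. x (Suc j) \<le> y (Suc j)) \<longleftrightarrow> (\<forall>j\<in>{1..m}. x j \<le> y j)"
  proof (intro iffI ballI)
    fix j assume "\<forall>j<m. x (Suc j) \<le> y (Suc j)" "j \<in> {1..m}"
    then show "x j \<le> y j" by (cases j) auto
  qed auto
  also have "(\<forall>j. Suc j < m \<longrightarrow> y (Suc j) \<le> x (Suc (Suc j))) \<longleftrightarrow> (\<forall>j\<in>{1..<m}. y j \<le> x (Suc j))"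
  proof (intro iffI ballI)
    fix j assume "\<forall>j. Suc j < m \<longrightarrow> y (Suc j) \<le> x (Suc (Suc j))" "j \<in> {1..<m}"
    then show "y j \<le> x (Suc j)" by (cases j) auto
  qed auto
  finally show ?thesis .
qed

text \<open>The hypothesis amounts to x' j \<le> x j \<le> x' (j + 1). Passing to the complements
  keeps the order of \<open>x'\<close> and \<open>x\<close>. For the indices in \<open>A\<close>,
  however, a is paired with a + 1, and x a \<le> x' (a + 1) puts \<open>x\<close> first.\<close>

lemma interlaced_complement:
  assumes il: "interlaced (map x' [1..<Suc m]) (map x [1..<Suc m])" and A: "A \<subseteq> {1..m - 1}" and m: "m \<ge> 1"
  shows "interlaced (map x' (sorted_list_of_set ({1..m} - Suc ` A))) (map x (sorted_list_of_set ({1..m} - A)))"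
    and "interlaced (map x (sorted_list_of_set A)) (map x' (sorted_list_of_set (Suc ` A)))"
    and "\<lbrakk>i \<le> j; 1 \<le> i; j \<le> m\<rbrakk> \<Longrightarrow> x i \<le> x j"
proof -
  have le: "\<And>j. j \<in> {1..m} \<Longrightarrow> x' j \<le> x j" and le': "\<And>j. j \<in> {1..<m} \<Longrightarrow> x j \<le> x' (Suc j)"
    using il unfolding interlaced_map_upt_iff by auto
  have nth: "map z [1..<Suc m] ! (i - 1) = z i" if "1 \<le> i" "i \<le> m" for z :: "nat \<Rightarrow> real" and i
    using that by (simp del: upt_Suc)
  have mono': "x' i \<le> x' j" and mono: "x i \<le> x j" if "i \<le> j" "1 \<le> i" "j \<le> m" for i j
    using sorted_nth_mono[OF interlaced_imp_sorted(1)[OF il], of "i - 1" "j - 1"]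
      sorted_nth_mono[OF interlaced_imp_sorted(2)[OF il], of "i - 1" "j - 1"] nth[of i] nth[of j] that
    by (simp_all del: upt_Suc)
  from mono show "\<lbrakk>i \<le> j; 1 \<le> i; j \<le> m\<rbrakk> \<Longrightarrow> x i \<le> x j" .
  let ?B = "sorted_list_of_set ({1..m} - A)" and ?B' = "sorted_list_of_set ({1..m} - Suc ` A)"
  note c = complement_Suc_image[OF A m]
  have B: "?B ! j \<in> {1..m}" if "j < length ?B" for j
  proof -
    have "?B ! j \<in> set ?B" using that by (rule nth_mem)
    then show ?thesis by auto
  qed
  have B': "?B' ! j \<in> {1..m}" if "j < length ?B" for j
  proof -
    have "?B' ! j \<in> set ?B'" using that c(1) by (metis nth_mem)
    then show ?thesis by auto
  qed
  show "interlaced (map x' ?B') (map x ?B)"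
    unfolding interlaced_def
  proof (intro conjI allI impI)
    show "length (map x' ?B') = length (map x ?B)" using c(1) by simp
  next
    fix j assume "j < length (map x' ?B')"
    then have j: "j < length ?B" using c(1) by simp
    have "x' (?B' ! j) \<le> x (?B' ! j)" using le[OF B'[OF j]] .
    also have "\<dots> \<le> x (?B ! j)" using mono[OF c(2)[OF j]] B[OF j] B'[OF j] by auto
    finally show "map x' ?B' ! j \<le> map x ?B ! j" using j c(1) by simp
  next
    fix j assume "Suc j < length (map x' ?B')"
    then have j: "Suc j < length ?B" using c(1) by simp
    have "?B ! j < m" using c(3)[OF j] B'[of "Suc j"] j by auto
    then have "x (?B ! j) \<le> x' (Suc (?B ! j))" using le'[of "?B ! j"] B[of j] j by auto
    then show "map x ?B ! j \<le> map x' ?B' ! Suc j" using j c(1,3) by simp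
  qed
  let ?A = "sorted_list_of_set A"
  have fA: "finite A" using A finite_subset by blast
  have inA: "?A ! j \<in> A" if "j < length ?A" for j using nth_mem[OF that] fA by simp
  show "interlaced (map x ?A) (map x' (sorted_list_of_set (Suc ` A)))"
    unfolding sorted_list_of_set_Suc_image[OF fA] interlaced_def
  proof (intro conjI allI impI)
    fix j assume "j < length (map x ?A)"
    then have "j < length ?A" by simp
    moreover from this have "?A ! j \<in> {1..<m}" using inA[of j] A m by fastforce
    ultimately show "map x ?A ! j \<le> map x' (map Suc ?A) ! j" using le' by simp
  next
    fix j assume "Suc j < length (map x ?A)"
    then have j: "Suc j < length ?A" by simp
    have a: "?A ! j \<in> {1..<m}" "?A ! Suc j \<in> {1..<m}" using inA[of j] inA[of "Suc j"] j A m by fastforce+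
    have "sorted_wrt (<) ?A" by (simp del: strict_sorted_iff)
    then have "?A ! j < ?A ! Suc j" using j by (simp add: sorted_wrt_iff_nth_less)
    then have "x' (Suc (?A ! j)) \<le> x' (?A ! Suc j)" using a by (intro mono') auto
    also have "\<dots> \<le> x (?A ! Suc j)" using le a by auto
    finally show "map x' (map Suc ?A) ! j \<le> map x ?A ! Suc j" using j by simp
  qed simp
qed

context nondegenerate_preserver
begin

context
  fixes n :: nat and A :: "nat set"
  assumes n: "M \<le> n" and A: "A \<subseteq> {1..n + r - 1}" "card A = r" and r: "r \<ge> 1"
begin

lemma A_bounds: "A \<subseteq> {1..n + r}" "Suc ` A \<subseteq> {1..n + r}" "card (Suc ` A) = r"
  using A(1) r by (force dest: subsetD[OF A(1)], force dest: subsetD[OF A(1)], simp add: card_image A(2))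

text \<open>The two statements feed each other: \<open>T_interlace\<close> leads from the arguments
  to the zeros of their images, and selecting the complements of \<open>A\<close> and A + 1 leads
  back to arguments. At the start all zeros coincide.\<close>

lemma zero_iter_interlace:
  "interlaced (map (zero_iter n (Suc ` A) i) (sorted_list_of_set ({1..n + r} - Suc ` A)))
      (map (zero_iter n A i) (sorted_list_of_set ({1..n + r} - A)))"
  "interlaced (map (zero_iter n (Suc ` A) (Suc i)) [1..<Suc (n + r)]) (map (zero_iter n A (Suc i)) [1..<Suc (n + r)])"
proof -
  have step: "interlaced (map (zero_iter n (Suc ` A) (Suc i)) [1..<Suc (n + r)]) (map (zero_iter n A (Suc i)) [1..<Suc (n + r)])"
    if "interlaced (map (zero_iter n (Suc ` A) i) (sorted_list_of_set ({1..n + r} - Suc ` A)))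
      (map (zero_iter n A i) (sorted_list_of_set ({1..n + r} - A)))" for i
  proof -
    have "ang_le (zero_set_f n (Suc ` A) i) (zero_set_f n A i)"
      using interlaced_ang_le[OF that] by (simp add: zero_set_f_def mset_sorted_list_of_set_eq)
    then have "interlaced (image_zeros (zero_set_f n (Suc ` A) i)) (image_zeros (zero_set_f n A i))"
      using size_zero_set_f[OF n A_bounds(2,3)] n by (intro T_interlace) auto
    then show ?thesis
      using image_zeros_zero_set_f(5)[OF n A_bounds(2,3)] image_zeros_zero_set_f(5)[OF n A_bounds(1) A(2)] by simp
  qed
  show *: "interlaced (map (zero_iter n (Suc ` A) i) (sorted_list_of_set ({1..n + r} - Suc ` A)))
      (map (zero_iter n A i) (sorted_list_of_set ({1..n + r} - A)))"
  proof (induction i)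
    case 0
    have "length (sorted_list_of_set ({1..n + r} - Suc ` A)) = length (sorted_list_of_set ({1..n + r} - A))"
      using complement_Suc_image(1)[OF A(1)] r by simp
    then show ?case by (simp add: interlaced_def)
  next
    case (Suc i)
    show ?case using interlaced_complement(1)[OF step[OF Suc] A(1)] r by simp
  qed
  show "interlaced (map (zero_iter n (Suc ` A) (Suc i)) [1..<Suc (n + r)]) (map (zero_iter n A (Suc i)) [1..<Suc (n + r)])"
    by (rule step[OF *])
qed

text \<open>Only weak inequalities survive the limit, which is why strictness needs a separate
  argument.\<close>

lemma zero_lim_interlace: "interlaced (map (zero_lim n (Suc ` A)) [1..<Suc (n + r)]) (map (zero_lim n A) [1..<Suc (n + r)])"
proof -
  note l' = zero_iter_tendsto[OF n A_bounds(2,3) r, THEN LIMSEQ_Suc] and l = zero_iter_tendsto[OF n A_bounds(1) A(2) r, THEN LIMSEQ_Suc]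
  have i: "\<forall>j\<in>{1..n + r}. zero_iter n (Suc ` A) (Suc i) j \<le> zero_iter n A (Suc i) j"
    "\<forall>j\<in>{1..<n + r}. zero_iter n A (Suc i) j \<le> zero_iter n (Suc ` A) (Suc i) (Suc j)" for i
    using zero_iter_interlace(2)[of i] unfolding interlaced_map_upt_iff by blast+
  show ?thesis unfolding interlaced_map_upt_iff
  proof (intro conjI ballI)
    fix j assume j: "j \<in> {1..n + r}"
    show "zero_lim n (Suc ` A) j \<le> zero_lim n A j"
      by (rule LIMSEQ_le[OF l'[OF j] l[OF j]]) (use i(1) j in blast)
  next
    fix j assume j: "j \<in> {1..<n + r}"
    then have j': "j \<in> {1..n + r}" "Suc j \<in> {1..n + r}" by auto
    show "zero_lim n A j \<le> zero_lim n (Suc ` A) (Suc j)"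
      by (rule LIMSEQ_le[OF l[OF j'(1)] l'[OF j'(2)]]) (use i(2) j in blast)
  qed
qed

end
end

section \<open>Orders of zeros of images\<close>

lemma poly_cp_pcompose: "poly (cp (pcompose p q)) z = poly (cp p) (poly (cp q) z)"
  by (induction p) (auto simp: pcompose_pCons cp_add cp_mult map_poly_pCons)

lemma hyperbolic_pcompose_linear:
  assumes "hyperbolic p" "s \<noteq> 0" shows "hyperbolic (pcompose p [:t, s:])"
  unfolding hyperbolic_def
proof (intro conjI allI impI)
  show "pcompose p [:t, s:] \<noteq> 0"
    using assms by (auto simp: hyperbolic_def pcompose_eq_0_iff)
  fix z assume "poly (cp (pcompose p [:t, s:])) z = 0"
  then have "poly (cp p) (of_real t + z * of_real s) = 0"
    by (simp add: poly_cp_pcompose map_poly_pCons)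
  then have "of_real t + z * of_real s \<in> \<real>" using assms by (auto simp: hyperbolic_def)
  then show "z \<in> \<real>" using assms(2) by (simp add: complex_is_Real_iff)
qed

text \<open>Zooming in at \<^term>\<open>\<theta>\<close> turns the members \<open>q + t p\<close> of the pencil into \<open>q(\<theta>) + C y ^ k\<close>, and
  \<open>1 + y ^ k\<close> is not hyperbolic for \<open>k \<ge> 2\<close>.\<close>

lemma pencil_order:
  assumes pen: "pencil p q" and nz: "p \<noteq> 0" "q \<noteq> 0"
  shows "order \<theta> p \<le> order \<theta> q + 1"
proof (rule ccontr)
  assume *: "\<not> order \<theta> p \<le> order \<theta> q + 1"
  define l k where "l = order \<theta> q" and "k = order \<theta> p - l"
  have k: "k \<ge> 2" "order \<theta> p = l + k" using * by (auto simp: l_def k_def)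
  obtain q1 where q1: "q = [:-\<theta>, 1:] ^ l * q1" "poly q1 \<theta> \<noteq> 0"
    using order_decomp[OF nz(2), of \<theta>] unfolding l_def by (auto simp: poly_eq_0_iff_dvd)
  obtain p2 where p2: "p = [:-\<theta>, 1:] ^ (l + k) * p2" "poly p2 \<theta> \<noteq> 0"
    using order_decomp[OF nz(1), of \<theta>] unfolding k(2) by (auto simp: poly_eq_0_iff_dvd)
  define p1 where "p1 = [:-\<theta>, 1:] ^ k * p2"
  have pen1: "smult a p1 + smult b q1 = 0 \<or> hyperbolic (smult a p1 + smult b q1)" for a b
  proof -
    have "smult a p + smult b q = [:-\<theta>, 1:] ^ l * (smult a p1 + smult b q1)"
      unfolding p1_def by (subst p2(1), subst q1(1)) (simp only: power_add mult_smult_right distrib_left mult.assoc)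
    moreover have "[:-\<theta>, 1:] ^ l \<noteq> 0" by simp
    ultimately show ?thesis using pen unfolding pencil_def by (metis hyperbolic_mult mult_eq_0_iff)
  qed
  \<comment> \<open>Chosen such that \<open>L\<close> becomes \<open>poly q1 \<theta>\<close> times
    1 + y^k.\<close>
  define \<sigma> :: real where "\<sigma> = poly q1 \<theta> / poly p2 \<theta>"
  \<comment> \<open>Under z = \<theta> + y / (j + 1) the polynomial \<open>p1\<close>, of order
    \<open>k\<close> at \<theta>, shrinks by (j + 1)^k; the coefficient compensates for
    this.\<close>
  define R where "R = (\<lambda>j. pcompose (smult (\<sigma> * real (Suc j) ^ k) p1 + smult 1 q1) [:\<theta>, 1 / real (Suc j):])"
  define L where "L = [:poly q1 \<theta>:] + monom (\<sigma> * poly p2 \<theta>) k"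
  have "L = 0 \<or> hyperbolic L"
  proof (rule hyperbolic_tendsto[of sequentially R])
    show "eventually (\<lambda>j. R j = 0 \<or> hyperbolic (R j)) sequentially"
      unfolding R_def using pen1 hyperbolic_pcompose_linear
      by (intro always_eventually allI) (metis divide_eq_0_iff of_nat_eq_0_iff old.nat.distinct(2) pcompose_0 zero_neq_one)
    fix y :: complex
    let ?z = "\<lambda>j. of_real \<theta> + y * of_real (1 / real (Suc j))"
    have "poly (cp (R j)) y = of_real \<sigma> * y ^ k * poly (cp p2) (?z j) + poly (cp q1) (?z j)" for j
    proof -
      have "?z j - of_real \<theta> = y / of_nat (Suc j)" by (simp add: divide_inverse)
      then have "of_nat (Suc j) ^ k * (?z j - of_real \<theta>) ^ k = y ^ k"
        by (simp add: power_divide del: of_nat_Suc)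
      moreover have "poly (cp p1) (?z j) = (?z j - of_real \<theta>) ^ k * poly (cp p2) (?z j)"
      proof -
        have "cp p1 = cp (monic_of (replicate_mset k \<theta>)) * cp p2"
          by (simp add: p1_def monic_of_replicate cp_mult)
        then show ?thesis by (simp add: poly_cp_monic_of del: of_nat_Suc)
      qed
      ultimately have "of_nat (Suc j) ^ k * poly (cp p1) (?z j) = y ^ k * poly (cp p2) (?z j)"
        by (metis mult.assoc)
      moreover have "poly (cp (R j)) y = of_real \<sigma> * (of_nat (Suc j) ^ k * poly (cp p1) (?z j)) + poly (cp q1) (?z j)"
        unfolding R_def poly_cp_pcompose cp_add cp_smult
        by (simp add: map_poly_pCons mult.assoc del: of_nat_Suc)
      ultimately show ?thesis by (simp add: mult.assoc)
    qed
    moreover have z: "?z \<longlonglongrightarrow> of_real \<theta> + y * of_real 0"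
      by (intro tendsto_intros LIMSEQ_Suc[OF lim_const_over_n])
    ultimately have "(\<lambda>j. poly (cp (R j)) y) \<longlonglongrightarrow>
        of_real \<sigma> * y ^ k * poly (cp p2) (of_real \<theta> + y * of_real 0) + poly (cp q1) (of_real \<theta> + y * of_real 0)"
      by (simp only:) (intro tendsto_intros tendsto_poly z)
    then show "(\<lambda>j. poly (cp (R j)) y) \<longlonglongrightarrow> poly (cp L) y"
      by (simp add: L_def cp_add map_poly_pCons map_poly_monom poly_monom poly_cp_of_real algebra_simps)
  qed simp
  moreover have "poly L 0 \<noteq> 0" using k q1 by (simp add: L_def poly_monom power_0_left)
  ultimately have hL: "hyperbolic L" by auto
  have "poly (cp L) z = of_real (poly q1 \<theta>) * (1 + z ^ k)" for z
    using p2(2) by (simp add: L_def \<sigma>_def cp_add map_poly_pCons map_poly_monom poly_monom algebra_simps)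
  moreover have "real k * (pi / real k) = pi" using k(1) by simp
  \<comment> \<open>For \<open>k \<ge> 2\<close> this root of -1 lies in the open upper
    half-plane.\<close>
  then have "cis (pi / k) ^ k = -1" by (simp only: Complex.DeMoivre cis_pi)
  ultimately have 0: "poly (cp L) (cis (pi / k)) = 0" by simp
  have "pi / k < pi" using k by (simp add: field_simps)
  then have "sin (pi / k) > 0" using k by (intro sin_gt_zero) auto
  then show False using hyperbolic_upper[OF hL, of "cis (pi / k)"] 0 by simp
qed

lemma pencil_smult: "pencil f g \<Longrightarrow> pencil (smult a f) (smult b g)"
  unfolding pencil_def by (simp only: smult_smult) blast

lemma pencil_combination: "pencil f g \<Longrightarrow> pencil (smult a f + smult b g) (smult a' f + smult b' g)"
proof -
  assume p: "pencil f g"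
  have "smult x (smult a f + smult b g) + smult y (smult a' f + smult b' g)
    = smult (x * a + y * a') f + smult (x * b + y * b') g" for x y
    by (simp add: smult_add_left smult_add_right)
  with p show ?thesis unfolding pencil_def by metis
qed

text \<open>The logarithmic derivative is the sum of the terms 1 / (z - x), each of negative
  imaginary part; the conjugate again replaces a division.\<close>

lemma Im_pderiv_monic_of:
  assumes "Im z > 0"
  shows "Im (poly (cp (pderiv (monic_of X))) z * cnj (poly (cp (monic_of X)) z)) \<le> 0 \<and>
    (X \<noteq> {#} \<longrightarrow> Im (poly (cp (pderiv (monic_of X))) z * cnj (poly (cp (monic_of X)) z)) < 0)"
proof (induction X)
  case empty
  then show ?case by (simp add: pderiv_1)
next
  case (add x X)
  define h h' u where "h = poly (cp (monic_of X)) z" and "h' = poly (cp (pderiv (monic_of X))) z"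
    and "u = z - of_real x"
  have e: "poly (cp (monic_of (add_mset x X))) z = u * h" "poly (cp (pderiv (monic_of (add_mset x X)))) z = h + u * h'"
    unfolding monic_of_add_mset pderiv_mult cp_add cp_mult h_def h'_def u_def
    by (simp_all add: map_poly_pCons pderiv_pCons cp_mult cp_add algebra_simps)
  have "(h + u * h') * cnj (u * h) = cnj u * (h * cnj h) + (u * cnj u) * (h' * cnj h)"
    by (simp add: algebra_simps)
  also have "\<dots> = of_real ((cmod h)\<^sup>2) * cnj u + of_real ((cmod u)\<^sup>2) * (h' * cnj h)"
    by (simp only: complex_norm_square mult.commute)
  finally have "Im ((h + u * h') * cnj (u * h)) = (cmod h)\<^sup>2 * (- Im z) + (cmod u)\<^sup>2 * Im (h' * cnj h)"
    by (simp add: u_def del: of_real_power)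
  moreover have "(cmod h)\<^sup>2 * (- Im z) < 0"
    using monic_of_upper_nz[OF assms, of X] assms by (simp add: h_def mult_neg_pos mult_less_0_iff)
  moreover have "(cmod u)\<^sup>2 * Im (h' * cnj h) \<le> 0" using add.IH by (auto simp: h_def h'_def intro: mult_nonneg_nonpos)
  ultimately show ?case unfolding e by auto
qed

text \<open>A zero of a nontrivial combination above the real axis would make g' / g real
  there.\<close>

lemma pencil_pderiv:
  assumes "hyperbolic g" shows "pencil g (pderiv g)"
proof -
  define X where "X = proots g"
  have "pencil (monic_of X) (pderiv (monic_of X))"
    unfolding pencil_def
  proof (intro allI)
    fix a b
    let ?h = "smult a (monic_of X) + smult b (pderiv (monic_of X))"
    have "poly (cp ?h) z \<noteq> 0" if nz: "?h \<noteq> 0" and z: "Im z > 0" for z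
    proof
      define A B where "A = poly (cp (monic_of X)) z" and "B = poly (cp (pderiv (monic_of X))) z"
      assume "poly (cp ?h) z = 0"
      then have 0: "of_real a * A + of_real b * B = 0" by (simp add: A_def B_def cp_add cp_smult)
      have A: "A \<noteq> 0" unfolding A_def by (rule monic_of_upper_nz[OF z])
      show False
      proof (cases "b = 0 \<or> X = {#}")
        case True
        then have "of_real a * A = 0" using 0 by (auto simp: B_def pderiv_1)
        then have "a = 0" using A by simp
        with True nz show False by (auto simp: pderiv_1)
      next
        case False
        then have "B = of_real (- a / b) * A" using 0 by (simp add: field_simps add_eq_0_iff)
        then have "B * cnj A = of_real (- a / b) * (A * cnj A)" by simp
        then have "Im (B * cnj A) = 0" by (simp add: complex_mult_cnj)
        with False Im_pderiv_monic_of[OF z, of X] show False by (simp add: A_def B_def)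
      qed
    qed
    then show "?h = 0 \<or> hyperbolic ?h" using hyperbolic_if_upper by blast
  qed
  from pencil_smult[OF this, of "lead_coeff g" "lead_coeff g"] show ?thesis
    using hyperbolic_decompose[OF assms] unfolding X_def by (metis pderiv_smult)
qed

section \<open>Constant coefficient operators and multiple zeros\<close>

lemma dvd_power_if_derivs_vanish:
  fixes p :: "real poly"
  assumes "\<And>j. j < m \<Longrightarrow> poly ((pderiv ^^ j) p) \<theta> = 0"
  shows "[:-\<theta>, 1:] ^ m dvd p"
  using assms
proof (induction m arbitrary: p)
  case (Suc m)
  have "poly ((pderiv ^^ j) (pderiv p)) \<theta> = 0" if "j < m" for j
    using Suc.prems[of "Suc j"] that by (simp add: funpow_swap1)
  from Suc.IH[OF this] have d: "pderiv p = 0 \<or> m \<le> order \<theta> (pderiv p)" by (simp add: order_divides)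
  have 0: "poly p \<theta> = 0" using Suc.prems[of 0] by simp
  show ?case
  proof (cases "p = 0")
    case False
    then have o: "order \<theta> p \<noteq> 0" using 0 by (simp add: order_root)
    have "pderiv p \<noteq> 0"
    proof
      assume "pderiv p = 0"
      then obtain c where "p = [:c:]" by (auto simp: pderiv_eq_0_iff elim: degree_eq_zeroE)
      with 0 False show False by simp
    qed
    then have "order \<theta> p = Suc (order \<theta> (pderiv p))" using False 0 by (intro order_pderiv)
    then have "Suc m \<le> order \<theta> p" using d \<open>pderiv p \<noteq> 0\<close> by simp
    then show ?thesis unfolding order_divides by simp
  qed simp
qed simp

text \<open>The operator S(D), indexed by the polynomial \<open>S\<close> so that a linear factor of
  \<open>S\<close> becomes a composition with D - \<rho>.\<close>

definition dop :: "real poly \<Rightarrow> real poly \<Rightarrow> real poly" where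
  "dop S g = (\<Sum>i\<le>degree S. smult (coeff S i) ((pderiv ^^ i) g))"

lemma dop_bound:
  assumes "degree S \<le> m" shows "dop S g = (\<Sum>i\<le>m. smult (coeff S i) ((pderiv ^^ i) g))"
  unfolding dop_def using assms by (intro sum.mono_neutral_left) (auto simp: coeff_eq_0)

lemma dop_smult: "dop (smult a S) g = smult a (dop S g)"
proof (cases "a = 0")
  case False
  then show ?thesis by (simp add: dop_def) (rule poly_eqI, simp add: coeff_sum sum_distrib_left mult.assoc)
qed (simp add: dop_def)

lemma dop_linear_factor: "dop ([:- \<rho>, 1:] * S) g = pderiv (dop S g) - smult \<rho> (dop S g)"
proof -
  define m where "m = degree S"
  have e: "[:- \<rho>, 1:] * S = pCons 0 S - smult \<rho> S" by simp
  have "degree (pCons 0 S) \<le> Suc m" "degree (smult \<rho> S) \<le> Suc m"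
    by (auto simp: m_def intro: order_trans[OF degree_smult_le] order_trans[OF degree_pCons_le])
  then have d: "degree (pCons 0 S - smult \<rho> S) \<le> Suc m" by (rule degree_diff_le)
  have "(\<Sum>i\<le>Suc m. smult (coeff (pCons 0 S) i) ((pderiv ^^ i) g)) = (\<Sum>i\<le>m. smult (coeff S i) ((pderiv ^^ Suc i) g))"
    by (simp add: sum.atMost_Suc_shift del: sum.atMost_Suc)
  also have "\<dots> = pderiv (dop S g)"
    unfolding dop_def m_def using higher_pderiv_sum[of 1 "\<lambda>i. smult (coeff S i) ((pderiv ^^ i) g)" "{..degree S}"]
    by (simp add: pderiv_smult)
  finally have 1: "(\<Sum>i\<le>Suc m. smult (coeff (pCons 0 S) i) ((pderiv ^^ i) g)) = pderiv (dop S g)" .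
  have "(\<Sum>i\<le>Suc m. smult (coeff (smult \<rho> S) i) ((pderiv ^^ i) g)) = dop (smult \<rho> S) g"
    by (rule dop_bound[symmetric]) (simp add: m_def order_trans[OF degree_smult_le])
  also have "\<dots> = smult \<rho> (dop S g)" by (rule dop_smult)
  finally have 2: "(\<Sum>i\<le>Suc m. smult (coeff (smult \<rho> S) i) ((pderiv ^^ i) g)) = smult \<rho> (dop S g)" .
  show ?thesis unfolding e dop_bound[OF d] coeff_diff smult_diff_left sum_subtractf 1 2 ..
qed

text \<open>By \<open>pencil_order\<close> a multiple zero of g' - \<rho> g forces \<open>g\<close>
  to vanish at \<theta>. If \<open>g\<close> had order less than \<open>m\<close>, then g' would
  vanish at least to the order of \<open>g\<close>, whereas its order is one less.\<close>

lemma order_pderiv_minus_smult: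
  assumes g: "hyperbolic g" and m: "2 \<le> m" and d: "[:-\<theta>, 1:] ^ m dvd pderiv g - smult \<rho> g"
    and nz: "pderiv g - smult \<rho> g \<noteq> 0"
  shows "[:-\<theta>, 1:] ^ m dvd g"
proof (rule ccontr)
  assume nd: "\<not> [:-\<theta>, 1:] ^ m dvd g"
  have g0: "g \<noteq> 0" using g by (auto simp: hyperbolic_def)
  let ?h = "pderiv g - smult \<rho> g"
  have "pencil (smult (-\<rho>) g + smult 1 (pderiv g)) (smult 1 g + smult 0 (pderiv g))"
    by (rule pencil_combination[OF pencil_pderiv[OF g]])
  then have "pencil ?h g" by simp
  from pencil_order[OF this nz g0] have "order \<theta> ?h \<le> order \<theta> g + 1" .
  moreover have "m \<le> order \<theta> ?h" using d nz by (simp only: order_divides) simp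
  ultimately have o1: "order \<theta> g \<ge> 1" using m by linarith
  have om: "order \<theta> g < m" using nd g0 by (simp add: order_divides)
  have "[:-\<theta>, 1:] ^ order \<theta> g dvd smult \<rho> g" by (intro dvd_smult order_1)
  moreover have "[:-\<theta>, 1:] ^ order \<theta> g dvd ?h" using d om by (meson dvd_trans le_imp_power_dvd less_imp_le)
  ultimately have "[:-\<theta>, 1:] ^ order \<theta> g dvd ?h + smult \<rho> g" by (rule dvd_add[rotated])
  then have dd: "[:-\<theta>, 1:] ^ order \<theta> g dvd pderiv g" by simp
  have "pderiv g \<noteq> 0"
  proof
    assume "pderiv g = 0"
    then obtain c where "g = [:c:]" by (auto simp: pderiv_eq_0_iff elim: degree_eq_zeroE)
    with o1 g0 show False by (simp add: order_0I)
  qed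
  moreover have "poly g \<theta> = 0" using o1 by (metis order_0I not_one_le_zero)
  then have "order \<theta> g = Suc (order \<theta> (pderiv g))" using g0 by (intro order_pderiv)
  ultimately show False using dd by (auto simp: order_divides simp del: power_Suc)
qed

text \<open>The factors D - \<rho> are applied one by one; hyperbolicity is carried along because
  the single step needs it.\<close>

lemma dop_order:
  assumes g: "hyperbolic g" and m: "2 \<le> m"
  shows "dop (monic_of X) g = 0 \<or> (hyperbolic (dop (monic_of X) g) \<and>
    ([:-\<theta>, 1:] ^ m dvd dop (monic_of X) g \<longrightarrow> [:-\<theta>, 1:] ^ m dvd g))"
proof (induction X)
  case empty
  then show ?case using g by (simp add: dop_def)
next
  case (add \<rho> X)
  let ?h = "dop (monic_of X) g"
  have e: "dop (monic_of (add_mset \<rho> X)) g = pderiv ?h - smult \<rho> ?h"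
    by (simp only: monic_of_add_mset dop_linear_factor)
  show ?case
  proof (cases "?h = 0 \<or> pderiv ?h - smult \<rho> ?h = 0")
    case False
    with add.IH have h: "hyperbolic ?h" "[:-\<theta>, 1:] ^ m dvd ?h \<longrightarrow> [:-\<theta>, 1:] ^ m dvd g" by auto
    have "smult (-\<rho>) ?h + smult 1 (pderiv ?h) = 0 \<or> hyperbolic (smult (-\<rho>) ?h + smult 1 (pderiv ?h))"
      using pencil_pderiv[OF h(1)] unfolding pencil_def by blast
    then show ?thesis using False h order_pderiv_minus_smult[OF h(1) m, of \<theta> \<rho>] unfolding e by auto
  qed (auto simp: e)
qed

context nondegenerate_preserver
begin

lemma T_low_degree: "degree h < M \<Longrightarrow> T h = 0"
  unfolding diff_op_def by (intro sum.neutral ballI) (simp add: higher_pderiv_degree_less)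

text \<open>\<open>g\<close> and its derivative span a hyperbolic pencil, hence so do their images,
  whose orders at \<theta> are related by \<open>pencil_order\<close>.\<close>

lemma T_pderiv_order:
  assumes g: "hyperbolic g" and d: "[:-\<theta>, 1:] ^ Suc m dvd T g"
  shows "[:-\<theta>, 1:] ^ m dvd T (pderiv g)"
proof (cases "degree g < M \<or> T (pderiv g) = 0")
  case True
  then have "T (pderiv g) = 0" using degree_pderiv[of g] by (auto intro: T_low_degree)
  then show ?thesis by simp
next
  case False
  have "coeff (T g) (degree g + r) = lam (degree g) * lead_coeff g" by (rule coeff_T) simp
  moreover have "lead_coeff g \<noteq> 0" using g by (simp add: hyperbolic_def)
  ultimately have "T g \<noteq> 0" using lam_nz[of "degree g"] False by auto
  then have "order \<theta> (T g) \<le> order \<theta> (T (pderiv g)) + 1"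
    using False by (intro pencil_order T_pencil pencil_pderiv g) auto
  moreover have "Suc m \<le> order \<theta> (T g)" using d \<open>T g \<noteq> 0\<close> by (simp only: order_divides) simp
  ultimately show ?thesis by (simp add: order_divides)
qed

lemma coeff_symbol_at: "coeff (symbol_at \<theta>) k = poly (Q k) \<theta>"
  using supp[of k] by (auto simp: symbol_at_def coeff_sum sum.delta not_less[symmetric])

lemma degree_symbol_at: "degree (symbol_at \<theta>) \<le> N"
  by (rule degree_le) (simp add: coeff_symbol_at supp)

lemma poly_dop_symbol_at: "poly (dop (symbol_at \<theta>) g) \<theta> = poly (T g) \<theta>"
proof -
  have "poly (dop (symbol_at \<theta>) g) \<theta> = (\<Sum>i\<le>N. poly (Q i) \<theta> * poly ((pderiv ^^ i) g) \<theta>)"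
    by (simp add: dop_bound[OF degree_symbol_at] coeff_symbol_at poly_sum)
  also have "\<dots> = (\<Sum>i=M..N. poly (Q i) \<theta> * poly ((pderiv ^^ i) g) \<theta>)"
    by (intro sum.mono_neutral_right) (auto simp: supp)
  finally show ?thesis by (simp add: diff_op_def poly_sum)
qed

lemma higher_pderiv_dop: "(pderiv ^^ j) (dop S g) = dop S ((pderiv ^^ j) g)"
proof -
  have "(pderiv ^^ j) ((pderiv ^^ i) g) = (pderiv ^^ i) ((pderiv ^^ j) g)" for i
    by (metis add.commute comp_apply funpow_add)
  then show ?thesis by (simp add: dop_def higher_pderiv_sum higher_pderiv_smult)
qed

text \<open>The zero of \<^term>\<open>T g\<close> at \<^term>\<open>\<theta>\<close> is inherited by the constant coefficient operator obtained by
  freezing the coefficients at \<^term>\<open>\<theta>\<close>, which is a product of factors \<open>D - \<rho>\<close>.\<close>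

lemma T_order:
  assumes g: "hyperbolic g" and d: "[:-\<theta>, 1:] ^ m dvd T g" and m: "2 \<le> m"
    and nz: "dop (symbol_at \<theta>) g \<noteq> 0"
  shows "[:-\<theta>, 1:] ^ m dvd g"
proof -
  have *: "j \<le> m \<Longrightarrow> [:-\<theta>, 1:] ^ (m - j) dvd T ((pderiv ^^ j) g) \<and> ((pderiv ^^ j) g = 0 \<or> hyperbolic ((pderiv ^^ j) g))" for j
  proof (induction j)
    case (Suc j)
    then have IH: "[:-\<theta>, 1:] ^ (m - j) dvd T ((pderiv ^^ j) g)" "(pderiv ^^ j) g = 0 \<or> hyperbolic ((pderiv ^^ j) g)" by auto
    show ?case
    proof (cases "(pderiv ^^ j) g = 0")
      case False
      then have h: "hyperbolic ((pderiv ^^ j) g)" using IH by simp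
      have "m - j = Suc (m - Suc j)" using Suc.prems by simp
      then have "[:-\<theta>, 1:] ^ (m - Suc j) dvd T (pderiv ((pderiv ^^ j) g))"
        using IH(1) by (intro T_pderiv_order h) simp
      moreover have "pderiv ((pderiv ^^ j) g) = 0 \<or> hyperbolic (pderiv ((pderiv ^^ j) g))"
        using pencil_hyperbolic(2)[OF pencil_pderiv[OF h]] by auto
      ultimately show ?thesis by simp
    qed simp
  qed (use d g in simp)
  have "[:-\<theta>, 1:] ^ m dvd dop (symbol_at \<theta>) g"
  proof (rule dvd_power_if_derivs_vanish)
    fix j assume "j < m"
    then have "[:-\<theta>, 1:] dvd T ((pderiv ^^ j) g)"
      using *[of j] by (meson dvd_power dvd_trans less_imp_le zero_less_diff)
    then show "poly ((pderiv ^^ j) (dop (symbol_at \<theta>) g)) \<theta> = 0"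
      by (simp add: higher_pderiv_dop poly_dop_symbol_at poly_eq_0_iff_dvd)
  qed
  moreover have S0: "symbol_at \<theta> \<noteq> 0" using nz by (auto simp: dop_def)
  then have "symbol_at \<theta> = smult (lead_coeff (symbol_at \<theta>)) (monic_of (proots (symbol_at \<theta>)))"
    using symbol_at_hyperbolic[of \<theta>] hyperbolic_decompose by blast
  then have e: "dop (symbol_at \<theta>) g = smult (lead_coeff (symbol_at \<theta>)) (dop (monic_of (proots (symbol_at \<theta>))) g)"
    by (metis dop_smult)
  ultimately have "[:-\<theta>, 1:] ^ m dvd dop (monic_of (proots (symbol_at \<theta>))) g"
    using S0 by (metis dvd_smult_cancel leading_coeff_0_iff)
  then show ?thesis using dop_order[OF g m, of "proots (symbol_at \<theta>)" \<theta>] nz e by auto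
qed

lemma dop_symbol_at_nonzero:
  assumes "g \<noteq> 0" "poly (Q k) \<theta> \<noteq> 0" "k \<le> degree g"
  shows "dop (symbol_at \<theta>) g \<noteq> 0"
proof -
  define k0 where "k0 = (LEAST k. poly (Q k) \<theta> \<noteq> 0)"
  have k0: "poly (Q k0) \<theta> \<noteq> 0" unfolding k0_def using assms(2) by (rule LeastI)
  have min: "poly (Q i) \<theta> = 0" if "i < k0" for i using not_less_Least that unfolding k0_def by blast
  have kd: "k0 \<le> degree g" using Least_le[of "\<lambda>k. poly (Q k) \<theta> \<noteq> 0", OF assms(2)] assms(3) by (simp add: k0_def)
  have kN: "k0 \<le> N" using k0 supp[of k0] by (auto simp: not_less[symmetric])
  have "coeff (dop (symbol_at \<theta>) g) (degree g - k0) = (\<Sum>i\<le>N. poly (Q i) \<theta> * coeff ((pderiv ^^ i) g) (degree g - k0))"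
    by (simp add: dop_bound[OF degree_symbol_at] coeff_symbol_at coeff_sum)
  also have "\<dots> = (\<Sum>i\<in>{k0}. poly (Q i) \<theta> * coeff ((pderiv ^^ i) g) (degree g - k0))"
  proof (rule sum.mono_neutral_right)
    show "\<forall>i\<in>{..N} - {k0}. poly (Q i) \<theta> * coeff ((pderiv ^^ i) g) (degree g - k0) = 0"
    proof
      fix i assume i: "i \<in> {..N} - {k0}"
      show "poly (Q i) \<theta> * coeff ((pderiv ^^ i) g) (degree g - k0) = 0"
      proof (cases "i < k0")
        case False
        with i kd have "degree g < degree g - k0 + i" by auto
        then show ?thesis by (simp add: coeff_higher_pderiv coeff_eq_0)
      qed (simp add: min)
    qed
  qed (use kN in auto)
  also have "\<dots> = poly (Q k0) \<theta> * (ffactorial (degree g) k0 * lead_coeff g)"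
    by (simp add: coeff_higher_pderiv_ffactorial[OF kd])
  also have "\<dots> \<noteq> 0" using k0 assms(1) ffactorial_pos[OF kd] by auto
  finally show ?thesis by auto
qed

text \<open>By \<open>T_order\<close> a multiple zero of \<open>T f\<close> would be a zero of
  \<open>f\<close> of at least the same order, but the factor \<open>v\<close> gives
  \<open>T f\<close> a strictly larger order than \<open>f\<close>.\<close>

lemma simple_zero:
  assumes f: "hyperbolic f" "degree f = n" and d: "k \<le> n" "poly (Q k) \<theta> \<noteq> 0"
    and T: "T f = v * f" "T f \<noteq> 0" and v: "poly v \<theta> = 0"
  shows "order \<theta> (T f) = 1" "poly f \<theta> \<noteq> 0"
proof -
  have nz: "v \<noteq> 0" "f \<noteq> 0" using T by auto
  have o: "order \<theta> (T f) = order \<theta> v + order \<theta> f" using T by (simp add: order_mult)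
  have ov: "order \<theta> v \<noteq> 0" using v nz by (simp add: order_root)
  have le: "order \<theta> (T f) \<le> 1"
  proof (rule ccontr)
    assume m: "\<not> order \<theta> (T f) \<le> 1"
    have "[:-\<theta>, 1:] ^ order \<theta> (T f) dvd f"
    proof (rule T_order[OF f(1) order_1])
      show "2 \<le> order \<theta> (T f)" using m by simp
      show "dop (symbol_at \<theta>) f \<noteq> 0" by (rule dop_symbol_at_nonzero[OF nz(2) d(2)]) (simp add: f d)
    qed
    then have "order \<theta> (T f) \<le> order \<theta> f" using nz by (simp add: order_divides)
    with o ov show False by simp
  qed
  with o ov show "order \<theta> (T f) = 1" by simp
  with o ov have "order \<theta> f = 0" by simp
  then show "poly f \<theta> \<noteq> 0" using nz by (simp add: order_root)
qed

lemma simple_zero_pderiv: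
  fixes p :: "real poly"
  assumes "p \<noteq> 0" "order \<theta> p = 1" shows "poly p \<theta> = 0" "poly (pderiv p) \<theta> \<noteq> 0"
proof -
  show z: "poly p \<theta> = 0" using assms by (simp add: order_root)
  show "poly (pderiv p) \<theta> \<noteq> 0"
  proof
    assume "poly (pderiv p) \<theta> = 0"
    then have "poly ((pderiv ^^ j) p) \<theta> = 0" if "j < 2" for j using that z by (auto simp: less_2_cases_iff)
    then have "[:-\<theta>, 1:] ^ 2 dvd p" by (rule dvd_power_if_derivs_vanish)
    then show False using assms by (simp add: order_divides)
  qed
qed

lemma no_common_zero:
  assumes f: "degree f = n" "lead_coeff f = 1" and f': "degree f' = n" "lead_coeff f' = 1"
    and pen: "pencil f f'" and ne: "coeff f (n - 1) \<noteq> coeff f' (n - 1)" and n: "M \<le> n" "1 \<le> n"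
    and d: "k \<in> {1..n}" "poly (Q k) \<theta> \<noteq> 0"
    and T: "T f = v * f" "T f' = v' * f'" and v: "poly v \<theta> = 0" "poly v' \<theta> = 0"
  shows False
proof -
  have nz: "f \<noteq> 0" "f' \<noteq> 0" using f f' by auto
  have h: "hyperbolic f" "hyperbolic f'" using pencil_hyperbolic[OF pen] nz by auto
  have Tnz: "T f \<noteq> 0" "T f' \<noteq> 0"
    using T_hyperbolic(1)[OF h(1) f lam_nz[OF n(1)]] T_hyperbolic(1)[OF h(2) f' lam_nz[OF n(1)]]
    by (auto simp: hyperbolic_def)
  have k: "k \<le> n" using d by simp
  note s = simple_zero[OF h(1) f(1) k d(2) T(1) Tnz(1) v(1)]
    and s' = simple_zero[OF h(2) f'(1) k d(2) T(2) Tnz(2) v(2)]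
  define u u' where "u = poly (pderiv (T f)) \<theta>" and "u' = poly (pderiv (T f')) \<theta>"
  have u: "u \<noteq> 0" "u' \<noteq> 0" "poly (T f) \<theta> = 0" "poly (T f') \<theta> = 0"
    using simple_zero_pderiv[OF Tnz(1) s(1)] simple_zero_pderiv[OF Tnz(2) s'(1)] by (auto simp: u_def u'_def)
  \<comment> \<open>The weights make the first derivatives of the two images cancel at
    \<theta>.\<close>
  define g where "g = smult u' f + smult (- u) f'"
  have Tg: "T g = smult u' (T f) + smult (- u) (T f')" by (simp only: g_def T_add T_smult)
  have "poly ((pderiv ^^ j) (T g)) \<theta> = 0" if "j < 2" for j
    using that u unfolding less_2_cases_iff
    by (auto simp: Tg pderiv_add pderiv_diff pderiv_smult pderiv_minus simp flip: u_def u'_def)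
  then have dT: "[:-\<theta>, 1:] ^ 2 dvd T g" by (rule dvd_power_if_derivs_vanish)
  have dg: "n - 1 \<le> degree g" and g0: "g \<noteq> 0"
  proof -
    have "coeff g n \<noteq> 0 \<or> coeff g (n - 1) \<noteq> 0"
    proof (cases "u = u'")
      case True
      then have "coeff g (n - 1) = u * (coeff f (n - 1) - coeff f' (n - 1))" by (simp add: g_def algebra_simps)
      then show ?thesis using ne u by simp
    next
      case False
      then show ?thesis using f f' by (auto simp: g_def)
    qed
    then show "n - 1 \<le> degree g" "g \<noteq> 0" using le_degree[of g n] le_degree[of g "n - 1"] by auto
  qed
  have hg: "hyperbolic g" using pen g0 unfolding pencil_def g_def by blast
  show False
  proof (cases "dop (symbol_at \<theta>) g = 0")
    case False
    then have "[:-\<theta>, 1:] ^ 2 dvd g" by (rule T_order[OF hg dT order_refl])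
    then have "2 \<le> order \<theta> g" using g0 by (simp only: order_divides) simp
    moreover have "pencil g (smult 1 f + smult 0 f')" unfolding g_def by (rule pencil_combination[OF pen])
    then have "order \<theta> g \<le> order \<theta> f + 1" using g0 nz by (intro pencil_order) auto
    moreover have "order \<theta> f = 0" using s(2) by (rule order_0I)
    ultimately show False by simp
  next
    case True
    then have low: "poly (Q i) \<theta> = 0" if "i \<le> n - 1" for i
      using dop_symbol_at_nonzero[OF g0, of i \<theta>] dg that by (meson order_trans)
    have "k = n" using low[of k] d by (cases "k \<le> n - 1") auto
    then have qn: "poly (Q n) \<theta> \<noteq> 0" using d by simp
    have "poly (T f) \<theta> = (\<Sum>i=M..N. poly (Q i) \<theta> * poly ((pderiv ^^ i) f) \<theta>)"
      by (simp add: diff_op_def poly_sum)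
    also have "\<dots> = (\<Sum>i\<in>{n}. poly (Q i) \<theta> * poly ((pderiv ^^ i) f) \<theta>)"
    proof (rule sum.mono_neutral_right)
      have "n \<le> N" using qn supp[of n] by (auto simp: not_less[symmetric])
      then show "{n} \<subseteq> {M..N}" using n by simp
      show "\<forall>i\<in>{M..N} - {n}. poly (Q i) \<theta> * poly ((pderiv ^^ i) f) \<theta> = 0"
      proof
        fix i assume "i \<in> {M..N} - {n}"
        then consider "i \<le> n - 1" | "n < i" by fastforce
        then show "poly (Q i) \<theta> * poly ((pderiv ^^ i) f) \<theta> = 0"
          by cases (auto simp: low higher_pderiv_degree_less f)
      qed
    qed simp
    also have "\<dots> = poly (Q n) \<theta> * poly ((pderiv ^^ n) f) \<theta>" by simp
    also have "(pderiv ^^ n) f = [:fact n:]"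
    proof (rule poly_eqI)
      fix i
      show "coeff ((pderiv ^^ n) f) i = coeff [:fact n:] i"
      proof (cases i)
        case 0
        then show ?thesis using f by (simp add: coeff_higher_pderiv pochhammer_fact[symmetric])
      next
        case (Suc j)
        then show ?thesis using f by (simp add: coeff_higher_pderiv coeff_eq_0)
      qed
    qed
    finally show False using u qn by simp
  qed
qed

end

section \<open>Proper position and strictness\<close>

lemma poly_monic_of_eq_0_iff: "poly (monic_of X) z = 0 \<longleftrightarrow> z \<in># X"
  by (induction X) (auto simp: monic_of_add_mset simp del: mult_pCons_left)

text \<open>A common divisor is again hyperbolic, so a nonconstant one would contribute a common
  real zero.\<close>

lemma coprime_hyperbolic:
  assumes p: "hyperbolic p" and "\<And>x. poly p x = 0 \<Longrightarrow> poly q x \<noteq> 0"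
  shows "coprime p q"
proof (rule coprimeI)
  fix d assume d: "d dvd p" "d dvd q"
  then have h: "hyperbolic d" using p by (auto simp: hyperbolic_mult elim!: dvdE)
  have "proots d = {#}"
  proof (rule ccontr)
    assume "proots d \<noteq> {#}"
    then obtain x where "x \<in># proots d" by auto
    then have "poly d x = 0" using h by (simp add: hyperbolic_def)
    then have "poly p x = 0" "poly q x = 0" using d by (auto elim!: dvdE)
    then show False using assms(2) by blast
  qed
  then have "degree d = 0" using hyperbolic_size_proots[OF h] by simp
  moreover have "d \<noteq> 0" using h by (simp add: hyperbolic_def)
  ultimately show "is_unit d" by (auto simp: is_unit_iff_degree)
qed

lemma zeros_smult_monic_of: "l \<noteq> 0 \<Longrightarrow> sorted xs \<Longrightarrow> zeros (smult l (monic_of (mset xs))) = xs"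
  by (simp add: zeros_def sorted_sort_id)

lemma interlaced_proper_position:
  assumes il: "interlaced xs ys" and l: "l \<noteq> 0"
  defines "p \<equiv> smult l (monic_of (mset xs))" and "q \<equiv> smult l (monic_of (mset ys))"
  shows "p \<lless> q" and "set xs \<inter> set ys = {} \<Longrightarrow> coprime p q \<and> strictly_interlace p q"
proof -
  have z: "zeros p = xs" "zeros q = ys"
    using interlaced_imp_sorted[OF il] l by (simp_all add: p_def q_def zeros_smult_monic_of)
  have h: "hyperbolic p" "hyperbolic q" using l by (simp_all add: p_def q_def hyperbolic_smult hyperbolic_monic_of)
  have len: "length xs = length ys" using il by (simp add: interlaced_def)
  have "interlace p q" using h len interlaced_splice(1)[OF il] by (simp add: interlace_def z alternate_def)
  moreover have "poly (pderiv p * q - p * pderiv q) x \<le> 0" for x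
  proof -
    have "poly (pderiv p * q - p * pderiv q) x = l\<^sup>2 * poly (pderiv (monic_of (mset xs)) * monic_of (mset ys)
        - monic_of (mset xs) * pderiv (monic_of (mset ys))) x"
      by (simp add: p_def q_def pderiv_smult power2_eq_square algebra_simps)
    also have "\<dots> \<le> 0" using ang_le_wronskian[OF interlaced_ang_le[OF il], of x] by (rule mult_nonneg_nonpos[OF zero_le_power2])
    finally show ?thesis .
  qed
  ultimately show "p \<lless> q" by (simp add: proper_position_def)
  assume d: "set xs \<inter> set ys = {}"
  have "coprime p q"
    using d l h by (intro coprime_hyperbolic) (auto simp: p_def q_def poly_monic_of_eq_0_iff)
  moreover have "strictly_interlace p q"
    using h len interlaced_splice(2)[OF il d] by (simp add: strictly_interlace_def z alternate_def)
  ultimately show "coprime p q \<and> strictly_interlace p q" ..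
qed

context nondegenerate_preserver
begin

text \<open>Here the polynomial that defines the starting point may have no zero. Convergence of
  \<open>f\<close> is bypassed: the cofactor is the constant \<open>lam n\<close> at every
  step.\<close>

lemma v_poly_r_0:
  assumes "M \<le> n" "r = 0"
  shows "v_poly M N Q r n {} = smult (lam n) (monic_of (mset []))"
proof -
  have "card ({} :: nat set) = r" using assms(2) by simp
  from v_seq_eq[OF assms(1) empty_subsetI this] show ?thesis
    unfolding v_poly_def by (intro poly_lim_eqI) simp
qed

context
  fixes n :: nat and A :: "nat set"
  assumes n: "M \<le> n" and A: "A \<subseteq> {1..n + r - 1}" "card A = r" and r: "r \<ge> 1"
begin

lemma v_poly_interlace:
  "interlaced (map (zero_lim n A) (sorted_list_of_set A)) (map (zero_lim n (Suc ` A)) (sorted_list_of_set (Suc ` A)))"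
  using interlaced_complement(2)[OF zero_lim_interlace[OF n A r] A(1)] r by simp

lemma v_poly_zeros:
  "v_poly M N Q r n A = smult (lam n) (monic_of (mset (map (zero_lim n A) (sorted_list_of_set A))))"
  "v_poly M N Q r n (Suc ` A) = smult (lam n) (monic_of (mset (map (zero_lim n (Suc ` A)) (sorted_list_of_set (Suc ` A)))))"
  using v_poly_eq[OF n A_bounds(1)[OF n A r] A(2) r] v_poly_eq[OF n A_bounds(2,3)[OF n A r] r]
  by (simp_all add: mset_sorted_list_of_set_eq)

lemma v_poly_disjoint:
  assumes Q: "\<nexists>\<theta>. \<forall>k\<in>{1..n}. poly (Q k) \<theta> = 0"
  shows "set (map (zero_lim n A) (sorted_list_of_set A)) \<inter> set (map (zero_lim n (Suc ` A)) (sorted_list_of_set (Suc ` A))) = {}"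
proof (rule ccontr)
  define m where "m = n + r"
  define x x' where "x = zero_lim n A" and "x' = zero_lim n (Suc ` A)"
  define B B' where "B = sorted_list_of_set ({1..m} - A)" and "B' = sorted_list_of_set ({1..m} - Suc ` A)"
  note Ab = A_bounds[OF n A r]
  have m1: "m \<ge> 1" and Am: "A \<subseteq> {1..m - 1}" using r A by (auto simp: m_def)
  have fA: "finite A" using A(1) finite_subset by blast
  assume "\<not> ?thesis"
  then obtain \<theta> where "\<theta> \<in> x ` A" "\<theta> \<in> x' ` Suc ` A" using fA by (auto simp: x_def x'_def)
  then obtain a a' where a: "a \<in> A" "\<theta> = x a" and a': "a' \<in> Suc ` A" "\<theta> = x' a'" by blast
  obtain k where k: "k \<in> {1..n}" "poly (Q k) \<theta> \<noteq> 0" using Q by blast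
  then have n1: "1 \<le> n" by simp
  have il: "interlaced (map x' [1..<Suc m]) (map x [1..<Suc m])"
    using zero_lim_interlace[OF n A r] by (simp add: x_def x'_def m_def)
  note ilB = interlaced_complement(1)[OF il Am m1, folded B_def B'_def]
  note mono = interlaced_complement(3)[OF il Am m1]
  define F F' where "F = mset (map x B)" and "F' = mset (map x' B')"
  have F: "F = image_mset x (mset_set ({1..n + r} - A))" "F' = image_mset x' (mset_set ({1..n + r} - Suc ` A))"
    by (simp_all add: F_def F'_def B_def B'_def m_def mset_sorted_list_of_set_eq)
  have size: "size F = n" "size F' = n"
    using card_complement[OF n Ab(1) A(2)] card_complement[OF n Ab(2,3)] by (simp_all add: F)
  define f f' where "f = monic_of F" and "f' = monic_of F'"
  define v v' where "v = smult (lam n) (monic_of (image_mset x (mset_set A)))"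
    and "v' = smult (lam n) (monic_of (image_mset x' (mset_set (Suc ` A))))"
  have mon: "degree f = n" "lead_coeff f = 1" "degree f' = n" "lead_coeff f' = 1"
    using lead_coeff_monic_of[of F] lead_coeff_monic_of[of F'] size by (simp_all add: f_def f'_def)
  have T: "T f = smult (lam n) (monic_of (image_mset x (mset_set {1..m})))"
    "T f' = smult (lam n) (monic_of (image_mset x' (mset_set {1..m})))"
    using T_limit[OF n Ab(1) A(2) r] T_limit[OF n Ab(2,3) r] by (simp_all add: f_def f'_def F x_def x'_def m_def)
  have "image_mset x (mset_set {1..m}) = image_mset x (mset_set A) + F"
    "image_mset x' (mset_set {1..m}) = image_mset x' (mset_set (Suc ` A)) + F'"
    by (simp_all only: F m_def image_mset_union[symmetric] mset_set_split[OF Ab(1) finite_atLeastAtMost]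
        mset_set_split[OF Ab(2) finite_atLeastAtMost])
  then have vf: "T f = v * f" "T f' = v' * f'"
    unfolding T unfolding v_def v'_def f_def f'_def by (simp_all only: monic_of_union mult_smult_left)
  have "\<theta> \<in> x ` A" "\<theta> \<in> x' ` Suc ` A" using a a' by blast+
  then have "\<theta> \<in># image_mset x (mset_set A)" "\<theta> \<in># image_mset x' (mset_set (Suc ` A))"
    using fA by simp_all
  then have vz: "poly v \<theta> = 0" "poly v' \<theta> = 0"
    by (simp_all only: v_def v'_def poly_smult poly_monic_of_eq_0_iff[THEN iffD2] mult_zero_right)
  have ang: "ang_le F' F" unfolding F_def F'_def by (rule interlaced_ang_le[OF ilB])
  have Tnz: "T f \<noteq> 0" using lam_nz[OF n] by (simp add: T)
  have hf: "hyperbolic f" by (simp add: f_def hyperbolic_monic_of)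
  have fz: "poly f \<theta> \<noteq> 0" using simple_zero(2)[OF hf mon(1) _ k(2) vf(1) Tnz vz(1)] k(1) by simp
  \<comment> \<open>\<open>no_common_zero\<close> needs different sums of zeros, which by
    \<open>ang_le_sum\<close> follow from this. If \<open>F = F'\<close>, all zeros of the two
    images agree as well, and the shift of the complement makes \<theta> a zero of \<open>f\<close>,
    against \<open>fz\<close>.\<close>
  have "F \<noteq> F'"
  proof
    assume "F = F'"
    then have "f = f'" by (simp add: f_def f'_def)
    then have "monic_of (image_mset x (mset_set {1..m})) = monic_of (image_mset x' (mset_set {1..m}))"
      using T lam_nz[OF n] by (metis smult_cancel)
    then have "image_mset x (mset_set {1..m}) = image_mset x' (mset_set {1..m})" by (metis proots_monic_of)
    then have "mset (map x [1..<Suc m]) = mset (map x' [1..<Suc m])"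
      by (simp add: mset_upt atLeastLessThanSuc_atLeastAtMost del: upt_Suc)
    then have "map x [1..<Suc m] = map x' [1..<Suc m]"
      using interlaced_imp_sorted[OF il] by (metis properties_for_sort sorted_sort_id)
    then have xx': "x i = x' i" if "i \<in> {1..m}" for i using that by (auto simp del: upt_Suc)
    have eq: "map x B = map x' B'"
      using \<open>F = F'\<close> interlaced_imp_sorted[OF ilB] unfolding F_def F'_def by (metis properties_for_sort sorted_sort_id)
    have aA: "1 \<le> a" "a < m" using subsetD[OF Am a(1)] m1 by auto
    have "m \<in> set B" using Am m1 by (auto simp: B_def)
    then obtain j0 where "j0 < length B" "B ! j0 = m" by (auto simp: in_set_conv_nth)
    then have ex: "\<exists>j. j < length B \<and> a \<le> B ! j" using aA by (intro exI[of _ j0]) auto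
    \<comment> \<open>All indices from \<open>a\<close> up to the next element of \<open>B\<close> belong to one run of equal zeros, so \<open>\<theta>\<close> is a zero of \<open>f\<close>.\<close>
    define j where "j = (LEAST j. j < length B \<and> a \<le> B ! j)"
    have j: "j < length B" "a \<le> B ! j" using LeastI_ex[OF ex] unfolding j_def by auto
    note c = complement_Suc_image[OF Am m1, folded B_def B'_def]
    have inB: "B ! i \<in> {1..m} - A" if "i < length B" for i
    proof -
      have "B ! i \<in> set B" using that by (rule nth_mem)
      then show ?thesis by (simp add: B_def)
    qed
    have inB': "B' ! j \<in> {1..m}"
    proof -
      have "B' ! j \<in> set B'" using j c(1) by (metis nth_mem)
      then show ?thesis by (simp add: B'_def)
    qed
    have "B' ! j \<le> a"
    proof (cases j)
      case 0
      then show ?thesis using c(4) j aA by simp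
    next
      case (Suc i)
      then have i: "i < length B" "\<not> a \<le> B ! i"
        using not_less_Least[of i "\<lambda>j. j < length B \<and> a \<le> B ! j"] j by (auto simp: j_def[symmetric])
      then show ?thesis using c(3)[of i] j Suc by simp
    qed
    then have "x (B' ! j) \<le> \<theta>" using mono inB' aA a by auto
    moreover have "\<theta> \<le> x (B ! j)" using mono j inB[OF j(1)] aA a by auto
    moreover have "x (B ! j) = x (B' ! j)"
    proof -
      have "map x B ! j = map x' B' ! j" using eq by simp
      then show ?thesis using j c(1) xx'[OF inB'] by simp
    qed
    ultimately have "\<theta> = x (B ! j)" by simp
    then have "\<theta> \<in># F" using j by (simp add: F_def)
    then show False using fz by (simp add: f_def poly_monic_of_eq_0_iff)
  qed
  then have "sum_mset F' \<noteq> sum_mset F" using ang_le_sum(2)[OF ang] by auto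
  then have ne: "coeff f (n - 1) \<noteq> coeff f' (n - 1)"
    unfolding f_def f'_def using size n1 by (subst (1 2) monic_of_coeff_penultimate) auto
  have "pencil f f'" unfolding f_def f'_def by (rule pencil_sym[OF ang_le_pencil[OF ang]])
  from no_common_zero[OF mon this ne n n1 k vf vz] show False .
qed

end
end

theorem theorem4p6:
  fixes Q :: "nat \<Rightarrow> real poly" and M N r n :: nat and A :: "nat set"
  assumes "\<And>k. k < M \<or> N < k \<Longrightarrow> Q k = 0"
    and "Q M \<noteq> 0" and "Q N \<noteq> 0"
    and "preserves_hyperbolicity (diff_op M N Q)"
    and "fuchs_index M N Q = int r"
    and "nondegenerate M N Q"
    and "M \<le> n"
    and "A \<subseteq> {1..n + r - 1}" and "card A = r"
  shows "v_poly M N Q r n A \<lless> v_poly M N Q r n (Suc ` A) \<and>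
    ((\<nexists>\<theta>::real. \<forall>k\<in>{1..n}. poly (Q k) \<theta> = 0) \<longrightarrow>
      coprime (v_poly M N Q r n A) (v_poly M N Q r n (Suc ` A)) \<and>
      strictly_interlace (v_poly M N Q r n A) (v_poly M N Q r n (Suc ` A)))"
proof -
  interpret nondegenerate_preserver Q M N r
    using assms by unfold_locales blast+
  have n: "M \<le> n" and A: "A \<subseteq> {1..n + r - 1}" "card A = r" by fact+
  have "finite A" using A(1) finite_subset by blast
  show ?thesis
  \<comment> \<open>For \<open>r = 0\<close> both polynomials are the same nonzero constant.\<close>
  proof (cases "r = 0")
    case True
    then have "A = {}" using A(2) \<open>finite A\<close> by simp
    moreover have "interlaced [] []" by (simp add: interlaced_def)
    ultimately show ?thesis
      using v_poly_r_0[OF n True] interlaced_proper_position[of "[]" "[]" "lam n"] lam_nz[OF n] by simp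
  next
    case False
    then have r: "r \<ge> 1" by simp
    show ?thesis
      unfolding v_poly_zeros[OF n A r]
      using interlaced_proper_position[OF v_poly_interlace[OF n A r] lam_nz[OF n]] v_poly_disjoint[OF n A r] by blast
  qed
qed

end
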